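(* (1) Every $\Sigma$-tensor norm on duals $\nu$ on the class of finite dimensional normed spaces defines a $\Sigma$-ideal $[\mathcal{A},A]$ on the class of finite dimensional normed spaces by $$\mathcal{A}^\beta(E_1,\dots,E_n;F):=\left(\mathcal{L}^\beta(E_1,\dots,E_n)\otimes F,\nu_\beta\right)$$ for every election $(n,E_1,\dots,E_n,F,\beta)$ of finite dimensional normed spaces. (2) Conversely, every $\Sigma$-ideal $[\mathcal{A},A]$ on the class of finite dimensional normed spaces defines a $\Sigma$-tensor norm on duals $\nu$ on the class of finite dimensional normed spaces by $$\left(\mathcal{L}^\beta(E_1,\dots,E_n)\otimes F,\nu_\beta\right):=\mathcal{A}^\beta(E_1,\dots,E_n;F)$$ for every election $(n,E_1,\dots,E_n,F,\beta)$ of finite dimensional normed spaces. In both cases the tensor product is identified with the space of multilinear operators $E_1\times\cdots\times E_n\to F$ through $\varphi\otimes y\mapsto\varphi\cdot y$, where $(\varphi\cdot y)(x)=\varphi(x)y$.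
   Context: **Basic notation.** $\mathbb{K}$ is the real or complex field. An election in the class of finite dimensional normed spaces is a tuple $(n,E_1,\dots,E_n,F,\beta)$ with $n$ a positive integer, $E_1,\dots,E_n,F$ finite dimensional normed spaces over $\mathbb{K}$ and $\beta$ a reasonable crossnorm on $E_1\otimes\cdots\otimes E_n$, i.e. a norm with $\varepsilon\le\beta\le\pi$ ($\varepsilon$, $\pi$ the injective and projective tensor norms). $\Sigma_{E_1,\dots,E_n}=\{x^1\otimes\cdots\otimes x^n: x^i\in E_i\}$. For a multilinear map $T$ on $E_1\times\cdots\times E_n$, $\tilde T$ is its linearization on $E_1\otimes\cdots\otimes E_n$ and $f_T=\tilde T|_{\Sigma_{E_1,\dots,E_n}}$; $Lip^\beta(f_T)$ is the Lipschitz constant of $f_T$ for the metric $\beta(p-q)$ on $\Sigma_{E_1,\dots,E_n}$. $\mathcal{L}(E_1,\dots,E_n;F)$ is the space of multilinear operators. $\mathcal{L}^\beta(E_1,\dots,E_n)$ is the space of multilinear forms $\varphi$ with norm $\|\varphi\|_\beta=\|\tilde\varphi:(E_1\otimes\cdots\otimes E_n,\beta)\to\mathbb{K}\|$, identified with $(E_1\otimes\cdots\otimes E_n,\beta)^*$. **$\Sigma$-$\beta$-$\theta$-operators.** Given reasonable crossnorms $\theta$ on $M_1\otimes\cdots\otimes M_m$ and $\beta$ on $E_1\otimes\cdots\otimes E_n$, $f_R$ is a $\Sigma$-$\beta$-$\theta$-operator if $R:M_1\times\cdots\times M_m\to E_1\otimes\cdots\otimes E_n$ is multilinear with values in $\Sigma_{E_1,\dots,E_n}$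 and $\tilde R:(M_1\otimes\cdots\otimes M_m,\theta)\to(E_1\otimes\cdots\otimes E_n,\beta)$ is bounded. **$\Sigma$-ideal** (on finite dimensional normed spaces): an assignment $[\mathcal{A},A]$ to each election of a linear subspace $\mathcal{A}^\beta(E_1,\dots,E_n;F)$ of $\mathcal{L}(E_1,\dots,E_n;F)$ and a complete norm $A^\beta$ on it such that: (I1) for $\varphi\in\mathcal{L}^\beta(E_1,\dots,E_n)$, $y\in F$, $\varphi\cdot y\in\mathcal{A}^\beta(E_1,\dots,E_n;F)$ and $A^\beta(\varphi\cdot y)\le\|\varphi\|_\beta\|y\|$; (I2) $Lip^\beta(f_T)\le A^\beta(T)$ for all $T\in\mathcal{A}^\beta(E_1,\dots,E_n;F)$; (I3) if $f_R:\Sigma_{M_1,\dots,M_m}\to\Sigma_{E_1,\dots,E_n}$ is a $\Sigma$-$\beta$-$\theta$-operator, $T\in\mathcal{A}^\beta(E_1,\dots,E_n;F)$ and $S:F\to N$ is linear, then $Sf_TR\in\mathcal{A}^\theta(M_1,\dots,M_m;N)$ and $A^\theta(Sf_TR)\le\|\tilde R\|A^\beta(T)\|S\|$. **$\Sigma$-tensor norm on duals** (on finite dimensional normed spaces): a linear operator $A:\mathcal{L}^\beta(E_1,\dots,E_n)\to\mathcal{L}^\theta(M_1,\dots,M_m)$ preserves $\Sigma$ if its adjoint $A^*:(M_1\otimes\cdots\otimes M_m,\theta)^{**}\to(E_1\otimes\cdots\otimes E_n,\beta)^{**}$ maps the canonical image of $\Sigma_{M_1,\dots,M_m}$ into the canonical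 image of $\Sigma_{E_1,\dots,E_n}$. A $\Sigma$-tensor norm on duals $\nu$ assigns to each election a norm $\nu_\beta$ on $\mathcal{L}^\beta(E_1,\dots,E_n)\otimes F$ such that: (D1) $\nu_\beta(\varphi\otimes y)\le\|\varphi\|_\beta\|y\|$; (D2) for $p,q\in\Sigma_{E_1,\dots,E_n}$, $y^*\in F^*$, the functional $\varphi\otimes y\mapsto(f_\varphi(p)-f_\varphi(q))y^*(y)$ has norm $\le\beta(p-q)\|y^*\|$; (D3) if $A:\mathcal{L}^\beta(E_1,\dots,E_n)\to\mathcal{L}^\theta(M_1,\dots,M_m)$ is linear and preserves $\Sigma$ and $B:F\to N$ is linear, then $A\otimes B:(\mathcal{L}^\beta(E_1,\dots,E_n)\otimes F,\nu_\beta)\to(\mathcal{L}^\theta(M_1,\dots,M_m)\otimes N,\nu_\theta)$ has norm $\le\|A\|\|B\|$. *)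

theory Defs
  imports Complex_Main "HOL-Library.FuncSet" "HOL-Algebra.Module"
begin

section \<open>The scalar field\<close>

text \<open>A normed field that is the real or the complex field, up to an isometric isomorphism.\<close>

class real_or_complex = real_normed_field +
  assumes real_or_complex:
    "\<exists>f :: 'a \<Rightarrow> complex.
       (\<forall>x y. f (x + y) = f x + f y) \<and> (\<forall>x y. f (x * y) = f x * f y) \<and>
       (\<forall>x. norm (f x) = norm x) \<and> (range f = \<real> \<or> range f = UNIV)"

instance real :: real_or_complex
  by standard (rule exI[of _ complex_of_real], auto simp: Reals_def)

instance complex :: real_or_complex
  by standard (rule exI[of _ id], auto)

definition scalar_ring :: "('k::real_or_complex) ring" where
  "scalar_ring = \<lparr>carrier = UNIV, monoid.mult = (*), one = 1, zero = 0, add = (+)\<rparr>"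


section \<open>Normed spaces\<close>

text \<open>
  Normed spaces live on carrier sets, so that one can quantify over all finite dimensional normed
  spaces with carrier in an arbitrary type \<open>'a\<close>, and over lists of them. The fields \<open>mult\<close> and
  \<open>one\<close>, which the record type \<open>module\<close> inherits from rings, play no role.
\<close>

record ('k, 'v) normed_space = "('k, 'v) module" +
  vnorm :: "'v \<Rightarrow> real"

definition with_norm ::
    "('k, 'v, 'm) module_scheme \<Rightarrow> ('v \<Rightarrow> real) \<Rightarrow> ('k, 'v) normed_space" where
  "with_norm V N =
     \<lparr>carrier = carrier V, monoid.mult = monoid.mult V, one = one V, zero = zero V, add = add V,
      smult = smult V, vnorm = N\<rparr>"

definition is_norm :: "('k::real_or_complex, 'v, 'm) module_scheme \<Rightarrow> ('v \<Rightarrow> real) \<Rightarrow> bool" where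
  "is_norm V N \<longleftrightarrow>
     (\<forall>v\<in>carrier V. 0 \<le> N v) \<and>
     (\<forall>v\<in>carrier V. N v = 0 \<longleftrightarrow> v = \<zero>\<^bsub>V\<^esub>) \<and>
     (\<forall>a. \<forall>v\<in>carrier V. N (a \<odot>\<^bsub>V\<^esub> v) = norm a * N v) \<and>
     (\<forall>u\<in>carrier V. \<forall>v\<in>carrier V. N (u \<oplus>\<^bsub>V\<^esub> v) \<le> N u + N v)"

definition is_complete :: "('k, 'v) normed_space \<Rightarrow> bool" where
  "is_complete V \<longleftrightarrow>
     (\<forall>s :: nat \<Rightarrow> 'v. (\<forall>i. s i \<in> carrier V) \<longrightarrow>
        (\<forall>e>0. \<exists>n0. \<forall>i\<ge>n0. \<forall>j\<ge>n0. vnorm V (s i \<ominus>\<^bsub>V\<^esub> s j) < e) \<longrightarrow>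
        (\<exists>v\<in>carrier V. (\<lambda>i. vnorm V (s i \<ominus>\<^bsub>V\<^esub> v)) \<longlonglongrightarrow> 0))"

definition fin_dim_normed_space :: "('k::real_or_complex, 'v) normed_space \<Rightarrow> bool" where
  "fin_dim_normed_space V \<longleftrightarrow>
     module scalar_ring V \<and> is_norm V (vnorm V) \<and>
     (\<exists>B. finite B \<and> B \<subseteq> carrier V \<and>
        (\<forall>v\<in>carrier V. \<exists>c :: 'v \<Rightarrow> 'k. v = (\<Oplus>\<^bsub>V\<^esub>b\<in>B. c b \<odot>\<^bsub>V\<^esub> b)))"

definition scalar_space :: "('k::real_or_complex, 'k) normed_space" where
  "scalar_space =
     \<lparr>carrier = UNIV, monoid.mult = (*), one = 1, zero = 0, add = (+), smult = (*), vnorm = norm\<rparr>"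

text \<open>Maps are functions on the carrier, extended by \<open>undefined\<close>; this makes them unique.\<close>

definition linear_maps ::
    "('k, 'v, 'm) module_scheme \<Rightarrow> ('k, 'w, 'n) module_scheme \<Rightarrow> ('v \<Rightarrow> 'w) set" where
  "linear_maps V W =
     {f \<in> carrier V \<rightarrow>\<^sub>E carrier W.
        (\<forall>u\<in>carrier V. \<forall>v\<in>carrier V. f (u \<oplus>\<^bsub>V\<^esub> v) = f u \<oplus>\<^bsub>W\<^esub> f v) \<and>
        (\<forall>a. \<forall>v\<in>carrier V. f (a \<odot>\<^bsub>V\<^esub> v) = a \<odot>\<^bsub>W\<^esub> f v)}"

definition bounded_map ::
    "('k, 'v) normed_space \<Rightarrow> ('k, 'w) normed_space \<Rightarrow> ('v \<Rightarrow> 'w) \<Rightarrow> bool" where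
  "bounded_map V W f \<longleftrightarrow> (\<exists>C. \<forall>v\<in>carrier V. vnorm W (f v) \<le> C * vnorm V v)"

text \<open>Only applied to linear maps between finite dimensional spaces, where the supremum is finite.\<close>

definition op_norm ::
    "('k, 'v) normed_space \<Rightarrow> ('k, 'w) normed_space \<Rightarrow> ('v \<Rightarrow> 'w) \<Rightarrow> real" where
  "op_norm V W f = Sup {vnorm W (f v) | v. v \<in> carrier V \<and> vnorm V v \<le> 1}"

definition isometric_iso ::
    "('k, 'v) normed_space \<Rightarrow> ('k, 'w) normed_space \<Rightarrow> ('v \<Rightarrow> 'w) \<Rightarrow> bool" where
  "isometric_iso V W f \<longleftrightarrow>
     f \<in> linear_maps V W \<and> bij_betw f (carrier V) (carrier W) \<and>
     (\<forall>v\<in>carrier V. vnorm W (f v) = vnorm V v)"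


section \<open>Tensor products\<close>

text \<open>
  A tensor product is realised as the span of the elementary tensors inside the algebraic dual of
  the space \<open>\<Phi>\<close> of multilinear forms: for \<open>x\<close> in the product set \<open>X\<close>, the elementary tensor is
  evaluation at \<open>x\<close>. The linearization of a multilinear map \<open>T\<close> on \<open>X\<close> is the unique linear map
  that sends the elementary tensor of \<open>x\<close> to \<open>T x\<close>.
\<close>

definition evaluation :: "('x \<Rightarrow> 'k) set \<Rightarrow> 'x \<Rightarrow> (('x \<Rightarrow> 'k) \<Rightarrow> 'k)" where
  "evaluation \<Phi> x = (\<lambda>\<phi>\<in>\<Phi>. \<phi> x)"

definition evaluation_span ::
    "'x set \<Rightarrow> ('x \<Rightarrow> 'k) set \<Rightarrow> ('k::real_or_complex, ('x \<Rightarrow> 'k) \<Rightarrow> 'k) module" where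
  "evaluation_span X \<Phi> =
     \<lparr>carrier = {(\<lambda>\<phi>\<in>\<Phi>. \<Sum>x\<in>B. c x * evaluation \<Phi> x \<phi>) | B c. finite B \<and> B \<subseteq> X},
      monoid.mult = undefined, one = undefined,
      zero = (\<lambda>\<phi>\<in>\<Phi>. 0), add = (\<lambda>u v. \<lambda>\<phi>\<in>\<Phi>. u \<phi> + v \<phi>), smult = (\<lambda>a u. \<lambda>\<phi>\<in>\<Phi>. a * u \<phi>)\<rparr>"

definition linearization ::
    "'x set \<Rightarrow> ('x \<Rightarrow> 'k::real_or_complex) set \<Rightarrow> ('k, 'w, 'n) module_scheme \<Rightarrow> ('x \<Rightarrow> 'w) \<Rightarrow>
     ((('x \<Rightarrow> 'k) \<Rightarrow> 'k) \<Rightarrow> 'w)" where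
  "linearization X \<Phi> W T =
     (THE L. L \<in> linear_maps (evaluation_span X \<Phi>) W \<and> (\<forall>x\<in>X. L (evaluation \<Phi> x) = T x))"


subsection \<open>Multilinear maps and $E_1 \otimes \cdots \otimes E_n$\<close>

definition tuples :: "('k, 'a) normed_space list \<Rightarrow> 'a list set" where
  "tuples Es = listset (map carrier Es)"

definition multilinear_maps ::
    "('k, 'a) normed_space list \<Rightarrow> ('k, 'w, 'n) module_scheme \<Rightarrow> ('a list \<Rightarrow> 'w) set" where
  "multilinear_maps Es W =
     {T \<in> tuples Es \<rightarrow>\<^sub>E carrier W.
        \<forall>x\<in>tuples Es. \<forall>i<length Es. (\<lambda>v\<in>carrier (Es ! i). T (x[i := v])) \<in> linear_maps (Es ! i) W}"

definition multilinear_space ::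
    "('k, 'a) normed_space list \<Rightarrow> ('k, 'w, 'n) module_scheme \<Rightarrow> ('k, 'a list \<Rightarrow> 'w) module" where
  "multilinear_space Es W =
     \<lparr>carrier = multilinear_maps Es W, monoid.mult = undefined, one = undefined,
      zero = (\<lambda>x\<in>tuples Es. \<zero>\<^bsub>W\<^esub>),
      add = (\<lambda>S T. \<lambda>x\<in>tuples Es. S x \<oplus>\<^bsub>W\<^esub> T x),
      smult = (\<lambda>a T. \<lambda>x\<in>tuples Es. a \<odot>\<^bsub>W\<^esub> T x)\<rparr>"

abbreviation multilinear_forms ::
    "('k::real_or_complex, 'a) normed_space list \<Rightarrow> ('a list \<Rightarrow> 'k) set" where
  "multilinear_forms Es \<equiv> multilinear_maps Es scalar_space"

type_synonym ('k, 'a) tensor = "('a list \<Rightarrow> 'k) \<Rightarrow> 'k"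

definition tensor_space ::
    "('k::real_or_complex, 'a) normed_space list \<Rightarrow> ('k, ('k, 'a) tensor) module" where
  "tensor_space Es = evaluation_span (tuples Es) (multilinear_forms Es)"

definition elementary_tensor ::
    "('k::real_or_complex, 'a) normed_space list \<Rightarrow> 'a list \<Rightarrow> ('k, 'a) tensor" where
  "elementary_tensor Es x = evaluation (multilinear_forms Es) x"

definition Sigma_set :: "('k::real_or_complex, 'a) normed_space list \<Rightarrow> ('k, 'a) tensor set" where
  "Sigma_set Es = elementary_tensor Es ` tuples Es"

definition lin ::
    "('k::real_or_complex, 'a) normed_space list \<Rightarrow> ('k, 'w, 'n) module_scheme \<Rightarrow>
     ('a list \<Rightarrow> 'w) \<Rightarrow> (('k, 'a) tensor \<Rightarrow> 'w)" where
  "lin Es W T = linearization (tuples Es) (multilinear_forms Es) W T"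

text \<open>The map $f_T$.\<close>

definition Sigma_map ::
    "('k::real_or_complex, 'a) normed_space list \<Rightarrow> ('k, 'w, 'n) module_scheme \<Rightarrow>
     ('a list \<Rightarrow> 'w) \<Rightarrow> (('k, 'a) tensor \<Rightarrow> 'w)" where
  "Sigma_map Es W T = restrict (lin Es W T) (Sigma_set Es)"


subsection \<open>The tensor product of two spaces\<close>

definition bilinear_forms ::
    "('k::real_or_complex, 'v, 'm) module_scheme \<Rightarrow> ('k, 'w, 'n) module_scheme \<Rightarrow>
     ('v \<times> 'w \<Rightarrow> 'k) set" where
  "bilinear_forms V W =
     {b \<in> carrier V \<times> carrier W \<rightarrow>\<^sub>E UNIV.
        (\<forall>v\<in>carrier V. (\<lambda>w\<in>carrier W. b (v, w)) \<in> linear_maps W scalar_space) \<and>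
        (\<forall>w\<in>carrier W. (\<lambda>v\<in>carrier V. b (v, w)) \<in> linear_maps V scalar_space)}"

definition tensor2 ::
    "('k::real_or_complex, 'v, 'm) module_scheme \<Rightarrow> ('k, 'w, 'n) module_scheme \<Rightarrow>
     ('k, ('v \<times> 'w \<Rightarrow> 'k) \<Rightarrow> 'k) module" where
  "tensor2 V W = evaluation_span (carrier V \<times> carrier W) (bilinear_forms V W)"

definition elementary2 ::
    "('k::real_or_complex, 'v, 'm) module_scheme \<Rightarrow> ('k, 'w, 'n) module_scheme \<Rightarrow>
     'v \<Rightarrow> 'w \<Rightarrow> (('v \<times> 'w \<Rightarrow> 'k) \<Rightarrow> 'k)" where
  "elementary2 V W v w = evaluation (bilinear_forms V W) (v, w)"

definition lin2 ::
    "('k::real_or_complex, 'v, 'm) module_scheme \<Rightarrow> ('k, 'w, 'n) module_scheme \<Rightarrow>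
     ('k, 'z, 'p) module_scheme \<Rightarrow> ('v \<Rightarrow> 'w \<Rightarrow> 'z) \<Rightarrow> ((('v \<times> 'w \<Rightarrow> 'k) \<Rightarrow> 'k) \<Rightarrow> 'z)" where
  "lin2 V W Z T =
     linearization (carrier V \<times> carrier W) (bilinear_forms V W) Z (\<lambda>(v, w). T v w)"


section \<open>Reasonable crossnorms and elections\<close>

definition injective_norm ::
    "('k::real_or_complex, 'a) normed_space list \<Rightarrow> ('k, 'a) tensor \<Rightarrow> real" where
  "injective_norm Es u =
     Sup {norm (lin Es scalar_space (\<lambda>x\<in>tuples Es. \<Prod>i<length Es. (\<phi> i) (x ! i)) u) | \<phi>.
            \<forall>i<length Es. \<phi> i \<in> linear_maps (Es ! i) scalar_space \<and>
                          op_norm (Es ! i) scalar_space (\<phi> i) \<le> 1}"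

definition projective_norm ::
    "('k::real_or_complex, 'a) normed_space list \<Rightarrow> ('k, 'a) tensor \<Rightarrow> real" where
  "projective_norm Es u =
     Inf {(\<Sum>j<m. \<Prod>i<length Es. vnorm (Es ! i) (x j ! i)) | (m::nat) x.
            (\<forall>j<m. x j \<in> tuples Es) \<and>
            u = (\<Oplus>\<^bsub>tensor_space Es\<^esub>j\<in>{..<m}. elementary_tensor Es (x j))}"

definition reasonable_crossnorm ::
    "('k::real_or_complex, 'a) normed_space list \<Rightarrow> (('k, 'a) tensor \<Rightarrow> real) \<Rightarrow> bool" where
  "reasonable_crossnorm Es \<beta> \<longleftrightarrow>
     is_norm (tensor_space Es) \<beta> \<and>
     (\<forall>u\<in>carrier (tensor_space Es). injective_norm Es u \<le> \<beta> u \<and> \<beta> u \<le> projective_norm Es u)"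

definition spaces_with_crossnorm ::
    "('k::real_or_complex, 'a) normed_space list \<Rightarrow> (('k, 'a) tensor \<Rightarrow> real) \<Rightarrow> bool" where
  "spaces_with_crossnorm Es \<beta> \<longleftrightarrow>
     Es \<noteq> [] \<and> (\<forall>E\<in>set Es. fin_dim_normed_space E) \<and> reasonable_crossnorm Es \<beta>"

definition election ::
    "('k::real_or_complex, 'a) normed_space list \<Rightarrow> ('k, 'a) normed_space \<Rightarrow>
     (('k, 'a) tensor \<Rightarrow> real) \<Rightarrow> bool" where
  "election Es F \<beta> \<longleftrightarrow> spaces_with_crossnorm Es \<beta> \<and> fin_dim_normed_space F"

abbreviation normed_tensor ::
    "('k::real_or_complex, 'a) normed_space list \<Rightarrow> (('k, 'a) tensor \<Rightarrow> real) \<Rightarrow>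
     ('k, ('k, 'a) tensor) normed_space" where
  "normed_tensor Es \<beta> \<equiv> with_norm (tensor_space Es) \<beta>"

definition forms_space ::
    "('k::real_or_complex, 'a) normed_space list \<Rightarrow> (('k, 'a) tensor \<Rightarrow> real) \<Rightarrow>
     ('k, 'a list \<Rightarrow> 'k) normed_space" where
  "forms_space Es \<beta> =
     with_norm (multilinear_space Es scalar_space)
       (\<lambda>\<phi>. op_norm (normed_tensor Es \<beta>) scalar_space (lin Es scalar_space \<phi>))"

definition Lip ::
    "('k::real_or_complex, 'a) normed_space list \<Rightarrow> (('k, 'a) tensor \<Rightarrow> real) \<Rightarrow>
     ('k, 'w) normed_space \<Rightarrow> (('k, 'a) tensor \<Rightarrow> 'w) \<Rightarrow> real" where
  "Lip Es \<beta> F f =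
     Inf {C. 0 \<le> C \<and> (\<forall>p\<in>Sigma_set Es. \<forall>q\<in>Sigma_set Es.
            vnorm F (f p \<ominus>\<^bsub>F\<^esub> f q) \<le> C * \<beta> (p \<ominus>\<^bsub>tensor_space Es\<^esub> q))}"

definition form_times_vector ::
    "('k::real_or_complex, 'a) normed_space list \<Rightarrow> ('k, 'w, 'n) module_scheme \<Rightarrow>
     ('a list \<Rightarrow> 'k) \<Rightarrow> 'w \<Rightarrow> ('a list \<Rightarrow> 'w)" where
  "form_times_vector Es F \<phi> y = (\<lambda>x\<in>tuples Es. \<phi> x \<odot>\<^bsub>F\<^esub> y)"


section \<open>$\Sigma$-ideals\<close>

text \<open>\<open>Sigma_operator Ms \<theta> Es \<beta> R\<close>: $f_R$ is a $\Sigma$-$\beta$-$\theta$-operator.\<close>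

definition Sigma_operator ::
    "('k::real_or_complex, 'a) normed_space list \<Rightarrow> (('k, 'a) tensor \<Rightarrow> real) \<Rightarrow>
     ('k, 'a) normed_space list \<Rightarrow> (('k, 'a) tensor \<Rightarrow> real) \<Rightarrow>
     ('a list \<Rightarrow> ('k, 'a) tensor) \<Rightarrow> bool" where
  "Sigma_operator Ms \<theta> Es \<beta> R \<longleftrightarrow>
     R \<in> multilinear_maps Ms (tensor_space Es) \<and>
     (\<forall>x\<in>tuples Ms. R x \<in> Sigma_set Es) \<and>
     bounded_map (normed_tensor Ms \<theta>) (normed_tensor Es \<beta>) (lin Ms (tensor_space Es) R)"

type_synonym ('k, 'a) space_assignment =
  "('k, 'a) normed_space list \<Rightarrow> ('k, 'a) normed_space \<Rightarrow> (('k, 'a) tensor \<Rightarrow> real) \<Rightarrow>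
   ('a list \<Rightarrow> 'a) set"

type_synonym ('k, 'a) norm_assignment =
  "('k, 'a) normed_space list \<Rightarrow> ('k, 'a) normed_space \<Rightarrow> (('k, 'a) tensor \<Rightarrow> real) \<Rightarrow>
   ('a list \<Rightarrow> 'a) \<Rightarrow> real"

definition component ::
    "('k, 'a) space_assignment \<Rightarrow> ('k, 'a) norm_assignment \<Rightarrow>
     ('k::real_or_complex, 'a) normed_space list \<Rightarrow> ('k, 'a) normed_space \<Rightarrow>
     (('k, 'a) tensor \<Rightarrow> real) \<Rightarrow> ('k, 'a list \<Rightarrow> 'a) normed_space" where
  "component \<A> A Es F \<beta> = with_norm (multilinear_space Es F \<lparr>carrier := \<A> Es F \<beta>\<rparr>) (A Es F \<beta>)"

definition Sigma_ideal ::
    "('k::real_or_complex, 'a) space_assignment \<Rightarrow> ('k, 'a) norm_assignment \<Rightarrow> bool" where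
  "Sigma_ideal \<A> A \<longleftrightarrow>
     (\<forall>Es F \<beta>. election Es F \<beta> \<longrightarrow>
        submodule (\<A> Es F \<beta>) scalar_ring (multilinear_space Es F) \<and>
        is_norm (component \<A> A Es F \<beta>) (A Es F \<beta>) \<and>
        is_complete (component \<A> A Es F \<beta>)) \<and>
     (\<forall>Es F \<beta>. election Es F \<beta> \<longrightarrow>
        (\<forall>\<phi>\<in>carrier (forms_space Es \<beta>). \<forall>y\<in>carrier F.
           form_times_vector Es F \<phi> y \<in> \<A> Es F \<beta> \<and>
           A Es F \<beta> (form_times_vector Es F \<phi> y) \<le> vnorm (forms_space Es \<beta>) \<phi> * vnorm F y)) \<and>
     (\<forall>Es F \<beta>. election Es F \<beta> \<longrightarrow>
        (\<forall>T\<in>\<A> Es F \<beta>. Lip Es \<beta> F (Sigma_map Es F T) \<le> A Es F \<beta> T)) \<and>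
     (\<forall>Es F \<beta> Ms N \<theta> R T S.
        election Es F \<beta> \<longrightarrow> election Ms N \<theta> \<longrightarrow>
        Sigma_operator Ms \<theta> Es \<beta> R \<longrightarrow> T \<in> \<A> Es F \<beta> \<longrightarrow> S \<in> linear_maps F N \<longrightarrow>
        (\<lambda>x\<in>tuples Ms. S (Sigma_map Es F T (R x))) \<in> \<A> Ms N \<theta> \<and>
        A Ms N \<theta> (\<lambda>x\<in>tuples Ms. S (Sigma_map Es F T (R x)))
          \<le> op_norm (normed_tensor Ms \<theta>) (normed_tensor Es \<beta>) (lin Ms (tensor_space Es) R)
             * A Es F \<beta> T * op_norm F N S)"


section \<open>$\Sigma$-tensor norms on duals\<close>

text \<open>
  The dual of the normed tensor product is identified with the space of multilinear forms, so the
  bidual consists of the linear functionals on that space.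
\<close>

definition canonical_image ::
    "('k::real_or_complex, 'a) normed_space list \<Rightarrow> ('k, 'a) tensor \<Rightarrow>
     (('a list \<Rightarrow> 'k) \<Rightarrow> 'k)" where
  "canonical_image Es p = (\<lambda>\<phi>\<in>multilinear_forms Es. lin Es scalar_space \<phi> p)"

definition adjoint :: "('k, 'v, 'm) module_scheme \<Rightarrow> ('v \<Rightarrow> 'w) \<Rightarrow> ('w \<Rightarrow> 'k) \<Rightarrow> ('v \<Rightarrow> 'k)" where
  "adjoint V f \<psi> = (\<lambda>v\<in>carrier V. \<psi> (f v))"

definition preserves_Sigma ::
    "('k::real_or_complex, 'a) normed_space list \<Rightarrow> (('k, 'a) tensor \<Rightarrow> real) \<Rightarrow>
     ('k, 'a) normed_space list \<Rightarrow> (('k, 'a) tensor \<Rightarrow> real) \<Rightarrow>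
     (('a list \<Rightarrow> 'k) \<Rightarrow> ('a list \<Rightarrow> 'k)) \<Rightarrow> bool" where
  "preserves_Sigma Es \<beta> Ms \<theta> f \<longleftrightarrow>
     f \<in> linear_maps (forms_space Es \<beta>) (forms_space Ms \<theta>) \<and>
     adjoint (forms_space Es \<beta>) f ` canonical_image Ms ` Sigma_set Ms
       \<subseteq> canonical_image Es ` Sigma_set Es"

type_synonym ('k, 'a) dual_tensor = "(('a list \<Rightarrow> 'k) \<times> 'a \<Rightarrow> 'k) \<Rightarrow> 'k"

definition dual_tensor_space ::
    "('k::real_or_complex, 'a) normed_space list \<Rightarrow> ('k, 'a) normed_space \<Rightarrow>
     ('k, ('k, 'a) dual_tensor) module" where
  "dual_tensor_space Es F = tensor2 (multilinear_space Es scalar_space) F"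

type_synonym ('k, 'a) dual_norm_assignment =
  "('k, 'a) normed_space list \<Rightarrow> ('k, 'a) normed_space \<Rightarrow> (('k, 'a) tensor \<Rightarrow> real) \<Rightarrow>
   ('k, 'a) dual_tensor \<Rightarrow> real"

abbreviation normed_dual_tensor ::
    "('k, 'a) dual_norm_assignment \<Rightarrow> ('k::real_or_complex, 'a) normed_space list \<Rightarrow>
     ('k, 'a) normed_space \<Rightarrow> (('k, 'a) tensor \<Rightarrow> real) \<Rightarrow>
     ('k, ('k, 'a) dual_tensor) normed_space" where
  "normed_dual_tensor \<nu> Es F \<beta> \<equiv> with_norm (dual_tensor_space Es F) (\<nu> Es F \<beta>)"

definition Sigma_tensor_norm_on_duals ::
    "('k::real_or_complex, 'a) dual_norm_assignment \<Rightarrow> bool" where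
  "Sigma_tensor_norm_on_duals \<nu> \<longleftrightarrow>
     (\<forall>Es F \<beta>. election Es F \<beta> \<longrightarrow> is_norm (dual_tensor_space Es F) (\<nu> Es F \<beta>)) \<and>
     (\<forall>Es F \<beta>. election Es F \<beta> \<longrightarrow>
        (\<forall>\<phi>\<in>carrier (forms_space Es \<beta>). \<forall>y\<in>carrier F.
           \<nu> Es F \<beta> (elementary2 (multilinear_space Es scalar_space) F \<phi> y)
             \<le> vnorm (forms_space Es \<beta>) \<phi> * vnorm F y)) \<and>
     (\<forall>Es F \<beta> p q y'.
        election Es F \<beta> \<longrightarrow> p \<in> Sigma_set Es \<longrightarrow> q \<in> Sigma_set Es \<longrightarrow>
        y' \<in> linear_maps F scalar_space \<longrightarrow>
        op_norm (normed_dual_tensor \<nu> Es F \<beta>) scalar_space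
          (lin2 (multilinear_space Es scalar_space) F scalar_space
             (\<lambda>\<phi> y. (Sigma_map Es scalar_space \<phi> p - Sigma_map Es scalar_space \<phi> q) * y' y))
          \<le> \<beta> (p \<ominus>\<^bsub>tensor_space Es\<^esub> q) * op_norm F scalar_space y') \<and>
     (\<forall>Es F \<beta> Ms N \<theta> f g.
        election Es F \<beta> \<longrightarrow> election Ms N \<theta> \<longrightarrow>
        preserves_Sigma Es \<beta> Ms \<theta> f \<longrightarrow> g \<in> linear_maps F N \<longrightarrow>
        op_norm (normed_dual_tensor \<nu> Es F \<beta>) (normed_dual_tensor \<nu> Ms N \<theta>)
          (lin2 (multilinear_space Es scalar_space) F (dual_tensor_space Ms N)
             (\<lambda>\<phi> y. elementary2 (multilinear_space Ms scalar_space) N (f \<phi>) (g y)))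
          \<le> op_norm (forms_space Es \<beta>) (forms_space Ms \<theta>) f * op_norm F N g)"


section \<open>The identification\<close>

text \<open>The linear map that sends $\varphi \otimes y$ to $\varphi \cdot y$.\<close>

definition identification ::
    "('k::real_or_complex, 'a) normed_space list \<Rightarrow> ('k, 'a) normed_space \<Rightarrow>
     (('k, 'a) dual_tensor \<Rightarrow> ('a list \<Rightarrow> 'a))" where
  "identification Es F =
     lin2 (multilinear_space Es scalar_space) F (multilinear_space Es F) (form_times_vector Es F)"

text \<open>The assignments obtained by transporting spaces and norms along the identification.\<close>

definition ideal_of_spaces :: "('k::real_or_complex, 'a) space_assignment" where
  "ideal_of_spaces Es F \<beta> = identification Es F ` carrier (dual_tensor_space Es F)"

definition ideal_of_norm ::
    "('k::real_or_complex, 'a) dual_norm_assignment \<Rightarrow> ('k, 'a) norm_assignment" where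
  "ideal_of_norm \<nu> Es F \<beta> T =
     \<nu> Es F \<beta> (inv_into (carrier (dual_tensor_space Es F)) (identification Es F) T)"

definition dual_norm_of ::
    "('k::real_or_complex, 'a) norm_assignment \<Rightarrow> ('k, 'a) dual_norm_assignment" where
  "dual_norm_of A Es F \<beta> u = A Es F \<beta> (identification Es F u)"

end

theory Submission
  imports Defs
begin

text \<open>
  Everything is transported along the identification \<open>\<phi> \<otimes> y \<mapsto> \<phi> \<cdot> y\<close>, which is bijective onto all
  multilinear maps because coordinates \<open>\<epsilon>\<^sub>b\<close> of \<open>F\<close> give \<open>T = \<Sum>\<^sub>b (\<epsilon>\<^sub>b \<circ> T) \<cdot> b\<close>; by (I1) a
  \<open>\<Sigma>\<close>-ideal therefore contains every multilinear map. If \<open>T\<close> corresponds to \<open>u\<close>, the functional in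
  (D2) maps \<open>u\<close> to \<open>y' (f\<^sub>T p - f\<^sub>T q)\<close>, so that (I2) and (D2) are equivalent by the Hahn--Banach
  theorem in \<open>F\<close>. For (I3) and (D3), a \<open>\<Sigma>\<close>-operator \<open>R\<close> induces \<open>\<phi> \<mapsto> \<phi> \<circ> R\<close>, which preserves
  \<open>\<Sigma>\<close>. Conversely, an operator preserving \<open>\<Sigma>\<close> has an adjoint that restricts to such an \<open>R\<close>, and
  the two operator norms agree by the Hahn--Banach theorem in the normed tensor product.
\<close>

section \<open>Scalars\<close>

text \<open>Two features of the definitions shape the proof. First, \<open>op_norm\<close> is a
  supremum, \<open>Lip\<close> an infimum and \<open>linearization\<close> a definite description,
  so each carries information only after boundedness, an admissible constant, or existence and
  uniqueness has been established. Boundedness of the linear maps involved rests on the equivalence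
  of norms in finite dimension, proved here for carrier sets over an abstract copy of the real or
  complex field; the same argument gives the completeness demanded of an ideal. Second, a tensor is
  a functional on forms. The linearization of a form is then evaluation at it, and the canonical map
  into the bidual is the identity, so that preserving \<Sigma> says that an adjoint maps elementary
  tensors to elementary tensors. For a linearization to exist it is enough that linear functionals
  separate the points of the target, which holds for spaces of evaluations before any norm is
  considered. Finite dimension is likewise obtained by exhibiting finitely many separating
  functionals; these are easier to transfer through spaces of maps and tensor products than spanning
  sets.\<close>

lemma scalar_ring_simps [simp]:
  "carrier scalar_ring = UNIV" "monoid.mult scalar_ring = (*)" "one scalar_ring = 1"
  "zero scalar_ring = 0" "add scalar_ring = (+)"
  by (simp_all add: scalar_ring_def)

lemma scalar_space_simps [simp]:
  "carrier scalar_space = UNIV" "zero scalar_space = 0" "add scalar_space = (+)"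
  "smult scalar_space = (*)" "vnorm scalar_space = norm"
  by (simp_all add: scalar_space_def)

lemma with_norm_simps [simp]:
  "carrier (with_norm V N) = carrier V" "zero (with_norm V N) = zero V"
  "add (with_norm V N) = add V" "smult (with_norm V N) = smult V" "vnorm (with_norm V N) = N"
  by (simp_all add: with_norm_def)

lemma minus_with_norm [simp]: "x \<ominus>\<^bsub>with_norm V N\<^esub> y = x \<ominus>\<^bsub>V\<^esub> y"
  by (simp add: a_minus_def a_inv_def m_inv_def)

lemma cring_scalar_ring: "cring (scalar_ring :: 'k::real_or_complex ring)"
proof (rule cringI)
  show "abelian_group (scalar_ring :: 'k ring)"
    by (rule abelian_groupI) (auto simp: algebra_simps intro: exI[of _ "- _"])
  show "comm_monoid (scalar_ring :: 'k ring)"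
    by (rule comm_monoidI) (auto simp: algebra_simps)
qed (auto simp: algebra_simps)

lemma scalar_ring_uminus [simp]: "\<ominus>\<^bsub>scalar_ring\<^esub> (a :: 'k::real_or_complex) = - a"
proof -
  interpret cring "scalar_ring :: 'k ring" by (rule cring_scalar_ring)
  show ?thesis using minus_equality[of "- a" a] by simp
qed


text \<open>
  An additive isometry with \<open>h 1 = 1\<close> fixes every real number \<open>r\<close>: the distances \<open>\<bar>r\<bar>\<close> and
  \<open>\<bar>r - 1\<bar>\<close> to \<open>0\<close> and \<open>1\<close> determine the image of \<open>r\<close> in the complex plane.
\<close>

lemma scalar_embedding:
  obtains h :: "'k::real_or_complex \<Rightarrow> complex"
  where "\<And>x y. h (x + y) = h x + h y" "\<And>x y. h (x - y) = h x - h y"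
    "\<And>x y. h (x * y) = h x * h y" "\<And>x. norm (h x) = norm x"
    "\<And>r. h (of_real r) = of_real r" "inj h" "range h = \<real> \<or> range h = UNIV"
proof -
  obtain h :: "'k \<Rightarrow> complex" where add: "\<And>x y. h (x + y) = h x + h y"
    and mult: "\<And>x y. h (x * y) = h x * h y" and norm: "\<And>x. norm (h x) = norm x"
    and range: "range h = \<real> \<or> range h = UNIV"
    using real_or_complex[where 'a='k] by blast
  have diff: "h (x - y) = h x - h y" for x y
    using add[of "x - y" y] by (simp add: algebra_simps)
  have "h 1 * h 1 = h 1" "h 1 \<noteq> 0"
    using mult[of 1 1] norm[of 1] by auto
  then have one: "h 1 = 1" by simp
  have real: "h (of_real r) = of_real r" for r
  proof -
    let ?z = "h (of_real r)"
    have "norm (?z - 1) = norm (of_real r - 1 :: 'k)"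
      using norm[of "of_real r - 1"] diff[of "of_real r" 1] one by simp
    also have "\<dots> = norm (of_real (r - 1) :: 'k)" by simp
    also have "\<dots> = \<bar>r - 1\<bar>" by (rule norm_of_real)
    finally have "(cmod (?z - 1))\<^sup>2 = (r - 1)\<^sup>2" by simp
    then have 1: "(Re ?z - 1)\<^sup>2 + (Im ?z)\<^sup>2 = (r - 1)\<^sup>2" by (simp add: cmod_power2)
    have "(cmod ?z)\<^sup>2 = r\<^sup>2" by (simp add: norm)
    then have 2: "(Re ?z)\<^sup>2 + (Im ?z)\<^sup>2 = r\<^sup>2" by (simp add: cmod_power2)
    from 1 2 have "Re ?z = r" by (simp add: power2_eq_square algebra_simps)
    with 2 show ?thesis by (simp add: complex_eq_iff)
  qed
  have "inj h"
    using diff norm by (metis injI eq_iff_diff_eq_0 norm_eq_zero)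
  with add diff mult norm real range show ?thesis using that by blast
qed

text \<open>The field has no \<open>Re\<close> and \<open>Im\<close> of its own. The complex case
  therefore provides a preimage \<open>i\<close> of the imaginary unit, the decomposition into real
  and imaginary part, and the bound of the real part by the norm; together they suffice for the
  Hahn--Banach theorem.\<close>

lemma scalar_cases:
  obtains (real) "\<And>a :: 'k::real_or_complex. \<exists>r. a = of_real r"
  | (complex) i :: "'k::real_or_complex" where "i * i = - 1"
      "\<And>a. \<exists>x y. a = of_real x + of_real y * i"
      "\<And>x y. \<bar>x\<bar> \<le> norm (of_real x + of_real y * i)"
proof -
  obtain h :: "'k \<Rightarrow> complex"
    where h: "\<And>x y. h (x + y) = h x + h y" "\<And>x y. h (x - y) = h x - h y"
      "\<And>x y. h (x * y) = h x * h y" "\<And>x. norm (h x) = norm x"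
      "\<And>r. h (of_real r) = of_real r"
      and "inj h" and range: "range h = \<real> \<or> range h = UNIV"
    by (rule scalar_embedding) (rule that)
  from range show ?thesis
  proof
    assume "range h = \<real>"
    show ?thesis
    proof (rule real)
      fix a
      have "h a \<in> \<real>" using \<open>range h = \<real>\<close> by blast
      then obtain r where "h a = of_real r" by (rule Reals_cases)
      then have "h a = h (of_real r)" using h(5) by simp
      then show "\<exists>r. a = of_real r" using injD[OF \<open>inj h\<close>] by blast
    qed
  next
    assume surj: "range h = UNIV"
    then obtain i where i: "h i = \<i>" by (metis rangeE UNIV_I)
    have m1: "h (- 1) = - 1" using h(5)[of "- 1"] by simp
    have "h (i * i) = h (- 1)" using m1 by (simp add: h(3) i)
    then have "i * i = - 1" using \<open>inj h\<close> by (rule injD[rotated])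
    moreover have "\<exists>x y. a = of_real x + of_real y * i" for a
    proof (intro exI)
      have "h a = h (of_real (Re (h a)) + of_real (Im (h a)) * i)"
        by (simp add: h(1,3,5) i complex_eq_iff)
      then show "a = of_real (Re (h a)) + of_real (Im (h a)) * i"
        using \<open>inj h\<close> by (rule injD[rotated])
    qed
    moreover have "\<bar>x\<bar> \<le> norm (of_real x + of_real y * i)" for x y
    proof -
      have "Re (h (of_real x + of_real y * i)) = x" by (simp add: h(1,3,5) i)
      then show ?thesis using abs_Re_le_cmod[of "h (of_real x + of_real y * i)"] h(4) by simp
    qed
    ultimately show ?thesis by (rule complex)
  qed
qed

lemma scalar_Cauchy_convergent:
  fixes X :: "nat \<Rightarrow> 'k::real_or_complex"
  assumes "Cauchy X"
  shows "convergent X"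
proof -
  obtain h :: "'k \<Rightarrow> complex"
    where "\<And>x y. h (x + y) = h x + h y" and h: "\<And>x y. h (x - y) = h x - h y"
      and "\<And>x y. h (x * y) = h x * h y" and norm: "\<And>x. norm (h x) = norm x"
      and "\<And>r. h (of_real r) = of_real r"
      and "inj h" and range: "range h = \<real> \<or> range h = UNIV"
    by (rule scalar_embedding) (rule that)
  have dist: "dist (h x) (h y) = dist x y" for x y
    by (metis dist_norm h norm)
  have "Cauchy (\<lambda>n. h (X n))" using assms by (simp add: Cauchy_def dist)
  then obtain z where z: "(\<lambda>n. h (X n)) \<longlonglongrightarrow> z"
    using Cauchy_convergent convergentD by blast
  \<comment> \<open>Both possible ranges are closed in the complex plane: a limit of real numbers
    equals its own real part.\<close>
  have "z \<in> range h"
    using range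
  proof
    assume "range h = \<real>"
    then have "h (X n) \<in> \<real>" for n by blast
    then have "of_real (Re (h (X n))) = h (X n)" for n by (rule of_real_Re)
    then have "(\<lambda>n. h (X n)) \<longlonglongrightarrow> of_real (Re z)"
      using tendsto_of_real[OF tendsto_Re[OF z], where 'a=complex] by simp
    with z have "z = of_real (Re z)" by (rule LIMSEQ_unique)
    then have "z \<in> \<real>" by (metis Reals_of_real)
    then show ?thesis using \<open>range h = \<real>\<close> by simp
  qed simp
  then obtain x where x: "z = h x" by blast
  have "X \<longlonglongrightarrow> x"
    using z unfolding x tendsto_iff dist .
  then show ?thesis by (rule convergentI)
qed


section \<open>Vector spaces on carrier sets\<close>

lemma linear_mapsD:
  assumes "f \<in> linear_maps V W"
  shows "v \<in> carrier V \<Longrightarrow> f v \<in> carrier W"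
    and "u \<in> carrier V \<Longrightarrow> v \<in> carrier V \<Longrightarrow> f (u \<oplus>\<^bsub>V\<^esub> v) = f u \<oplus>\<^bsub>W\<^esub> f v"
    and "v \<in> carrier V \<Longrightarrow> f (a \<odot>\<^bsub>V\<^esub> v) = a \<odot>\<^bsub>W\<^esub> f v"
    and "f \<in> extensional (carrier V)"
  using assms by (auto simp: linear_maps_def PiE_def)

lemma linear_mapsI:
  assumes "\<And>v. v \<in> carrier V \<Longrightarrow> f v \<in> carrier W"
    and "\<And>u v. u \<in> carrier V \<Longrightarrow> v \<in> carrier V \<Longrightarrow> f (u \<oplus>\<^bsub>V\<^esub> v) = f u \<oplus>\<^bsub>W\<^esub> f v"
    and "\<And>a v. v \<in> carrier V \<Longrightarrow> f (a \<odot>\<^bsub>V\<^esub> v) = a \<odot>\<^bsub>W\<^esub> f v"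
    and "f \<in> extensional (carrier V)"
  shows "f \<in> linear_maps V W"
  using assms by (auto simp: linear_maps_def PiE_def)

lemma linear_maps_with_norm [simp]:
  "linear_maps (with_norm V N) W = linear_maps V W"
  "linear_maps V (with_norm W M) = linear_maps V W"
  by (simp_all add: linear_maps_def)

locale kspace = module "scalar_ring :: 'k::real_or_complex ring" V
  for V :: "('k::real_or_complex, 'v, 'm) module_scheme" (structure)
begin

text \<open>This and the following lemmas rephrase the module laws without the side condition that
  scalars lie in \<open>carrier scalar_ring\<close>, which is the whole type.\<close>

lemma scale_closed [simp, intro]: "v \<in> carrier V \<Longrightarrow> a \<odot> v \<in> carrier V"
  by simp

lemma scale_left_distrib: "v \<in> carrier V \<Longrightarrow> (a + b) \<odot> v = a \<odot> v \<oplus> b \<odot> v"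
  using smult_l_distr[of a b v] by simp

lemma scale_right_distrib:
  "u \<in> carrier V \<Longrightarrow> v \<in> carrier V \<Longrightarrow> a \<odot> (u \<oplus> v) = a \<odot> u \<oplus> a \<odot> v"
  using smult_r_distr[of a u v] by simp

lemma scale_scale [simp]: "v \<in> carrier V \<Longrightarrow> a \<odot> (b \<odot> v) = (a * b) \<odot> v"
  using smult_assoc1[of a b v] by simp

lemma scale_one [simp]: "v \<in> carrier V \<Longrightarrow> 1 \<odot> v = v"
  using smult_one[of v] by simp

lemma scale_zero [simp]: "v \<in> carrier V \<Longrightarrow> 0 \<odot> v = \<zero>"
  using smult_l_null[of v] by simp

lemma scale_zero_right [simp]: "a \<odot> \<zero> = \<zero>"
  using smult_r_null[of a] by simp

lemma scale_minus_one: "v \<in> carrier V \<Longrightarrow> (- 1) \<odot> v = \<ominus> v"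
  using smult_l_minus[of 1 v] by simp

lemma minus_eq_scale: "u \<in> carrier V \<Longrightarrow> v \<in> carrier V \<Longrightarrow> u \<ominus> v = u \<oplus> (- 1) \<odot> v"
  by (simp add: scale_minus_one minus_eq)

lemma add_cancel: "u \<in> carrier V \<Longrightarrow> u \<oplus> (- 1) \<odot> u = \<zero>"
  by (simp add: scale_minus_one r_neg)

lemma eqI_minus: "u \<in> carrier V \<Longrightarrow> v \<in> carrier V \<Longrightarrow> u \<ominus> v = \<zero> \<Longrightarrow> u = v"
proof -
  assume uv: "u \<in> carrier V" "v \<in> carrier V" and eq: "u \<ominus> v = \<zero>"
  have "u = (u \<ominus> v) \<oplus> v" using uv by (simp add: minus_eq a_assoc l_neg)
  then show "u = v" using uv eq by simp
qed

lemma add_interchange: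
  "\<lbrakk>a \<in> carrier V; b \<in> carrier V; c \<in> carrier V; d \<in> carrier V\<rbrakk>
    \<Longrightarrow> (a \<oplus> b) \<oplus> (c \<oplus> d) = (a \<oplus> c) \<oplus> (b \<oplus> d)"
  by (simp add: a_ac)

lemma minus_trans:
  assumes "a \<in> carrier V" "b \<in> carrier V" "c \<in> carrier V"
  shows "a \<ominus> c = (a \<ominus> b) \<oplus> (b \<ominus> c)"
proof -
  have "(a \<ominus> b) \<oplus> (b \<ominus> c) = (a \<oplus> (- 1) \<odot> c) \<oplus> (b \<oplus> (- 1) \<odot> b)"
    using assms by (simp add: minus_eq_scale a_ac)
  then show ?thesis using assms by (simp add: minus_eq_scale add_cancel)
qed

lemma finsum_scale:
  "finite A \<Longrightarrow> f \<in> A \<rightarrow> carrier V \<Longrightarrow> a \<odot> finsum V f A = finsum V (\<lambda>i. a \<odot> f i) A"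
  using finsum_smult_ldistr[of A a f] by simp

section \<open>Linear subspaces, finite combinations and unique decompositions\<close>

definition subspace :: "'v set \<Rightarrow> bool" where
  "subspace U \<longleftrightarrow> U \<subseteq> carrier V \<and> \<zero> \<in> U \<and> (\<forall>u\<in>U. \<forall>v\<in>U. u \<oplus> v \<in> U) \<and> (\<forall>a. \<forall>u\<in>U. a \<odot> u \<in> U)"

lemma subspaceD:
  assumes "subspace U"
  shows "u \<in> U \<Longrightarrow> u \<in> carrier V" "\<zero> \<in> U" "u \<in> U \<Longrightarrow> v \<in> U \<Longrightarrow> u \<oplus> v \<in> U"
    "u \<in> U \<Longrightarrow> a \<odot> u \<in> U" "u \<in> U \<Longrightarrow> v \<in> U \<Longrightarrow> u \<ominus> v \<in> U"
  using assms by (auto simp: subspace_def minus_eq_scale subset_eq)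

lemma finsum_in_set:
  assumes "U \<subseteq> carrier V" "\<zero> \<in> U" "\<And>u v. u \<in> U \<Longrightarrow> v \<in> U \<Longrightarrow> u \<oplus> v \<in> U"
    and "finite A" "\<And>i. i \<in> A \<Longrightarrow> f i \<in> U"
  shows "finsum V f A \<in> U"
  using assms(4,5)
proof (induction A)
  case (insert i A)
  then show ?case using assms(1-3) by (auto simp: Pi_iff subset_eq)
qed (simp add: assms)

lemma finsum_combination_diff:
  assumes "finite I" "I \<subseteq> carrier V"
  shows "(\<Oplus>b\<in>I. c b \<odot> b) \<ominus> (\<Oplus>b\<in>I. d b \<odot> b) = (\<Oplus>b\<in>I. (c b - d b) \<odot> b)"
proof -
  have cl: "(\<lambda>b. f b \<odot> b) \<in> I \<rightarrow> carrier V" for f using assms by auto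
  have "(\<Oplus>b\<in>I. (c b - d b) \<odot> b) = (\<Oplus>b\<in>I. c b \<odot> b \<oplus> (- 1) \<odot> (d b \<odot> b))"
    using assms
    by (intro finsum_cong') (auto simp: scale_left_distrib[symmetric] subset_eq)
  also have "\<dots> = (\<Oplus>b\<in>I. c b \<odot> b) \<oplus> (- 1) \<odot> (\<Oplus>b\<in>I. d b \<odot> b)"
    using assms by (subst finsum_addf) (auto simp: cl finsum_scale)
  finally show ?thesis using cl by (simp add: minus_eq_scale)
qed

lemma subspace_carrier: "subspace (carrier V)"
  by (simp add: subspace_def)

text \<open>If the coefficients differed, \<open>b\<close> would be \<open>u' - u\<close> multiplied
  by \<open>1 / (c - c')\<close>, hence lie in \<open>U\<close>. The set \<open>D\<close> of
  admissible coefficients is the whole field when frames are extended and \<real> in the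
  Hahn--Banach argument, where \<open>U\<close> is closed only under real scalars.\<close>

lemma line_decomposition_unique:
  fixes c c' :: 'k
  assumes U: "U \<subseteq> carrier V" "\<And>u v. u \<in> U \<Longrightarrow> v \<in> U \<Longrightarrow> u \<oplus> v \<in> U"
    and D: "\<And>a u. a \<in> D \<Longrightarrow> u \<in> U \<Longrightarrow> a \<odot> u \<in> U" "D = UNIV \<or> D = \<real>"
    and b: "b \<in> carrier V" "b \<notin> U"
    and "u \<in> U" "u' \<in> U" "c \<in> D" "c' \<in> D" and eq: "u \<oplus> c \<odot> b = u' \<oplus> c' \<odot> b"
  shows "c = c' \<and> u = u'"
proof
  have uc: "u \<in> carrier V" "u' \<in> carrier V" using assms by auto
  show "c = c'"
  proof (rule ccontr)
    assume "c \<noteq> c'"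
    have "(c - c') \<odot> b = u' \<oplus> (- 1) \<odot> u"
    proof -
      have "(c - c') \<odot> b = (u \<oplus> c \<odot> b) \<oplus> ((- c') \<odot> b \<oplus> (- 1) \<odot> u)"
      proof -
        have "(u \<oplus> c \<odot> b) \<oplus> ((- c') \<odot> b \<oplus> (- 1) \<odot> u) = (u \<oplus> (- 1) \<odot> u) \<oplus> (c \<odot> b \<oplus> (- c') \<odot> b)"
          using uc b by (simp add: a_ac)
        then show ?thesis using uc b by (simp add: add_cancel flip: scale_left_distrib)
      qed
      also have "\<dots> = (c' \<odot> b \<oplus> (- c') \<odot> b) \<oplus> (u' \<oplus> (- 1) \<odot> u)"
        unfolding eq using uc b by (simp add: a_ac)
      also have "\<dots> = u' \<oplus> (- 1) \<odot> u"
        using uc b by (simp flip: scale_left_distrib)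
      finally show ?thesis .
    qed
    moreover have "1 / (c - c') \<in> D" "- 1 \<in> D" using D(2) assms(9,10) by auto
    ultimately have "(1 / (c - c')) \<odot> ((c - c') \<odot> b) \<in> U"
      using assms(7,8) U D(1) by metis
    then show False using b \<open>c \<noteq> c'\<close> by simp
  qed
  then show "u = u'" using eq uc b by simp
qed

end

lemma kspace_iff: "kspace V \<longleftrightarrow> module scalar_ring V"
  by (simp add: kspace_def)

text \<open>\<open>with_norm\<close> copies the module fields into a new record, so the two
  predicates are compared after unfolding them to statements about these fields.\<close>

lemma kspace_with_norm [simp]: "kspace (with_norm V N) = kspace V"
  by (simp add: kspace_iff module_def abelian_group_def abelian_monoid_def
      abelian_group_axioms_def module_axioms_def
      comm_group_def group_def group_axioms_def Units_def Group.comm_monoid_def monoid_def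
      comm_monoid_axioms_def)

lemma finsum_with_norm [simp]: "finsum (with_norm V N) = finsum V"
  by (simp add: fun_eq_iff finsum_def finprod_def)

text \<open>The inverse of \<open>v\<close> is supplied as \<open>(- 1) \<odot> v\<close>, so that
  no existence statement has to be proved for a concrete space.\<close>

lemma kspaceI:
  fixes V (structure)
  assumes "\<And>u v. u \<in> carrier V \<Longrightarrow> v \<in> carrier V \<Longrightarrow> u \<oplus> v \<in> carrier V"
    and "\<zero> \<in> carrier V"
    and "\<And>u v w. u \<in> carrier V \<Longrightarrow> v \<in> carrier V \<Longrightarrow> w \<in> carrier V \<Longrightarrow> (u \<oplus> v) \<oplus> w = u \<oplus> (v \<oplus> w)"
    and "\<And>u v. u \<in> carrier V \<Longrightarrow> v \<in> carrier V \<Longrightarrow> u \<oplus> v = v \<oplus> u"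
    and "\<And>v. v \<in> carrier V \<Longrightarrow> \<zero> \<oplus> v = v"
    and "\<And>v. v \<in> carrier V \<Longrightarrow> (- 1) \<odot> v \<oplus> v = \<zero>"
    and "\<And>(a :: 'k::real_or_complex) v. v \<in> carrier V \<Longrightarrow> a \<odot> v \<in> carrier V"
    and "\<And>(a :: 'k) b v. v \<in> carrier V \<Longrightarrow> (a + b) \<odot> v = a \<odot> v \<oplus> b \<odot> v"
    and "\<And>(a :: 'k) u v. u \<in> carrier V \<Longrightarrow> v \<in> carrier V \<Longrightarrow> a \<odot> (u \<oplus> v) = a \<odot> u \<oplus> a \<odot> v"
    and "\<And>(a :: 'k) b v. v \<in> carrier V \<Longrightarrow> (a * b) \<odot> v = a \<odot> (b \<odot> v)"
    and "\<And>v. v \<in> carrier V \<Longrightarrow> (1 :: 'k) \<odot> v = v"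
  shows "kspace V"
  unfolding kspace_iff
proof (rule moduleI[OF cring_scalar_ring])
  show "abelian_group V"
  proof (rule abelian_groupI)
    show "\<exists>u\<in>carrier V. u \<oplus> v = \<zero>" if "v \<in> carrier V" for v
      using assms(6,7)[OF that] by blast
  qed (rule assms(1-5); assumption)+
qed (unfold scalar_ring_simps, (rule assms(7-11); assumption)+)

lemma kspace_scalar_space: "kspace scalar_space"
  by (rule kspaceI) (simp_all add: algebra_simps)

lemma linear_map_scalarD:
  assumes "f \<in> linear_maps V scalar_space"
  shows "u \<in> carrier V \<Longrightarrow> v \<in> carrier V \<Longrightarrow> f (u \<oplus>\<^bsub>V\<^esub> v) = f u + f v"
    and "v \<in> carrier V \<Longrightarrow> f (a \<odot>\<^bsub>V\<^esub> v) = a * f v"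
  using linear_mapsD[OF assms] by auto

lemma linear_map_zero:
  assumes "kspace V" "kspace W" "f \<in> linear_maps V W"
  shows "f \<zero>\<^bsub>V\<^esub> = \<zero>\<^bsub>W\<^esub>"
proof -
  interpret V: kspace V by fact
  interpret W: kspace W by fact
  have "f (0 \<odot>\<^bsub>V\<^esub> \<zero>\<^bsub>V\<^esub>) = 0 \<odot>\<^bsub>W\<^esub> f \<zero>\<^bsub>V\<^esub>" using linear_mapsD(3)[OF assms(3)] by blast
  then show ?thesis using linear_mapsD(1)[OF assms(3), of "\<zero>\<^bsub>V\<^esub>"] by simp
qed

lemma linear_map_minus:
  assumes "kspace V" "kspace W" "f \<in> linear_maps V W" "u \<in> carrier V" "v \<in> carrier V"
  shows "f (u \<ominus>\<^bsub>V\<^esub> v) = f u \<ominus>\<^bsub>W\<^esub> f v"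
proof -
  interpret V: kspace V by fact
  interpret W: kspace W by fact
  show ?thesis
    using linear_mapsD(1-3)[OF assms(3)] assms(4,5) by (simp add: V.minus_eq_scale W.minus_eq_scale)
qed

lemma linear_map_finsum:
  assumes "kspace V" "kspace W" "f \<in> linear_maps V W" "finite A" "\<And>i. i \<in> A \<Longrightarrow> g i \<in> carrier V"
  shows "f (finsum V g A) = finsum W (\<lambda>i. f (g i)) A"
proof -
  interpret V: kspace V by fact
  interpret W: kspace W by fact
  show ?thesis
    using assms(4,5)
  proof (induction A)
    case empty then show ?case using linear_map_zero[OF assms(1-3)] by simp
  next
    case (insert i A)
    then have "g \<in> A \<rightarrow> carrier V" "(\<lambda>i. f (g i)) \<in> A \<rightarrow> carrier W" "g i \<in> carrier V" "f (g i) \<in> carrier W"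
      using linear_mapsD(1)[OF assms(3)] by auto
    then show ?case using insert linear_mapsD(2)[OF assms(3)] by simp
  qed
qed

text \<open>This is the algebraic clause of \<open>fin_dim_normed_space\<close>, split off because
  it is also established for spaces that carry no norm yet.\<close>

definition finitely_spanned :: "('k::real_or_complex, 'v, 'm) module_scheme \<Rightarrow> bool" where
  "finitely_spanned V \<longleftrightarrow>
     (\<exists>B. finite B \<and> B \<subseteq> carrier V \<and>
        (\<forall>v\<in>carrier V. \<exists>c :: 'v \<Rightarrow> 'k. v = (\<Oplus>\<^bsub>V\<^esub>b\<in>B. c b \<odot>\<^bsub>V\<^esub> b)))"

lemma finitely_spanned_with_norm [simp]: "finitely_spanned (with_norm V N) = finitely_spanned V"
  by (simp add: finitely_spanned_def)

lemma fin_dim_normed_space_iff: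
  "fin_dim_normed_space V \<longleftrightarrow> kspace V \<and> is_norm V (vnorm V) \<and> finitely_spanned V"
  by (simp add: fin_dim_normed_space_def kspace_iff finitely_spanned_def)

text \<open>Induction on the functionals. On the kernel of \<open>l\<close> in \<open>U\<close> the
  remaining functionals separate, so it is spanned by a finite \<open>B\<close>; it has codimension
  at most one, so a single vector outside the kernel completes \<open>B\<close>. Stating the lemma
  for a subspace \<open>U\<close> keeps the kernel within the scope of the induction.\<close>

lemma (in kspace) finite_separating_subspace:
  assumes "finite \<Lambda>" "\<Lambda> \<subseteq> linear_maps V scalar_space" "subspace U"
    and "\<And>u. u \<in> U \<Longrightarrow> (\<And>l. l \<in> \<Lambda> \<Longrightarrow> l u = 0) \<Longrightarrow> u = \<zero>"
  shows "\<exists>B. finite B \<and> B \<subseteq> U \<and> (\<forall>u\<in>U. \<exists>c. u = (\<Oplus>b\<in>B. c b \<odot> b))"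
  using assms
proof (induction \<Lambda> arbitrary: U)
  case empty
  then have "u = (\<Oplus>b\<in>{}. 0 \<odot> b)" if "u \<in> U" for u using that by simp
  then show ?case by (intro exI[of _ "{}"]) auto
next
  case (insert l \<Lambda>)
  have l: "l \<in> linear_maps V scalar_space" using insert.prems by simp
  note lD = linear_map_scalarD[OF l]
  note UD = subspaceD[OF insert.prems(2)]
  define K where "K = {u \<in> U. l u = 0}"
  have l0: "l \<zero> = 0"
    using linear_map_zero[OF kspace_axioms kspace_scalar_space l] by simp
  have K: "subspace K"
    unfolding subspace_def
  proof (intro conjI ballI allI)
    show "K \<subseteq> carrier V" using UD(1) by (auto simp: K_def)
    show "\<zero> \<in> K" using UD(2) l0 by (simp add: K_def)
    show "u \<oplus> v \<in> K" if "u \<in> K" "v \<in> K" for u v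
      using that UD(1)[of u] UD(1)[of v] UD(3)[of u v] lD(1)[of u v] by (simp add: K_def)
    show "a \<odot> u \<in> K" if "u \<in> K" for a u
      using that UD(1)[of u] UD(4)[of u a] lD(2)[of u a] by (simp add: K_def)
  qed
  have "\<exists>B. finite B \<and> B \<subseteq> K \<and> (\<forall>u\<in>K. \<exists>c. u = (\<Oplus>b\<in>B. c b \<odot> b))"
  proof (rule insert.IH[OF _ K])
    show "\<Lambda> \<subseteq> linear_maps V scalar_space" using insert.prems(1) by simp
    show "u = \<zero>" if "u \<in> K" "\<And>l. l \<in> \<Lambda> \<Longrightarrow> l u = 0" for u
      using that by (intro insert.prems(3)) (auto simp: K_def)
  qed
  then obtain B where B: "finite B" "B \<subseteq> K" "\<And>u. u \<in> K \<Longrightarrow> \<exists>c. u = (\<Oplus>b\<in>B. c b \<odot> b)"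
    by blast
  show ?case
  proof (cases "K = U")
    case True
    then show ?thesis using B by blast
  next
    case False
    then obtain v where v: "v \<in> U" "l v \<noteq> 0" by (auto simp: K_def)
    have vB: "v \<notin> B" using B(2) v by (auto simp: K_def)
    have "\<exists>c. u = (\<Oplus>b\<in>insert v B. c b \<odot> b)" if u: "u \<in> U" for u
    proof -
      \<comment> \<open>This coefficient makes \<open>l\<close> vanish at \<open>u - a v\<close>, so
        that the difference is a combination of \<open>B\<close>.\<close>
      define a where "a = l u / l v"
      have uv: "u \<in> carrier V" "v \<in> carrier V" using u v UD(1) by auto
      have "u \<ominus> a \<odot> v \<in> K"
        using u v uv UD(4)[OF v(1), of a] UD(5)[OF u, of "a \<odot> v"]
        by (simp add: K_def minus_eq_scale lD a_def)
      then obtain c where c: "u \<ominus> a \<odot> v = (\<Oplus>b\<in>B. c b \<odot> b)" using B(3) by blast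
      define c' where "c' = c(v := a)"
      have cl: "(\<lambda>b. c' b \<odot> b) \<in> B \<rightarrow> carrier V"
        using B(2) UD(1) by (auto simp: K_def)
      have "(\<Oplus>b\<in>B. c b \<odot> b) = (\<Oplus>b\<in>B. c' b \<odot> b)"
        using vB by (intro finsum_cong'[OF refl cl]) (auto simp: c'_def)
      then have "(\<Oplus>b\<in>insert v B. c' b \<odot> b) = a \<odot> v \<oplus> (u \<ominus> a \<odot> v)"
        using finsum_insert[OF B(1) vB cl] uv c by (simp add: c'_def)
      also have "\<dots> = u"
        using uv by (simp add: minus_eq_scale a_ac flip: scale_left_distrib)
      finally show ?thesis by metis
    qed
    then show ?thesis using B v by (intro exI[of _ "insert v B"]) (auto simp: K_def)
  qed
qed

lemma (in kspace) finite_separating_spanned: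
  assumes "finite \<Lambda>" "\<Lambda> \<subseteq> linear_maps V scalar_space"
    and "\<And>v. v \<in> carrier V \<Longrightarrow> (\<And>l. l \<in> \<Lambda> \<Longrightarrow> l v = 0) \<Longrightarrow> v = \<zero>"
  shows "finitely_spanned V"
  using finite_separating_subspace[OF assms(1,2) subspace_carrier assms(3)]
  unfolding finitely_spanned_def by blast

section \<open>Finite dimensional normed spaces\<close>

lemma is_norm_with_norm [simp]: "is_norm (with_norm V M) N = is_norm V N"
  by (simp add: is_norm_def)

locale normed_kspace = kspace V
  for V :: "('k::real_or_complex, 'v, 'm) module_scheme" (structure) +
  fixes N :: "'v \<Rightarrow> real"
  assumes is_norm: "is_norm V N"
begin

lemma N_nonneg [simp]: "v \<in> carrier V \<Longrightarrow> 0 \<le> N v"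
  and N_eq_0_iff: "v \<in> carrier V \<Longrightarrow> N v = 0 \<longleftrightarrow> v = \<zero>"
  and N_scale: "v \<in> carrier V \<Longrightarrow> N (a \<odot> v) = norm a * N v"
  and N_triangle: "u \<in> carrier V \<Longrightarrow> v \<in> carrier V \<Longrightarrow> N (u \<oplus> v) \<le> N u + N v"
  using is_norm by (auto simp: is_norm_def)

lemma N_zero [simp]: "N \<zero> = 0"
  by (simp add: N_eq_0_iff)

lemma N_minus_commute: "u \<in> carrier V \<Longrightarrow> v \<in> carrier V \<Longrightarrow> N (u \<ominus> v) = N (v \<ominus> u)"
proof -
  assume uv: "u \<in> carrier V" "v \<in> carrier V"
  then have "v \<ominus> u = (- 1) \<odot> (u \<ominus> v)"
    by (simp add: minus_eq_scale scale_right_distrib a_comm)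
  then show ?thesis using uv by (simp add: N_scale)
qed

lemma N_finsum:
  assumes "finite A" "\<And>i. i \<in> A \<Longrightarrow> f i \<in> carrier V"
  shows "N (finsum V f A) \<le> (\<Sum>i\<in>A. N (f i))"
  using assms
proof (induction A)
  case (insert i A)
  then show ?case using N_triangle[of "f i" "finsum V f A"] by (force simp: Pi_iff)
qed simp

text \<open>
  The coordinate functionals of a frame are required to be continuous; that every finite set lies
  in a subspace with a frame therefore contains the equivalence of norms in finite dimension.
\<close>

definition frame :: "'v set \<Rightarrow> 'v set \<Rightarrow> ('v \<Rightarrow> 'v \<Rightarrow> 'k) \<Rightarrow> bool" where
  "frame U I \<epsilon> \<longleftrightarrow> finite I \<and> I \<subseteq> U \<and>
     (\<forall>b\<in>I. \<forall>u\<in>U. \<forall>v\<in>U. \<epsilon> b (u \<oplus> v) = \<epsilon> b u + \<epsilon> b v) \<and>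
     (\<forall>b\<in>I. \<forall>a. \<forall>u\<in>U. \<epsilon> b (a \<odot> u) = a * \<epsilon> b u) \<and>
     (\<exists>C. \<forall>b\<in>I. \<forall>u\<in>U. norm (\<epsilon> b u) \<le> C * N u) \<and>
     (\<forall>u\<in>U. u = (\<Oplus>b\<in>I. \<epsilon> b u \<odot> b))"

text \<open>The coordinates of a Cauchy sequence are Cauchy because the coordinate functionals are
  continuous. Their limits recombine to the limit of the sequence, since the norm of a combination
  is at most the weighted sum of the norms of its coefficients.\<close>

lemma frame_complete:
  assumes U: "subspace U" and fr: "frame U I \<epsilon>" and s: "\<And>n. s n \<in> U"
    and cauchy: "\<And>e. e > 0 \<Longrightarrow> \<exists>n0. \<forall>i\<ge>n0. \<forall>j\<ge>n0. N (s i \<ominus> s j) < e"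
  shows "\<exists>v\<in>U. (\<lambda>n::nat. N (s n \<ominus> v)) \<longlonglongrightarrow> 0"
proof -
  have I: "finite I" "I \<subseteq> U" "I \<subseteq> carrier V" and rep: "\<And>u. u \<in> U \<Longrightarrow> u = (\<Oplus>b\<in>I. \<epsilon> b u \<odot> b)"
    using fr U by (auto simp: frame_def subspace_def)
  have sc: "s n \<in> carrier V" for n using s U by (auto simp: subspace_def)
  obtain C where C: "\<And>b u. b \<in> I \<Longrightarrow> u \<in> U \<Longrightarrow> norm (\<epsilon> b u) \<le> C * N u"
    using fr unfolding frame_def by blast
  have "convergent (\<lambda>n. \<epsilon> b (s n))" if b: "b \<in> I" for b
  proof (rule scalar_Cauchy_convergent, rule CauchyI)
    fix e :: real assume "e > 0"
    \<comment> \<open>The constant \<open>C\<close> need not be positive;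
      \<open>\<bar>C\<bar> + 1\<close> is.\<close>
    then obtain n0 where n0: "\<And>i j. i \<ge> n0 \<Longrightarrow> j \<ge> n0 \<Longrightarrow> N (s i \<ominus> s j) < e / (\<bar>C\<bar> + 1)"
      using cauchy[of "e / (\<bar>C\<bar> + 1)"] by (auto simp: add_nonneg_pos)
    have "norm (\<epsilon> b (s i) - \<epsilon> b (s j)) < e" if "i \<ge> n0" "j \<ge> n0" for i j
    proof -
      have "\<epsilon> b (s i \<ominus> s j) = \<epsilon> b (s i) - \<epsilon> b (s j)"
        using fr b s[of i] s[of j] U sc by (simp add: minus_eq_scale frame_def subspace_def)
      then have "norm (\<epsilon> b (s i) - \<epsilon> b (s j)) \<le> C * N (s i \<ominus> s j)"
        using C[OF b, of "s i \<ominus> s j"] subspaceD(5)[OF U] s by simp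
      also have "\<dots> \<le> (\<bar>C\<bar> + 1) * N (s i \<ominus> s j)"
        by (intro mult_right_mono) (auto simp: sc)
      also have "\<dots> < (\<bar>C\<bar> + 1) * (e / (\<bar>C\<bar> + 1))"
        using n0[OF that] by (intro mult_strict_left_mono) auto
      finally show ?thesis by (simp split: if_splits)
    qed
    then show "\<exists>M. \<forall>m\<ge>M. \<forall>n\<ge>M. norm (\<epsilon> b (s m) - \<epsilon> b (s n)) < e" by blast
  qed
  then have "\<forall>b\<in>I. \<exists>l. (\<lambda>n. \<epsilon> b (s n)) \<longlonglongrightarrow> l" by (auto simp: convergent_def)
  then obtain l where l: "\<And>b. b \<in> I \<Longrightarrow> (\<lambda>n. \<epsilon> b (s n)) \<longlonglongrightarrow> l b" by metis
  define v where "v = (\<Oplus>b\<in>I. l b \<odot> b)"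
  have v: "v \<in> U"
    unfolding v_def using I subspaceD[OF U] by (intro finsum_in_set) auto
  have bound: "N (s n \<ominus> v) \<le> (\<Sum>b\<in>I. norm (\<epsilon> b (s n) - l b) * N b)" for n
  proof -
    have "s n \<ominus> v = (\<Oplus>b\<in>I. \<epsilon> b (s n) \<odot> b) \<ominus> v"
      by (rule arg_cong[OF rep[OF s[of n]], of "\<lambda>x. x \<ominus> v"])
    also have "\<dots> = (\<Oplus>b\<in>I. (\<epsilon> b (s n) - l b) \<odot> b)"
      unfolding v_def by (rule finsum_combination_diff[OF I(1,3)])
    finally have "N (s n \<ominus> v) \<le> (\<Sum>b\<in>I. N ((\<epsilon> b (s n) - l b) \<odot> b))"
      using I by (auto intro!: N_finsum)
    also have "\<dots> = (\<Sum>b\<in>I. norm (\<epsilon> b (s n) - l b) * N b)"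
      using I by (intro sum.cong) (auto simp: N_scale)
    finally show ?thesis .
  qed
  have "(\<lambda>n. \<Sum>b\<in>I. norm (\<epsilon> b (s n) - l b) * N b) \<longlonglongrightarrow> (\<Sum>b\<in>I. 0 * N b)"
    using l by (intro tendsto_sum tendsto_mult tendsto_const tendsto_norm_zero) (auto simp: LIM_zero_iff)
  then have lim: "(\<lambda>n. \<Sum>b\<in>I. norm (\<epsilon> b (s n) - l b) * N b) \<longlonglongrightarrow> 0" by simp
  have nonneg: "0 \<le> N (s n \<ominus> v)" for n
    using sc[of n] subspaceD(1)[OF U v] by simp
  have "(\<lambda>n. N (s n \<ominus> v)) \<longlonglongrightarrow> 0"
    by (rule tendsto_sandwich[OF always_eventually always_eventually tendsto_const lim])
      (simp_all add: bound nonneg)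
  with v show ?thesis by blast
qed

text \<open>Induction step of the equivalence of norms. The subspace \<open>U\<close> is complete by
  \<open>frame_complete\<close>, hence closed, so a vector outside it has a positive distance
  \<open>d\<close> from it. This distance makes the coefficient along the new vector a continuous
  functional, and then the old coordinates remain continuous on the span of \<open>U\<close> and
  \<open>b0\<close>.\<close>

lemma frame_extend:
  assumes U: "subspace U" and fr: "frame U I \<epsilon>" and b0: "b0 \<in> carrier V"
  shows "\<exists>U' I' \<epsilon>'. subspace U' \<and> U \<subseteq> U' \<and> b0 \<in> U' \<and> frame U' I' \<epsilon>'"
proof (cases "b0 \<in> U")
  case True
  then show ?thesis using assms by blast
next
  case False
  note UD = subspaceD[OF U]
  have I: "finite I" "I \<subseteq> U" and rep: "\<And>u. u \<in> U \<Longrightarrow> u = (\<Oplus>b\<in>I. \<epsilon> b u \<odot> b)"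
    and add: "\<And>b u v. b \<in> I \<Longrightarrow> u \<in> U \<Longrightarrow> v \<in> U \<Longrightarrow> \<epsilon> b (u \<oplus> v) = \<epsilon> b u + \<epsilon> b v"
    and scale: "\<And>b u a. b \<in> I \<Longrightarrow> u \<in> U \<Longrightarrow> \<epsilon> b (a \<odot> u) = a * \<epsilon> b u"
    using fr by (auto simp: frame_def)
  obtain C where C: "\<And>b u. b \<in> I \<Longrightarrow> u \<in> U \<Longrightarrow> norm (\<epsilon> b u) \<le> C * N u"
    using fr unfolding frame_def by blast
  \<comment> \<open>Otherwise points of \<open>U\<close> approach \<open>b0\<close>; they form a
    Cauchy sequence, whose limit lies in \<open>U\<close> and has distance 0 from
    \<open>b0\<close>.\<close>
  have "\<exists>d>0. \<forall>u\<in>U. d \<le> N (b0 \<ominus> u)"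
  proof (rule ccontr)
    assume "\<not> ?thesis"
    then have "\<forall>d>0. \<exists>u\<in>U. N (b0 \<ominus> u) < d" by (meson not_le)
    then have "\<forall>n. \<exists>u\<in>U. N (b0 \<ominus> u) < 1 / real (Suc n)" by simp
    then obtain s where s: "\<And>n. s n \<in> U" "\<And>n. N (b0 \<ominus> s n) < 1 / real (Suc n)" by metis
    have sc: "s n \<in> carrier V" for n using s UD by blast
    have lim0: "(\<lambda>n. 1 / real (Suc n)) \<longlonglongrightarrow> 0"
      using LIMSEQ_inverse_real_of_nat by (simp add: inverse_eq_divide)
    have lim: "(\<lambda>n. N (b0 \<ominus> s n)) \<longlonglongrightarrow> 0"
      by (rule tendsto_sandwich[OF always_eventually always_eventually tendsto_const lim0])
        (simp_all add: less_imp_le[OF s(2)] sc b0 del: of_nat_Suc)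
    have "\<exists>v\<in>U. (\<lambda>n. N (s n \<ominus> v)) \<longlonglongrightarrow> 0"
    proof (rule frame_complete[OF U fr s(1)])
      fix e :: real assume "e > 0"
      then obtain n0 where n0: "\<And>n. n \<ge> n0 \<Longrightarrow> N (b0 \<ominus> s n) < e / 2"
        using order_tendstoD(2)[OF lim, of "e / 2"] unfolding eventually_sequentially by auto
      have "N (s i \<ominus> s j) < e" if "i \<ge> n0" "j \<ge> n0" for i j
      proof -
        have "N (s i \<ominus> s j) \<le> N (s i \<ominus> b0) + N (b0 \<ominus> s j)"
          using minus_trans[of "s i" b0 "s j"] N_triangle[of "s i \<ominus> b0" "b0 \<ominus> s j"] b0 sc by simp
        then show ?thesis
          using n0[OF that(1)] n0[OF that(2)] N_minus_commute[OF b0 sc[of i]] by simp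
      qed
      then show "\<exists>n0. \<forall>i\<ge>n0. \<forall>j\<ge>n0. N (s i \<ominus> s j) < e" by blast
    qed
    then obtain v where v: "v \<in> U" and limv: "(\<lambda>n. N (s n \<ominus> v)) \<longlonglongrightarrow> 0" by blast
    have vc: "v \<in> carrier V" using v UD by blast
    have "N (b0 \<ominus> v) \<le> N (b0 \<ominus> s n) + N (s n \<ominus> v)" for n
      using minus_trans[of b0 "s n" v] N_triangle[of "b0 \<ominus> s n" "s n \<ominus> v"] b0 sc vc by simp
    then have "N (b0 \<ominus> v) \<le> 0 + 0"
      by (intro LIMSEQ_le_const[OF tendsto_add[OF lim limv]]) blast
    then have "N (b0 \<ominus> v) = 0"
      using N_nonneg[of "b0 \<ominus> v"] minus_closed[OF b0 vc] by linarith
    then have "b0 \<ominus> v = \<zero>" using N_eq_0_iff[of "b0 \<ominus> v"] minus_closed[OF b0 vc] by blast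
    then have "b0 = v" using eqI_minus[OF b0 vc] by blast
    with v False show False by simp
  qed
  then obtain d where d: "d > 0" "\<And>u. u \<in> U \<Longrightarrow> d \<le> N (b0 \<ominus> u)" by blast
  have inj: "inj_on (\<lambda>(u, a). u \<oplus> a \<odot> b0) (U \<times> UNIV)"
    using line_decomposition_unique[where D=UNIV, OF _ _ _ _ b0 False] UD
    by (intro inj_onI) (auto simp: subset_eq split: prod.splits)
  define U' where "U' = (\<lambda>(u, a). u \<oplus> a \<odot> b0) ` (U \<times> UNIV)"
  \<comment> \<open>\<open>g\<close> reads the two components off \<open>u + a b0\<close>; by
    \<open>inj\<close> they are well defined.\<close>
  define g where "g = the_inv_into (U \<times> UNIV) (\<lambda>(u, a). u \<oplus> a \<odot> b0)"
  have g: "g (u \<oplus> a \<odot> b0) = (u, a)" if "u \<in> U" for u a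
    using the_inv_into_f_f[OF inj, of "(u, a)"] that by (simp add: g_def)
  have U'E: "\<exists>u a. u \<in> U \<and> w = u \<oplus> a \<odot> b0" if "w \<in> U'" for w
    using that by (auto simp: U'_def)
  have U'I: "u \<oplus> a \<odot> b0 \<in> U'" if "u \<in> U" for u a
    using that by (force simp: U'_def)
  have addU': "(u \<oplus> a \<odot> b0) \<oplus> (u' \<oplus> a' \<odot> b0) = (u \<oplus> u') \<oplus> (a + a') \<odot> b0" if "u \<in> U" "u' \<in> U" for u u' a a'
    using that UD b0 by (simp add: add_interchange scale_left_distrib)
  have scaleU': "c \<odot> (u \<oplus> a \<odot> b0) = c \<odot> u \<oplus> (c * a) \<odot> b0" if "u \<in> U" for u a c
    using that UD b0 by (simp add: scale_right_distrib)
  have sub: "subspace U'"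
    unfolding subspace_def
  proof (intro conjI ballI allI)
    show "U' \<subseteq> carrier V" using UD b0 by (auto simp: U'_def)
    show "\<zero> \<in> U'" using U'I[of \<zero> 0] UD b0 by simp
    show "u \<oplus> v \<in> U'" if "u \<in> U'" "v \<in> U'" for u v
      using U'E[OF that(1)] U'E[OF that(2)] addU' U'I UD by metis
    show "a \<odot> u \<in> U'" if "u \<in> U'" for a u
      using U'E[OF that] scaleU' U'I UD by metis
  qed
  have UU': "U \<subseteq> U'"
  proof
    fix u assume "u \<in> U" then show "u \<in> U'" using U'I[of u 0] UD b0 by simp
  qed
  have b0U': "b0 \<in> U'" using U'I[of \<zero> 1] UD b0 by simp
  define \<epsilon>' where "\<epsilon>' b w = (if b = b0 then snd (g w) else \<epsilon> b (fst (g w)))" for b w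
  have b0I: "b0 \<notin> I" using I False by blast
  have "frame U' (insert b0 I) \<epsilon>'"
    unfolding frame_def
  proof (intro conjI ballI allI)
    show "finite (insert b0 I)" "insert b0 I \<subseteq> U'" using I UU' b0U' by auto
    show "\<epsilon>' b (u \<oplus> v) = \<epsilon>' b u + \<epsilon>' b v" if b: "b \<in> insert b0 I" and u: "u \<in> U'" and v: "v \<in> U'" for b u v
    proof -
      obtain x a where x: "x \<in> U" "u = x \<oplus> a \<odot> b0" using U'E[OF u] by blast
      obtain y c where y: "y \<in> U" "v = y \<oplus> c \<odot> b0" using U'E[OF v] by blast
      have "g u = (x, a)" "g v = (y, c)" "g (u \<oplus> v) = (x \<oplus> y, a + c)"
        using x y UD(3)[OF x(1) y(1)] by (simp_all add: addU' g)
      then show ?thesis using b add[OF _ x(1) y(1)] by (auto simp: \<epsilon>'_def)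
    qed
    show "\<epsilon>' b (a \<odot> u) = a * \<epsilon>' b u" if b: "b \<in> insert b0 I" and "u \<in> U'" for b u a
    proof -
      obtain x c where x: "x \<in> U" and u: "u = x \<oplus> c \<odot> b0"
        using U'E[OF \<open>u \<in> U'\<close>] by blast
      show ?thesis
        unfolding u scaleU'[OF x] \<epsilon>'_def using b x UD(4)[OF x] by (auto simp: g scale)
    qed
    show "u = (\<Oplus>b\<in>insert b0 I. \<epsilon>' b u \<odot> b)" if "u \<in> U'" for u
    proof -
      obtain x c where x: "x \<in> U" and u: "u = x \<oplus> c \<odot> b0"
        using U'E[OF \<open>u \<in> U'\<close>] by blast
      have "(\<Oplus>b\<in>I. \<epsilon>' b u \<odot> b) = (\<Oplus>b\<in>I. \<epsilon> b x \<odot> b)"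
        using I(2) b0I UD(1) x unfolding u \<epsilon>'_def by (intro finsum_cong') (auto simp: g)
      also have "\<dots> = x" using rep[OF x] by simp
      finally have x': "(\<Oplus>b\<in>I. \<epsilon>' b u \<odot> b) = x" .
      have "(\<Oplus>b\<in>insert b0 I. \<epsilon>' b u \<odot> b) = \<epsilon>' b0 u \<odot> b0 \<oplus> (\<Oplus>b\<in>I. \<epsilon>' b u \<odot> b)"
        using I b0I UD(1) b0 by (intro finsum_insert) (auto simp: subset_eq)
      also have "\<epsilon>' b0 u = c" using x by (simp add: \<epsilon>'_def u g)
      finally show ?thesis using x' UD(1)[OF x] b0 u by (simp add: a_comm)
    qed
    show "\<exists>C. \<forall>b\<in>insert b0 I. \<forall>u\<in>U'. norm (\<epsilon>' b u) \<le> C * N u"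
    proof (intro exI ballI)
      fix b u assume b: "b \<in> insert b0 I" and "u \<in> U'"
      then obtain x c where x: "x \<in> U" and u: "u = x \<oplus> c \<odot> b0"
        using U'E by blast
      have xc: "x \<in> carrier V" using x UD by blast
      have uc: "u \<in> carrier V" using u xc b0 by simp
      \<comment> \<open>After the factor \<open>c\<close> is taken out of \<open>x + c b0\<close>,
        what remains is \<open>b0\<close> minus an element of \<open>U\<close>, of norm at least
        \<open>d\<close>.\<close>
      have c: "norm c * d \<le> N u"
      proof (cases "c = 0")
        case True then show ?thesis using uc by simp
      next
        case False
        have "u = c \<odot> (b0 \<ominus> (- 1 / c) \<odot> x)"
          using False xc b0 by (simp add: u minus_eq_scale scale_right_distrib a_comm)
        then have "N u = norm c * N (b0 \<ominus> (- 1 / c) \<odot> x)"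
          using xc b0 by (metis N_scale minus_closed scale_closed)
        moreover have "d \<le> N (b0 \<ominus> (- 1 / c) \<odot> x)" using d(2) x UD by blast
        ultimately show ?thesis by (simp add: mult_left_mono)
      qed
      then have c': "norm c \<le> N u / d" using d by (simp add: pos_le_divide_eq)
      \<comment> \<open>The projection to \<open>U\<close> along \<open>b0\<close> is continuous
        too, with constant \<open>1 + N b0 / d\<close>.\<close>
      have "x = u \<oplus> (- c) \<odot> b0"
        using xc b0 by (simp add: u a_assoc flip: scale_left_distrib)
      then have "N x \<le> N u + norm c * N b0"
        using N_triangle[OF uc, of "(- c) \<odot> b0"] b0 by (simp add: N_scale)
      also have "\<dots> \<le> N u + N u / d * N b0"
        using c' b0 by (intro add_left_mono mult_right_mono) auto
      finally have x': "N x \<le> (1 + N b0 / d) * N u" by (simp add: algebra_simps)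
      have "norm (\<epsilon> b x) \<le> \<bar>C\<bar> * ((1 + N b0 / d) * N u)" if "b \<in> I"
      proof -
        have "norm (\<epsilon> b x) \<le> C * N x" using C[OF that x] .
        also have "\<dots> \<le> \<bar>C\<bar> * N x" using xc by (intro mult_right_mono) auto
        also have "\<dots> \<le> \<bar>C\<bar> * ((1 + N b0 / d) * N u)" using x' by (intro mult_left_mono) auto
        finally show ?thesis .
      qed
      moreover have "0 \<le> N u / d" "0 \<le> \<bar>C\<bar> * ((1 + N b0 / d) * N u)"
        using uc d b0 by auto
      \<comment> \<open>The bounds for \<open>b = b0\<close> and for \<open>b\<close> in
        \<open>I\<close> are both nonnegative, so their sum serves in either case.\<close>
      ultimately have "norm (\<epsilon>' b u) \<le> N u / d + \<bar>C\<bar> * ((1 + N b0 / d) * N u)"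
        using b c' x by (fastforce simp: \<epsilon>'_def u g)
      then show "norm (\<epsilon>' b u) \<le> (1 / d + \<bar>C\<bar> * (1 + N b0 / d)) * N u"
        by (simp add: algebra_simps)
    qed
  qed
  then show ?thesis using sub UU' b0U' by blast
qed

lemma frame_exists:
  assumes "finite S" "S \<subseteq> carrier V"
  shows "\<exists>U I \<epsilon>. subspace U \<and> S \<subseteq> U \<and> frame U I \<epsilon>"
  using assms
proof (induction S)
  case empty
  have "subspace {\<zero>}" "frame {\<zero>} {} (\<lambda>_ _. 0)"
    by (auto simp: subspace_def frame_def)
  then show ?case by blast
next
  case (insert b S)
  then obtain U I \<epsilon> where "subspace U" "S \<subseteq> U" "frame U I \<epsilon>" by blast
  moreover from frame_extend[OF this(1,3), of b] insert.prems obtain U' I' \<epsilon>'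
    where "subspace U'" "U \<subseteq> U'" "b \<in> U'" "frame U' I' \<epsilon>'" by blast
  ultimately show ?case by blast
qed

text \<open>A subspace with a frame that contains a spanning set is the whole space.\<close>

lemma finitely_spanned_frame:
  assumes "finitely_spanned V"
  shows "\<exists>I \<epsilon>. frame (carrier V) I \<epsilon>"
proof -
  obtain B where B: "finite B" "B \<subseteq> carrier V"
    "\<And>v. v \<in> carrier V \<Longrightarrow> \<exists>c. v = (\<Oplus>b\<in>B. c b \<odot> b)"
    using assms unfolding finitely_spanned_def by metis
  obtain U I \<epsilon> where U: "subspace U" "B \<subseteq> U" "frame U I \<epsilon>" using frame_exists[OF B(1,2)] by blast
  have "(\<Oplus>b\<in>B. c b \<odot> b) \<in> U" for c
    using U B subspaceD[OF U(1)] by (intro finsum_in_set) auto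
  then have "carrier V \<subseteq> U" using B(3) by auto
  then have "U = carrier V" using U(1) by (auto simp: subspace_def)
  then show ?thesis using U by blast
qed

end

section \<open>Norming functionals\<close>

context normed_kspace
begin

text \<open>Subspaces over \<real>, embedded by \<open>of_real\<close>: the extension argument
  compares values by their order, so it is carried out for real functionals even over the complex
  field.\<close>

definition real_subspace :: "'v set \<Rightarrow> bool" where
  "real_subspace U \<longleftrightarrow> U \<subseteq> carrier V \<and> \<zero> \<in> U \<and> (\<forall>u\<in>U. \<forall>v\<in>U. u \<oplus> v \<in> U) \<and>
     (\<forall>r. \<forall>u\<in>U. of_real r \<odot> u \<in> U)"

definition dominated_on :: "'v set \<Rightarrow> ('v \<Rightarrow> real) \<Rightarrow> bool" where
  "dominated_on U f \<longleftrightarrow> (\<forall>u\<in>U. \<forall>v\<in>U. f (u \<oplus> v) = f u + f v) \<and>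
     (\<forall>r. \<forall>u\<in>U. f (of_real r \<odot> u) = r * f u) \<and> (\<forall>u\<in>U. f u \<le> N u)"

text \<open>The value \<open>t\<close> of the extension at \<open>b\<close> has to satisfy
  \<open>f x - N (x - b) \<le> t \<le> N (y + b) - f y\<close> for all \<open>x\<close>,
  \<open>y\<close> in \<open>U\<close>. The triangle inequality for
  \<open>(x - b) + (y + b) = x + y\<close> says that every such lower bound is below every such
  upper bound.\<close>

lemma dominated_extend:
  assumes U: "real_subspace U" and f: "dominated_on U f" and b: "b \<in> carrier V"
  shows "\<exists>U' f'. real_subspace U' \<and> U \<subseteq> U' \<and> b \<in> U' \<and> dominated_on U' f' \<and> (\<forall>u\<in>U. f' u = f u)"
proof (cases "b \<in> U")
  case True
  then show ?thesis using assms by blast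
next
  case False
  have Uc: "\<And>u. u \<in> U \<Longrightarrow> u \<in> carrier V" and U0: "\<zero> \<in> U"
    and Uadd: "\<And>u v. u \<in> U \<Longrightarrow> v \<in> U \<Longrightarrow> u \<oplus> v \<in> U"
    and Uscale: "\<And>r u. u \<in> U \<Longrightarrow> of_real r \<odot> u \<in> U"
    using U by (auto simp: real_subspace_def)
  have add: "\<And>u v. u \<in> U \<Longrightarrow> v \<in> U \<Longrightarrow> f (u \<oplus> v) = f u + f v"
    and scale: "\<And>r u. u \<in> U \<Longrightarrow> f (of_real r \<odot> u) = r * f u"
    and le: "\<And>u. u \<in> U \<Longrightarrow> f u \<le> N u"
    using f by (auto simp: dominated_on_def)
  have sep: "f x - N (x \<ominus> b) \<le> N (y \<oplus> b) - f y" if "x \<in> U" "y \<in> U" for x y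
  proof -
    have xy: "x \<in> carrier V" "y \<in> carrier V" using that Uc by auto
    have "(x \<ominus> b) \<oplus> (y \<oplus> b) = (x \<oplus> y) \<oplus> ((- 1) \<odot> b \<oplus> b)"
      using xy b by (simp add: minus_eq_scale add_interchange)
    also have "\<dots> = x \<oplus> y" using xy b by (simp add: scale_minus_one l_neg)
    finally have "N (x \<oplus> y) \<le> N (x \<ominus> b) + N (y \<oplus> b)"
      using N_triangle[of "x \<ominus> b" "y \<oplus> b"] xy b by simp
    moreover have "f x + f y \<le> N (x \<oplus> y)" using le[OF Uadd[OF that]] add[OF that] by simp
    ultimately show ?thesis by simp
  qed
  \<comment> \<open>The least admissible value; the set is nonempty and is bounded above by the
    upper bound that belongs to \<open>y = 0\<close>.\<close>
  define t where "t = (SUP x\<in>U. f x - N (x \<ominus> b))"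
  have bdd: "bdd_above ((\<lambda>x. f x - N (x \<ominus> b)) ` U)"
    using sep[OF _ U0] by (intro bdd_aboveI2)
  have t1: "f x - N (x \<ominus> b) \<le> t" if "x \<in> U" for x
    unfolding t_def using cSUP_upper[OF that bdd] .
  have t2: "t \<le> N (y \<oplus> b) - f y" if "y \<in> U" for y
    unfolding t_def using U0 sep[OF _ that] by (intro cSUP_least) auto
  have inj: "inj_on (\<lambda>(u, r). u \<oplus> of_real r \<odot> b) (U \<times> UNIV)"
  proof (rule inj_onI, clarify)
    fix u r u' r' assume u: "u \<in> U" "u' \<in> U" and eq: "u \<oplus> of_real r \<odot> b = u' \<oplus> of_real r' \<odot> b"
    have "(of_real r :: 'k) = of_real r' \<and> u = u'"
    proof (rule line_decomposition_unique[where D=\<real> and U=U and b=b])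
      show "a \<odot> v \<in> U" if "a \<in> \<real>" "v \<in> U" for a v
        using that Uscale by (auto elim: Reals_cases)
    qed (use Uc Uadd b False u eq in auto)
    then show "u = u' \<and> r = r'" by simp
  qed
  define U' where "U' = (\<lambda>(u, r). u \<oplus> of_real r \<odot> b) ` (U \<times> (UNIV :: real set))"
  define g where "g = the_inv_into (U \<times> UNIV) (\<lambda>(u, r). u \<oplus> of_real r \<odot> b)"
  have g: "g (u \<oplus> of_real r \<odot> b) = (u, r)" if "u \<in> U" for u r
    using the_inv_into_f_f[OF inj, of "(u, r)"] that by (simp add: g_def)
  have U'E: "\<exists>u r. u \<in> U \<and> w = u \<oplus> of_real r \<odot> b" if "w \<in> U'" for w
    using that by (auto simp: U'_def)
  have U'I: "u \<oplus> of_real r \<odot> b \<in> U'" if "u \<in> U" for u r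
    using that by (force simp: U'_def)
  have addU': "(u \<oplus> of_real r \<odot> b) \<oplus> (u' \<oplus> of_real r' \<odot> b) = (u \<oplus> u') \<oplus> of_real (r + r') \<odot> b"
    if "u \<in> U" "u' \<in> U" for u u' r r'
    using that Uc b by (simp add: add_interchange scale_left_distrib)
  have scaleU': "of_real c \<odot> (u \<oplus> of_real r \<odot> b) = of_real c \<odot> u \<oplus> of_real (c * r) \<odot> b"
    if "u \<in> U" for u r c
    using that Uc b by (simp add: scale_right_distrib)
  define f' where "f' w = f (fst (g w)) + snd (g w) * t" for w
  have f': "f' (u \<oplus> of_real r \<odot> b) = f u + r * t" if "u \<in> U" for u r
    using g[OF that] by (simp add: f'_def)
  have "real_subspace U'"
    unfolding real_subspace_def
  proof (intro conjI ballI allI)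
    show "U' \<subseteq> carrier V" using Uc b by (auto simp: U'_def)
    show "\<zero> \<in> U'" using U'I[of \<zero> 0] U0 b by simp
    show "u \<oplus> v \<in> U'" if "u \<in> U'" "v \<in> U'" for u v
      using U'E[OF that(1)] U'E[OF that(2)] addU' U'I Uadd by metis
    show "of_real a \<odot> u \<in> U'" if "u \<in> U'" for a u
      using U'E[OF that] scaleU' U'I Uscale by metis
  qed
  moreover have "U \<subseteq> U'"
  proof
    fix u assume "u \<in> U" then show "u \<in> U'" using U'I[of u 0] Uc b by simp
  qed
  moreover have "b \<in> U'" using U'I[of \<zero> 1] U0 b by simp
  moreover have "f' u = f u" if "u \<in> U" for u
    using f'[OF that, of 0] Uc[OF that] b by simp
  moreover have "dominated_on U' f'"
    unfolding dominated_on_def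
  proof (intro conjI ballI allI)
    fix u v r assume u: "u \<in> U'" and v: "v \<in> U'"
    obtain x p where x: "x \<in> U" "u = x \<oplus> of_real p \<odot> b" using U'E[OF u] by blast
    obtain y q where y: "y \<in> U" "v = y \<oplus> of_real q \<odot> b" using U'E[OF v] by blast
    show "f' (u \<oplus> v) = f' u + f' v"
      unfolding x(2) y(2) addU'[OF x(1) y(1)] f'[OF x(1)] f'[OF y(1)] f'[OF Uadd[OF x(1) y(1)]]
        add[OF x(1) y(1)] by (simp add: algebra_simps)
  next
    fix u r assume u: "u \<in> U'"
    obtain x p where x: "x \<in> U" "u = x \<oplus> of_real p \<odot> b" using U'E[OF u] by blast
    show "f' (of_real r \<odot> u) = r * f' u"
      unfolding x(2) scaleU'[OF x(1)] f'[OF x(1)] f'[OF Uscale[OF x(1)]] scale[OF x(1)]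
      by (simp add: algebra_simps)
  next
    fix u assume u: "u \<in> U'"
    obtain x p where x: "x \<in> U" "u = x \<oplus> of_real p \<odot> b" using U'E[OF u] by blast
    have xc: "x \<in> carrier V" using x Uc by blast
    \<comment> \<open>For \<open>p \<noteq> 0\<close>, division by the absolute value of
      \<open>p\<close> reduces the claim to \<open>p = 1\<close>, which is the upper bound
      \<open>t2\<close>, or to \<open>p = -1\<close>, which is the lower bound
      \<open>t1\<close>.\<close>
    have "f x + p * t \<le> N u"
    proof (cases p "0 :: real" rule: linorder_cases)
      case equal
      then show ?thesis using le[OF x(1)] x(2) xc b by simp
    next
      case greater
      define y where "y = of_real (1 / p) \<odot> x"
      have y: "y \<in> U" "y \<in> carrier V" "f y = f x / p"
        using x Uscale[of x "1 / p"] Uc scale[of x "1 / p"] by (simp_all add: y_def)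
      have "u = of_real p \<odot> (y \<oplus> b)"
        using greater xc b by (simp add: x(2) y_def scale_right_distrib)
      then have "N u = p * N (y \<oplus> b)" using greater y b by (simp add: N_scale)
      moreover have "p * t \<le> p * (N (y \<oplus> b) - f y)"
        using t2[OF y(1)] greater by (intro mult_left_mono) auto
      ultimately show ?thesis using y(3) greater by (simp add: algebra_simps)
    next
      case less
      define y where "y = of_real (1 / - p) \<odot> x"
      have y: "y \<in> U" "y \<in> carrier V" "f y = f x / - p"
        using x Uscale[of x "1 / - p"] Uc scale[of x "1 / - p"] by (simp_all add: y_def)
      have "u = of_real (- p) \<odot> (y \<ominus> b)"
        using less xc b by (simp add: x(2) y_def minus_eq_scale scale_right_distrib)
      then have "N u = - p * N (y \<ominus> b)" using less y b by (simp add: N_scale)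
      moreover have "- p * (f y - N (y \<ominus> b)) \<le> - p * t"
        using t1[OF y(1)] less by (intro mult_left_mono) auto
      ultimately show ?thesis using y(3) less by (simp add: algebra_simps)
    qed
    then show "f' u \<le> N u" using f'[OF x(1)] x(2) by simp
  qed
  ultimately show ?thesis by blast
qed

text \<open>Finite dimension replaces Zorn's lemma: finitely many one-dimensional extensions reach a
  real subspace that contains \<open>S\<close>.\<close>

lemma dominated_extend_finite:
  assumes "finite S" "S \<subseteq> carrier V" "real_subspace U" "dominated_on U f"
  shows "\<exists>U' f'. real_subspace U' \<and> U \<union> S \<subseteq> U' \<and> dominated_on U' f' \<and> (\<forall>u\<in>U. f' u = f u)"
  using assms
proof (induction S)
  case empty
  then show ?case by blast
next
  case (insert b S)
  then obtain U1 f1 where 1: "real_subspace U1" "U \<union> S \<subseteq> U1" "dominated_on U1 f1" "\<forall>u\<in>U. f1 u = f u"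
    by auto
  from dominated_extend[OF 1(1,3), of b] insert.prems obtain U2 f2
    where 2: "real_subspace U2" "U1 \<subseteq> U2" "b \<in> U2" "dominated_on U2 f2" "\<forall>u\<in>U1. f2 u = f1 u"
    by auto
  have "U \<union> insert b S \<subseteq> U2" "\<forall>u\<in>U. f2 u = f u" using 1(2,4) 2(2,3,5) by auto
  with 2(1,4) show ?case by blast
qed

text \<open>The functional is \<open>r v \<mapsto> r * N v\<close>, well defined because
  \<open>r \<mapsto> r v\<close> is injective and dominated because
  \<open>r \<le> \<bar>r\<bar>\<close>.\<close>

lemma dominated_on_line:
  assumes "v \<in> carrier V" "v \<noteq> \<zero>"
  shows "\<exists>U f. real_subspace U \<and> v \<in> U \<and> dominated_on U f \<and> f v = N v"
proof -
  have Nv: "N v \<noteq> 0" using assms N_eq_0_iff by blast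
  have inj: "inj (\<lambda>r::real. of_real r \<odot> v)"
  proof (rule injI)
    fix r s :: real assume eq: "of_real r \<odot> v = of_real s \<odot> v"
    have "of_real (r - s) \<odot> v = of_real r \<odot> v \<oplus> (- of_real s) \<odot> v"
      using assms by (simp flip: scale_left_distrib)
    also have "\<dots> = \<zero>" unfolding eq using assms by (simp flip: scale_left_distrib)
    finally have "norm (of_real (r - s) :: 'k) * N v = 0"
      using N_scale[OF assms(1), of "of_real (r - s)"] by simp
    then show "r = s" using Nv by (simp flip: of_real_diff)
  qed
  define f where "f w = the_inv (\<lambda>r::real. of_real r \<odot> v) w * N v" for w
  have f: "f (of_real r \<odot> v) = r * N v" for r
    using the_inv_f_f[OF inj] by (simp add: f_def)
  let ?U = "range (\<lambda>r::real. of_real r \<odot> v)"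
  have U: "of_real r \<odot> v \<in> ?U" for r by blast
  have add: "of_real r \<odot> v \<oplus> of_real s \<odot> v = of_real (r + s) \<odot> v" for r s
    using assms by (simp add: scale_left_distrib)
  have scale: "of_real r \<odot> (of_real s \<odot> v) = of_real (r * s) \<odot> v" for r s
    using assms by simp
  have "real_subspace ?U"
    unfolding real_subspace_def
  proof (intro conjI ballI allI)
    show "?U \<subseteq> carrier V" using assms by auto
    show "\<zero> \<in> ?U" using U[of 0] assms by simp
    show "x \<oplus> y \<in> ?U" if "x \<in> ?U" "y \<in> ?U" for x y using that by (auto simp: add U simp del: of_real_add)
    show "of_real r \<odot> x \<in> ?U" if "x \<in> ?U" for x r
    proof -
      obtain s where "x = of_real s \<odot> v" using \<open>x \<in> ?U\<close> by blast
      then show ?thesis using scale U by metis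
    qed
  qed
  moreover have "dominated_on ?U f"
    unfolding dominated_on_def
  proof (intro conjI ballI allI)
    show "f (x \<oplus> y) = f x + f y" if "x \<in> ?U" "y \<in> ?U" for x y
      using that by (auto simp: add f algebra_simps simp del: of_real_add)
    show "f (of_real r \<odot> x) = r * f x" if "x \<in> ?U" for x r
      using that by (auto simp: scale f simp del: scale_scale of_real_mult)
    show "f x \<le> N x" if "x \<in> ?U" for x
      using that assms by (auto simp: f N_scale intro!: mult_right_mono)
  qed
  moreover have "v \<in> ?U" "f v = N v" using U[of 1] f[of 1] assms by simp_all
  ultimately show ?thesis by blast
qed

lemma real_norming_functional:
  assumes "finitely_spanned V" "v0 \<in> carrier V" "v0 \<noteq> \<zero>"
  shows "\<exists>f. dominated_on (carrier V) f \<and> f v0 = N v0"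
proof -
  obtain B where B: "finite B" "B \<subseteq> carrier V"
    "\<And>v. v \<in> carrier V \<Longrightarrow> \<exists>c. v = (\<Oplus>b\<in>B. c b \<odot> b)"
    using assms(1) unfolding finitely_spanned_def by metis
  obtain U f where U: "real_subspace U" "v0 \<in> U" "dominated_on U f" "f v0 = N v0"
    using dominated_on_line[OF assms(2,3)] by blast
  \<comment> \<open>\<open>S\<close> spans over \<real>: it consists of the vectors of
    \<open>B\<close>, to which their multiples by \<open>i\<close> are added over the complex
    field.\<close>
  obtain S where S: "finite S" "S \<subseteq> carrier V"
    and span: "\<And>U a b. real_subspace U \<Longrightarrow> S \<subseteq> U \<Longrightarrow> b \<in> B \<Longrightarrow> a \<odot> b \<in> U"
  proof (cases rule: scalar_cases[where 'k='k])
    case real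
    show thesis
    proof (rule that[of B])
      fix U b and a :: 'k assume "real_subspace U" "B \<subseteq> U" "b \<in> B"
      moreover obtain r where "a = of_real r" using real by blast
      ultimately show "a \<odot> b \<in> U" by (auto simp: real_subspace_def)
    qed (use B in auto)
  next
    case (complex i)
    show thesis
    proof (rule that[of "B \<union> (\<lambda>b. i \<odot> b) ` B"])
      fix U b and a :: 'k assume U: "real_subspace U" "B \<union> (\<lambda>b. i \<odot> b) ` B \<subseteq> U" "b \<in> B"
      obtain x y where a: "a = of_real x + of_real y * i" using complex by blast
      have "b \<in> carrier V" using U(3) B by blast
      then have "a \<odot> b = of_real x \<odot> b \<oplus> of_real y \<odot> (i \<odot> b)"
        by (simp add: a scale_left_distrib)
      moreover have "b \<in> U" "i \<odot> b \<in> U" using U by auto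
      ultimately show "a \<odot> b \<in> U" using U(1) by (simp add: real_subspace_def del: scale_scale)
    qed (use B in auto)
  qed
  obtain U' f' where U': "real_subspace U'" "U \<union> S \<subseteq> U'" "dominated_on U' f'" "\<forall>u\<in>U. f' u = f u"
    using dominated_extend_finite[OF S U(1,3)] by blast
  have "(\<Oplus>b\<in>B. c b \<odot> b) \<in> U'" for c
  proof (rule finsum_in_set)
    show "u \<oplus> v \<in> U'" if "u \<in> U'" "v \<in> U'" for u v
      using U'(1) that by (simp add: real_subspace_def)
    show "finite B" by (rule B)
    show "c b \<odot> b \<in> U'" if "b \<in> B" for b using span[OF U'(1) _ that] U'(2) by blast
  qed (use U'(1) in \<open>simp_all add: real_subspace_def\<close>)
  then have "carrier V \<subseteq> U'" using B(3) by auto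
  then have "U' = carrier V" using U'(1) by (auto simp: real_subspace_def)
  with U' U show ?thesis by auto
qed

text \<open>Over the complex field a linear functional is recovered from its real part
  \<open>f\<close> by \<open>l v = f v - i * f (i v)\<close>, and it has the same bound as
  \<open>f\<close>.\<close>

lemma norming_functional:
  assumes "finitely_spanned V" "v0 \<in> carrier V"
  shows "\<exists>l\<in>linear_maps V scalar_space. (\<forall>v\<in>carrier V. norm (l v) \<le> N v) \<and> norm (l v0) = N v0"
proof (cases "v0 = \<zero>")
  case True
  then show ?thesis
    by (intro bexI[of _ "\<lambda>v\<in>carrier V. 0"]) (auto intro!: linear_mapsI)
next
  case False
  obtain f where f: "dominated_on (carrier V) f" "f v0 = N v0"
    using real_norming_functional[OF assms False] by blast
  have add: "\<And>u v. u \<in> carrier V \<Longrightarrow> v \<in> carrier V \<Longrightarrow> f (u \<oplus> v) = f u + f v"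
    and scale: "\<And>r u. u \<in> carrier V \<Longrightarrow> f (of_real r \<odot> u) = r * f u"
    and le: "\<And>u. u \<in> carrier V \<Longrightarrow> f u \<le> N u"
    using f(1) by (auto simp: dominated_on_def)
  show ?thesis
  proof (cases rule: scalar_cases[where 'k='k])
    case real
    define l :: "'v \<Rightarrow> 'k" where "l = (\<lambda>v\<in>carrier V. of_real (f v))"
    have "l \<in> linear_maps V scalar_space"
    proof (rule linear_mapsI)
      fix a :: 'k and v assume "v \<in> carrier V"
      moreover obtain r where "a = of_real r" using real by blast
      ultimately show "l (a \<odot> v) = a \<odot>\<^bsub>scalar_space\<^esub> l v" by (simp add: l_def scale)
    qed (auto simp: l_def add)
    moreover have "norm (l v) \<le> N v" if "v \<in> carrier V" for v
      using le[OF that] le[of "of_real (- 1) \<odot> v"] that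
      by (simp add: l_def N_scale scale del: of_real_minus)
    ultimately show ?thesis using f(2) assms(2) by (intro bexI[of _ l]) (auto simp: l_def)
  next
    case (complex i)
    define l where "l = (\<lambda>v\<in>carrier V. of_real (f v) - i * of_real (f (i \<odot> v)))"
    have ii: "i * (i * z) = - z" for z
      by (simp add: complex(1) flip: mult.assoc)
    have f_scale: "f ((of_real x + of_real y * i) \<odot> v) = x * f v + y * f (i \<odot> v)"
      if "v \<in> carrier V" for x y v
    proof -
      have "(of_real x + of_real y * i) \<odot> v = of_real x \<odot> v \<oplus> of_real y \<odot> (i \<odot> v)"
        using that by (simp add: scale_left_distrib)
      then show ?thesis
        using that scale[OF that, of x] scale[of "i \<odot> v" y] by (simp add: add del: scale_scale)
    qed
    have l_scale: "l (a \<odot> v) = a * l v" if v: "v \<in> carrier V" for a :: 'k and v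
    proof -
      obtain x y where a: "a = of_real x + of_real y * i" using complex by blast
      have ia: "i * a = of_real (- y) + of_real x * i"
        by (simp add: a algebra_simps ii)
      have "l (a \<odot> v) = of_real (f (a \<odot> v)) - i * of_real (f ((i * a) \<odot> v))"
        using v by (simp add: l_def)
      also have "\<dots> = of_real (x * f v + y * f (i \<odot> v)) - i * of_real (- y * f v + x * f (i \<odot> v))"
        unfolding ia f_scale[OF v] unfolding a f_scale[OF v] ..
      also have "\<dots> = a * l v"
        using v by (simp add: a l_def algebra_simps ii)
      finally show ?thesis .
    qed
    have "l \<in> linear_maps V scalar_space"
    proof (rule linear_mapsI)
      fix u v assume uv: "u \<in> carrier V" "v \<in> carrier V"
      then have "f (i \<odot> (u \<oplus> v)) = f (i \<odot> u) + f (i \<odot> v)" by (simp add: scale_right_distrib add)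
      then show "l (u \<oplus> v) = l u \<oplus>\<^bsub>scalar_space\<^esub> l v"
        using uv by (simp add: l_def add algebra_simps)
    qed (simp_all add: l_scale, simp add: l_def)
    moreover have le_l: "norm (l v) \<le> N v" if v: "v \<in> carrier V" for v
    proof (cases "l v = 0")
      case True
      then show ?thesis using v by simp
    next
      case False
      \<comment> \<open>Rotating \<open>v\<close> to \<open>w\<close> makes \<open>l w\<close> the
        nonnegative number \<open>m\<close>; then \<open>m\<close> is the real part
        \<open>f w\<close>, which is at most \<open>N w = N v\<close>.\<close>
      define m where "m = norm (l v)"
      define w where "w = (of_real m / l v) \<odot> v"
      have w: "w \<in> carrier V" "N w = N v"
        using False v by (simp_all add: w_def N_scale norm_divide m_def)
      have "l w = of_real m" using False v by (simp add: w_def l_scale)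
      then have "of_real (m - f w) = - (i * of_real (f (i \<odot> w)))"
        using w by (simp add: l_def algebra_simps)
      \<comment> \<open>Squaring replaces a comparison of real and imaginary parts: with
        \<open>i * i = - 1\<close> it yields a vanishing sum of two real squares.\<close>
      then have "of_real (m - f w) * of_real (m - f w)
          = (i * i) * (of_real (f (i \<odot> w)) * of_real (f (i \<odot> w)))"
        by simp
      then have "of_real ((m - f w) * (m - f w) + f (i \<odot> w) * f (i \<odot> w)) = (0 :: 'k)"
        unfolding complex(1) of_real_add of_real_mult by simp
      then have "(m - f w) * (m - f w) + f (i \<odot> w) * f (i \<odot> w) = 0"
        by (simp only: of_real_eq_0_iff)
      then have "m = f w" by (simp add: sum_squares_eq_zero_iff)
      then show ?thesis using le[OF w(1)] w(2) by (simp add: m_def)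
    qed
    \<comment> \<open>The real part of \<open>l v0\<close> is \<open>f v0 = N v0\<close>.\<close>
    moreover have "N v0 \<le> norm (l v0)"
      using complex(3)[of "f v0" "- f (i \<odot> v0)"] assms(2) f(2)
      by (simp add: l_def mult.commute)
    ultimately show ?thesis using assms(2) by (intro bexI[of _ l]) (auto intro: antisym)
  qed
qed

end


section \<open>Operator norms\<close>

text \<open>Equality in such a space can be tested by linear functionals. This is the condition on
  the target under which linearizations are shown to exist; it refers to no norm and to no finite
  set.\<close>

definition separated :: "('k::real_or_complex, 'v, 'm) module_scheme \<Rightarrow> bool" where
  "separated V \<longleftrightarrow> kspace V \<and>
     (\<forall>v\<in>carrier V. (\<forall>l\<in>linear_maps V scalar_space. l v = 0) \<longrightarrow> v = \<zero>\<^bsub>V\<^esub>)"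

lemma separated_eqI:
  assumes "separated V" "u \<in> carrier V" "v \<in> carrier V"
    and "\<And>l. l \<in> linear_maps V scalar_space \<Longrightarrow> l u = l v"
  shows "u = v"
proof -
  interpret V: kspace V using assms(1) by (simp add: separated_def)
  have "l (u \<ominus>\<^bsub>V\<^esub> v) = 0" if "l \<in> linear_maps V scalar_space" for l
    using assms(2-4) that linear_map_scalarD[OF that] by (simp add: V.minus_eq_scale)
  then have "u \<ominus>\<^bsub>V\<^esub> v = \<zero>\<^bsub>V\<^esub>" using assms(1-3) by (simp add: separated_def)
  then show ?thesis using V.eqI_minus assms(2,3) by blast
qed

lemma fin_dimD:
  assumes "fin_dim_normed_space V"
  shows "kspace V" "normed_kspace V (vnorm V)" "finitely_spanned V"
  using assms
  by (simp_all add: fin_dim_normed_space_iff normed_kspace_def normed_kspace_axioms_def)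

lemma fin_dim_with_norm:
  "fin_dim_normed_space (with_norm V N) \<longleftrightarrow> kspace V \<and> is_norm V N \<and> finitely_spanned V"
  by (simp add: fin_dim_normed_space_iff)

lemma fin_dim_norming_functional:
  assumes "fin_dim_normed_space V" "v0 \<in> carrier V"
  shows "\<exists>l\<in>linear_maps V scalar_space.
    (\<forall>v\<in>carrier V. norm (l v) \<le> vnorm V v) \<and> norm (l v0) = vnorm V v0"
  by (rule normed_kspace.norming_functional[OF fin_dimD(2)[OF assms(1)] fin_dimD(3)[OF assms(1)]
        assms(2)])

lemma fin_dim_separated:
  assumes "fin_dim_normed_space V"
  shows "separated V"
  unfolding separated_def
proof (intro conjI ballI impI)
  interpret normed_kspace V "vnorm V" using fin_dimD(2)[OF assms] .
  fix v assume v: "v \<in> carrier V" and 0: "\<forall>l\<in>linear_maps V scalar_space. l v = 0"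
  then have "vnorm V v = 0" using fin_dim_norming_functional[OF assms v] by auto
  then show "v = \<zero>\<^bsub>V\<^esub>" using v N_eq_0_iff by blast
qed (rule fin_dimD(1)[OF assms])

text \<open>Expanding \<open>v\<close> in a frame gives \<open>f v\<close> as a combination of the
  finitely many \<open>f b\<close>, with coefficients bounded by a multiple of the norm of
  \<open>v\<close>.\<close>

lemma fin_dim_linear_bounded:
  assumes V: "fin_dim_normed_space V" and W: "normed_kspace W (vnorm W)"
    and f: "f \<in> linear_maps V W"
  shows "bounded_map V W f"
proof -
  interpret V: normed_kspace V "vnorm V" using fin_dimD(2)[OF V] .
  interpret W: normed_kspace W "vnorm W" using W .
  obtain I \<epsilon> where fr: "V.frame (carrier V) I \<epsilon>"
    using V.finitely_spanned_frame[OF fin_dimD(3)[OF V]] by blast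
  then have I: "finite I" "I \<subseteq> carrier V"
    and rep: "\<And>v. v \<in> carrier V \<Longrightarrow> v = (\<Oplus>\<^bsub>V\<^esub>b\<in>I. \<epsilon> b v \<odot>\<^bsub>V\<^esub> b)"
    unfolding V.frame_def by blast+
  obtain C where C: "\<And>b v. b \<in> I \<Longrightarrow> v \<in> carrier V \<Longrightarrow> norm (\<epsilon> b v) \<le> C * vnorm V v"
    using fr unfolding V.frame_def by blast
  note fD = linear_mapsD(1-3)[OF f]
  have "vnorm W (f v) \<le> (\<Sum>b\<in>I. C * vnorm W (f b)) * vnorm V v" if v: "v \<in> carrier V" for v
  proof -
    have "f v = f (\<Oplus>\<^bsub>V\<^esub>b\<in>I. \<epsilon> b v \<odot>\<^bsub>V\<^esub> b)" by (rule arg_cong[OF rep[OF v]])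
    also have "\<dots> = (\<Oplus>\<^bsub>W\<^esub>b\<in>I. f (\<epsilon> b v \<odot>\<^bsub>V\<^esub> b))"
      using I by (intro linear_map_finsum[OF V.kspace_axioms W.kspace_axioms f]) auto
    also have "vnorm W \<dots> \<le> (\<Sum>b\<in>I. vnorm W (f (\<epsilon> b v \<odot>\<^bsub>V\<^esub> b)))"
      using I(2) by (intro W.N_finsum[OF I(1)] fD(1)) auto
    also have "\<dots> \<le> (\<Sum>b\<in>I. C * vnorm W (f b) * vnorm V v)"
    proof (rule sum_mono)
      fix b assume b: "b \<in> I"
      then have bc: "b \<in> carrier V" "f b \<in> carrier W" using I fD(1) by auto
      have "norm (\<epsilon> b v) * vnorm W (f b) \<le> (C * vnorm V v) * vnorm W (f b)"
        using C[OF b v] bc by (intro mult_right_mono) auto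
      then show "vnorm W (f (\<epsilon> b v \<odot>\<^bsub>V\<^esub> b)) \<le> C * vnorm W (f b) * vnorm V v"
        using bc by (simp add: fD(3) W.N_scale algebra_simps)
    qed
    finally show ?thesis by (simp add: sum_distrib_right)
  qed
  then show ?thesis unfolding bounded_map_def by blast
qed

lemma fin_dim_complete:
  assumes "fin_dim_normed_space V"
  shows "is_complete V"
  unfolding is_complete_def
proof (intro allI impI)
  interpret V: normed_kspace V "vnorm V" using fin_dimD(2)[OF assms] .
  obtain I \<epsilon> where fr: "V.frame (carrier V) I \<epsilon>"
    using V.finitely_spanned_frame[OF fin_dimD(3)[OF assms]] by blast
  fix s :: "nat \<Rightarrow> _"
  assume "\<forall>i. s i \<in> carrier V" "\<forall>e>0. \<exists>n0. \<forall>i\<ge>n0. \<forall>j\<ge>n0. vnorm V (s i \<ominus>\<^bsub>V\<^esub> s j) < e"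
  then show "\<exists>v\<in>carrier V. (\<lambda>i. vnorm V (s i \<ominus>\<^bsub>V\<^esub> v)) \<longlonglongrightarrow> 0"
    by (intro V.frame_complete[OF V.subspace_carrier fr]) auto
qed

section \<open>The operator norm as the best constant\<close>

context
  fixes V :: "('k::real_or_complex, 'v) normed_space" and W :: "('k, 'w) normed_space"
  assumes V: "normed_kspace V (vnorm V)" and W: "normed_kspace W (vnorm W)"
begin

interpretation V: normed_kspace V "vnorm V" by (rule V)
interpretation W: normed_kspace W "vnorm W" by (rule W)

lemma op_norm_le:
  assumes "0 \<le> C" "\<And>v. v \<in> carrier V \<Longrightarrow> vnorm W (f v) \<le> C * vnorm V v"
  shows "op_norm V W f \<le> C"
  unfolding op_norm_def
proof (rule cSup_least)
  show "{vnorm W (f v) |v. v \<in> carrier V \<and> vnorm V v \<le> 1} \<noteq> {}"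
    using V.zero_closed by force
  fix x assume "x \<in> {vnorm W (f v) |v. v \<in> carrier V \<and> vnorm V v \<le> 1}"
  then obtain v where "v \<in> carrier V" "vnorm V v \<le> 1" "x = vnorm W (f v)" by blast
  then show "x \<le> C" using assms(2)[of v] mult_left_mono[of "vnorm V v" 1 C] assms(1) by simp
qed

context
  fixes f
  assumes f: "f \<in> linear_maps V W" "bounded_map V W f"
begin

text \<open>Only a set that is bounded above has a meaningful real \<open>Sup\<close>. The absolute
  value enters the bound because the constant in \<open>bounded_map\<close> may have either
  sign.\<close>

private lemma op_norm_bdd: "bdd_above {vnorm W (f v) |v. v \<in> carrier V \<and> vnorm V v \<le> 1}"
proof -
  obtain C where C: "\<And>v. v \<in> carrier V \<Longrightarrow> vnorm W (f v) \<le> C * vnorm V v"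
    using f(2) unfolding bounded_map_def by blast
  show ?thesis
  proof (rule bdd_aboveI)
    fix x assume "x \<in> {vnorm W (f v) |v. v \<in> carrier V \<and> vnorm V v \<le> 1}"
    then obtain v where v: "v \<in> carrier V" "vnorm V v \<le> 1" "x = vnorm W (f v)" by blast
    have "C * vnorm V v \<le> \<bar>C\<bar> * 1" using v by (intro mult_mono) auto
    then show "x \<le> \<bar>C\<bar>" using v C[of v] by simp
  qed
qed

lemma op_norm_nonneg: "0 \<le> op_norm V W f"
proof -
  have "f \<zero>\<^bsub>V\<^esub> \<in> carrier W" using linear_mapsD(1)[OF f(1)] by simp
  then have "0 \<le> vnorm W (f \<zero>\<^bsub>V\<^esub>)" by simp
  also have "\<dots> \<le> op_norm V W f"
    unfolding op_norm_def by (rule cSup_upper[OF _ op_norm_bdd]) force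
  finally show ?thesis .
qed

lemma op_norm_bound:
  assumes v: "v \<in> carrier V"
  shows "vnorm W (f v) \<le> op_norm V W f * vnorm V v"
proof (cases "v = \<zero>\<^bsub>V\<^esub>")
  case True
  then show ?thesis using linear_map_zero[OF V.kspace_axioms W.kspace_axioms f(1)] by simp
next
  case False
  then have pos: "vnorm V v > 0" using v V.N_nonneg V.N_eq_0_iff by (metis less_eq_real_def)
  define w where "w = of_real (1 / vnorm V v) \<odot>\<^bsub>V\<^esub> v"
  have w: "w \<in> carrier V" "vnorm V w = 1" using v pos by (simp_all add: w_def V.N_scale norm_divide)
  have "vnorm W (f v) / vnorm V v = vnorm W (f w)"
    using v pos linear_mapsD(1,3)[OF f(1)] by (simp add: w_def W.N_scale norm_divide)
  also have "\<dots> \<le> op_norm V W f"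
    unfolding op_norm_def using w by (intro cSup_upper[OF _ op_norm_bdd]) force
  finally show ?thesis using pos by (simp add: divide_le_eq)
qed

end

end

lemma normed_kspace_scalar_space: "normed_kspace scalar_space norm"
  by (simp add: normed_kspace_def normed_kspace_axioms_def kspace_scalar_space is_norm_def
      norm_mult norm_triangle_ineq)

section \<open>Universal property of the spaces of evaluations\<close>

lemma evaluation_span_simps [simp]:
  "zero (evaluation_span X \<Phi>) = (\<lambda>\<phi>\<in>\<Phi>. 0)"
  "add (evaluation_span X \<Phi>) = (\<lambda>u v. \<lambda>\<phi>\<in>\<Phi>. u \<phi> + v \<phi>)"
  "smult (evaluation_span X \<Phi>) = (\<lambda>a u. \<lambda>\<phi>\<in>\<Phi>. a * u \<phi>)"
  by (simp_all add: evaluation_span_def)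

lemma evaluation_span_carrier:
  "u \<in> carrier (evaluation_span X \<Phi>) \<longleftrightarrow>
     (\<exists>B c. u = (\<lambda>\<phi>\<in>\<Phi>. \<Sum>x\<in>B. c x * \<phi> x) \<and> finite B \<and> B \<subseteq> X)"
proof -
  have "(\<lambda>\<phi>\<in>\<Phi>. \<Sum>x\<in>B. c x * evaluation \<Phi> x \<phi>) = (\<lambda>\<phi>\<in>\<Phi>. \<Sum>x\<in>B. c x * \<phi> x)" for B c
    by (auto simp: evaluation_def intro!: restrict_ext)
  then show ?thesis by (simp add: evaluation_span_def)
qed

lemma evaluation_in_span:
  assumes "x \<in> X"
  shows "evaluation \<Phi> x \<in> carrier (evaluation_span X \<Phi>)"
  unfolding evaluation_span_carrier evaluation_def
  using assms by (intro exI[of _ "{x}"] exI[of _ "\<lambda>_. 1"]) simp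

lemma evaluation_span_extensional:
  "u \<in> carrier (evaluation_span X \<Phi>) \<Longrightarrow> u \<in> extensional \<Phi>"
  by (auto simp: evaluation_span_carrier)

lemma evaluation_span_add:
  assumes "u \<in> carrier (evaluation_span X \<Phi>)" "v \<in> carrier (evaluation_span X \<Phi>)"
  shows "(\<lambda>\<phi>\<in>\<Phi>. u \<phi> + v \<phi>) \<in> carrier (evaluation_span X \<Phi>)"
proof -
  obtain B c where u: "u = (\<lambda>\<phi>\<in>\<Phi>. \<Sum>x\<in>B. c x * \<phi> x)" "finite B" "B \<subseteq> X"
    using assms(1) unfolding evaluation_span_carrier by blast
  obtain B' c' where v: "v = (\<lambda>\<phi>\<in>\<Phi>. \<Sum>x\<in>B'. c' x * \<phi> x)" "finite B'" "B' \<subseteq> X"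
    using assms(2) unfolding evaluation_span_carrier by blast
  \<comment> \<open>Extending the coefficients by 0 puts both combinations on the common index set
    \<open>B \<union> B'\<close>.\<close>
  define d where "d x = (if x \<in> B then c x else 0)" for x
  define d' where "d' x = (if x \<in> B' then c' x else 0)" for x
  have "(\<Sum>x\<in>B. c x * \<phi> x) = (\<Sum>x\<in>B \<union> B'. d x * \<phi> x)"
    "(\<Sum>x\<in>B'. c' x * \<phi> x) = (\<Sum>x\<in>B \<union> B'. d' x * \<phi> x)" for \<phi>
    using u(2) v(2) by (auto simp: d_def d'_def intro!: sum.mono_neutral_cong_left)
  then have "(\<lambda>\<phi>\<in>\<Phi>. u \<phi> + v \<phi>) = (\<lambda>\<phi>\<in>\<Phi>. \<Sum>x\<in>B \<union> B'. (d x + d' x) * \<phi> x)"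
    by (auto simp: u(1) v(1) distrib_right sum.distrib intro!: restrict_ext)
  then show ?thesis
    unfolding evaluation_span_carrier using u v
    by (intro exI[of _ "B \<union> B'"] exI[of _ "\<lambda>x. d x + d' x"]) auto
qed

lemma evaluation_span_scale:
  assumes "u \<in> carrier (evaluation_span X \<Phi>)"
  shows "(\<lambda>\<phi>\<in>\<Phi>. a * u \<phi>) \<in> carrier (evaluation_span X \<Phi>)"
proof -
  obtain B c where u: "u = (\<lambda>\<phi>\<in>\<Phi>. \<Sum>x\<in>B. c x * \<phi> x)" "finite B" "B \<subseteq> X"
    using assms(1) unfolding evaluation_span_carrier by blast
  have "(\<lambda>\<phi>\<in>\<Phi>. a * u \<phi>) = (\<lambda>\<phi>\<in>\<Phi>. \<Sum>x\<in>B. (a * c x) * \<phi> x)"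
    by (auto simp: u(1) sum_distrib_left mult.assoc intro!: restrict_ext)
  then show ?thesis
    unfolding evaluation_span_carrier using u
    by (intro exI[of _ B] exI[of _ "\<lambda>x. a * c x"]) auto
qed

lemma evaluation_span_zero: "(\<lambda>\<phi>\<in>\<Phi>. 0) \<in> carrier (evaluation_span X \<Phi>)"
  unfolding evaluation_span_carrier by (intro exI[of _ "{}"]) simp

lemma evaluation_span_induct [consumes 1, case_names zero step]:
  assumes "u \<in> carrier (evaluation_span X \<Phi>)"
    and zero: "P (\<lambda>\<phi>\<in>\<Phi>. 0)"
    and step: "\<And>u a x. u \<in> carrier (evaluation_span X \<Phi>) \<Longrightarrow> P u \<Longrightarrow> x \<in> X \<Longrightarrow>
      P (u \<oplus>\<^bsub>evaluation_span X \<Phi>\<^esub> a \<odot>\<^bsub>evaluation_span X \<Phi>\<^esub> evaluation \<Phi> x)"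
  shows "P u"
proof -
  obtain B c where u: "u = (\<lambda>\<phi>\<in>\<Phi>. \<Sum>x\<in>B. c x * \<phi> x)" "finite B" "B \<subseteq> X"
    using assms(1) unfolding evaluation_span_carrier by blast
  have "P (\<lambda>\<phi>\<in>\<Phi>. \<Sum>x\<in>B. c x * \<phi> x)"
    using u(2,3)
  proof (induction B)
    case empty
    then show ?case using zero by (simp only: sum.empty)
  next
    case (insert y B)
    let ?w = "\<lambda>\<phi>\<in>\<Phi>. \<Sum>x\<in>B. c x * \<phi> x"
    have w: "?w \<in> carrier (evaluation_span X \<Phi>)"
      unfolding evaluation_span_carrier using insert by auto
    have y: "y \<in> X" and B: "B \<subseteq> X" using insert.prems by auto
    have "P (?w \<oplus>\<^bsub>evaluation_span X \<Phi>\<^esub> c y \<odot>\<^bsub>evaluation_span X \<Phi>\<^esub> evaluation \<Phi> y)"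
      by (rule step[OF w insert.IH[OF B] y])
    also have "?w \<oplus>\<^bsub>evaluation_span X \<Phi>\<^esub> c y \<odot>\<^bsub>evaluation_span X \<Phi>\<^esub> evaluation \<Phi> y
        = (\<lambda>\<phi>\<in>\<Phi>. \<Sum>x\<in>insert y B. c x * \<phi> x)"
      using insert by (auto simp: evaluation_def intro!: restrict_ext)
    finally show ?case .
  qed
  then show ?thesis using u(1) by simp
qed

lemma kspace_evaluation_span: "kspace (evaluation_span X \<Phi>)"
proof (rule kspaceI, goal_cases)
  case (5 v)
  then show ?case using evaluation_span_extensional[OF 5]
    by (auto simp: fun_eq_iff restrict_def extensional_def)
next
  case (11 v)
  then show ?case using evaluation_span_extensional[OF 11]
    by (auto simp: fun_eq_iff restrict_def extensional_def)
qed (auto simp: evaluation_span_add evaluation_span_scale evaluation_span_zero algebra_simps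
    intro!: restrict_ext)

lemma evaluation_span_apply:
  assumes "\<phi> \<in> \<Phi>"
  shows "(\<lambda>u\<in>carrier (evaluation_span X \<Phi>). u \<phi>) \<in> linear_maps (evaluation_span X \<Phi>) scalar_space"
  using assms
  by (intro linear_mapsI) (auto simp: evaluation_span_add evaluation_span_scale)

text \<open>The elements are functions on \<open>\<Phi>\<close>, so the evaluations
  \<open>u \<mapsto> u \<phi>\<close> already separate them.\<close>

lemma separated_evaluation_span: "separated (evaluation_span X \<Phi>)"
  unfolding separated_def
proof (intro conjI ballI impI kspace_evaluation_span)
  fix u assume u: "u \<in> carrier (evaluation_span X \<Phi>)"
    and 0: "\<forall>l\<in>linear_maps (evaluation_span X \<Phi>) scalar_space. l u = 0"
  have "u \<phi> = 0" if "\<phi> \<in> \<Phi>" for \<phi>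
    using bspec[OF 0 evaluation_span_apply[OF that]] u by simp
  then show "u = \<zero>\<^bsub>evaluation_span X \<Phi>\<^esub>"
    using evaluation_span_extensional[OF u] by (auto simp: fun_eq_iff restrict_def extensional_def)
qed

lemma linear_maps_evaluation_span_eqI:
  assumes W: "kspace W" and f: "f \<in> linear_maps (evaluation_span X \<Phi>) W"
    and g: "g \<in> linear_maps (evaluation_span X \<Phi>) W"
    and eq: "\<And>x. x \<in> X \<Longrightarrow> f (evaluation \<Phi> x) = g (evaluation \<Phi> x)"
  shows "f = g"
proof (rule extensionalityI[OF linear_mapsD(4)[OF f] linear_mapsD(4)[OF g]])
  let ?E = "evaluation_span X \<Phi>"
  interpret E: kspace ?E by (rule kspace_evaluation_span)
  fix u assume "u \<in> carrier ?E"
  then show "f u = g u"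
  proof (induction rule: evaluation_span_induct)
    case zero
    then show ?case
      using linear_map_zero[OF E.kspace_axioms W f] linear_map_zero[OF E.kspace_axioms W g]
      by (simp only: evaluation_span_simps)
  next
    case (step u a x)
    have x: "evaluation \<Phi> x \<in> carrier ?E" by (rule evaluation_in_span[OF step.hyps(2)])
    have ax: "a \<odot>\<^bsub>?E\<^esub> evaluation \<Phi> x \<in> carrier ?E" by (rule E.scale_closed[OF x])
    show ?case
      unfolding linear_mapsD(2)[OF f step.hyps(1) ax] linear_mapsD(2)[OF g step.hyps(1) ax]
        linear_mapsD(3)[OF f x] linear_mapsD(3)[OF g x] step.IH eq[OF step.hyps(2)] ..
  qed
qed

context
  fixes W :: "('k::real_or_complex, 'w, 'n) module_scheme"
    and X :: "'x set" and \<Phi> :: "('x \<Rightarrow> 'k) set" and T :: "'x \<Rightarrow> 'w"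
  assumes W: "separated W" and T: "\<And>x. x \<in> X \<Longrightarrow> T x \<in> carrier W"
    and T_forms: "\<And>l. l \<in> linear_maps W scalar_space \<Longrightarrow> (\<lambda>x\<in>X. l (T x)) \<in> \<Phi>"
begin

text \<open>
  Since \<open>W\<close> is separated, the value of the linearization at \<open>u\<close> is determined by its images
  under linear functionals \<open>l\<close>, which have to be \<open>u (l \<circ> T)\<close>.
\<close>

private lemma linearization_exists:
  "\<exists>L\<in>linear_maps (evaluation_span X \<Phi>) W. \<forall>x\<in>X. L (evaluation \<Phi> x) = T x"
proof -
  let ?E = "evaluation_span X \<Phi>"
  interpret W: kspace W using W by (simp add: separated_def)
  \<comment> \<open>Induction along the span produces a candidate \<open>w\<close> by adding
    \<open>a \<odot> T x\<close> for each term. Its functional values depend on \<open>u\<close>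
    alone, so the representation of \<open>u\<close> does not matter.\<close>
  have "\<exists>w\<in>carrier W. \<forall>l\<in>linear_maps W scalar_space. l w = u (\<lambda>x\<in>X. l (T x))"
    if "u \<in> carrier ?E" for u
    using that
  proof (induction rule: evaluation_span_induct)
    case zero
    show ?case
    proof (intro bexI[of _ "\<zero>\<^bsub>W\<^esub>"] ballI)
      fix l assume l: "l \<in> linear_maps W scalar_space"
      show "l \<zero>\<^bsub>W\<^esub> = (\<lambda>\<phi>\<in>\<Phi>. 0) (\<lambda>x\<in>X. l (T x))"
        unfolding restrict_apply'[OF T_forms[OF l]]
        using linear_map_zero[OF W.kspace_axioms kspace_scalar_space l] by simp
    qed simp
  next
    case (step u a x)
    then obtain w where w: "w \<in> carrier W" "\<And>l. l \<in> linear_maps W scalar_space \<Longrightarrow> l w = u (\<lambda>x\<in>X. l (T x))"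
      by blast
    show ?case
    proof (intro bexI[of _ "w \<oplus>\<^bsub>W\<^esub> a \<odot>\<^bsub>W\<^esub> T x"] ballI)
      fix l assume l: "l \<in> linear_maps W scalar_space"
      then show "l (w \<oplus>\<^bsub>W\<^esub> a \<odot>\<^bsub>W\<^esub> T x) = (u \<oplus>\<^bsub>?E\<^esub> a \<odot>\<^bsub>?E\<^esub> evaluation \<Phi> x) (\<lambda>x\<in>X. l (T x))"
        using w T[OF step.hyps(2)] T_forms[OF l] step.hyps(2)
        by (simp add: linear_map_scalarD[OF l] evaluation_def)
    qed (use w T[OF step.hyps(2)] in simp)
  qed
  then obtain L where L: "\<And>u. u \<in> carrier ?E \<Longrightarrow> L u \<in> carrier W"
    "\<And>u l. u \<in> carrier ?E \<Longrightarrow> l \<in> linear_maps W scalar_space \<Longrightarrow> l (L u) = u (\<lambda>x\<in>X. l (T x))"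
    by metis
  have "restrict L (carrier ?E) \<in> linear_maps ?E W"
  proof (rule linear_mapsI)
    fix u v assume u: "u \<in> carrier ?E" and v: "v \<in> carrier ?E"
    have uv: "u \<oplus>\<^bsub>?E\<^esub> v \<in> carrier ?E" using evaluation_span_add[OF u v] by simp
    have "L (u \<oplus>\<^bsub>?E\<^esub> v) = L u \<oplus>\<^bsub>W\<^esub> L v"
    proof (rule separated_eqI[OF W])
      fix l assume l: "l \<in> linear_maps W scalar_space"
      show "l (L (u \<oplus>\<^bsub>?E\<^esub> v)) = l (L u \<oplus>\<^bsub>W\<^esub> L v)"
        unfolding L(2)[OF uv l] linear_map_scalarD(1)[OF l L(1)[OF u] L(1)[OF v]]
          L(2)[OF u l] L(2)[OF v l] using T_forms[OF l] by simp
    qed (use L(1) u v uv in auto)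
    then show "restrict L (carrier ?E) (u \<oplus>\<^bsub>?E\<^esub> v) = restrict L (carrier ?E) u \<oplus>\<^bsub>W\<^esub> restrict L (carrier ?E) v"
      using u v uv by (simp del: evaluation_span_simps)
  next
    fix a u assume u: "u \<in> carrier ?E"
    have au: "a \<odot>\<^bsub>?E\<^esub> u \<in> carrier ?E" using evaluation_span_scale[OF u] by simp
    have "L (a \<odot>\<^bsub>?E\<^esub> u) = a \<odot>\<^bsub>W\<^esub> L u"
    proof (rule separated_eqI[OF W])
      fix l assume l: "l \<in> linear_maps W scalar_space"
      show "l (L (a \<odot>\<^bsub>?E\<^esub> u)) = l (a \<odot>\<^bsub>W\<^esub> L u)"
        unfolding L(2)[OF au l] linear_map_scalarD(2)[OF l L(1)[OF u]] L(2)[OF u l]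
        using T_forms[OF l] by simp
    qed (use L(1) u au in auto)
    then show "restrict L (carrier ?E) (a \<odot>\<^bsub>?E\<^esub> u) = a \<odot>\<^bsub>W\<^esub> restrict L (carrier ?E) u"
      using u au by (simp del: evaluation_span_simps)
  qed (auto simp: L(1))
  moreover have "L (evaluation \<Phi> x) = T x" if x: "x \<in> X" for x
  proof (rule separated_eqI[OF W L(1)[OF evaluation_in_span[OF x]] T[OF x]])
    fix l assume l: "l \<in> linear_maps W scalar_space"
    show "l (L (evaluation \<Phi> x)) = l (T x)"
      using L(2)[OF evaluation_in_span[OF x] l] T_forms[OF l] x by (simp add: evaluation_def)
  qed
  ultimately show ?thesis
    by (intro bexI[of _ "restrict L (carrier ?E)"]) (simp_all add: evaluation_in_span)
qed

text \<open>The definite description denotes: existence is \<open>linearization_exists\<close>, and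
  linear maps that agree on the evaluations agree on their span.\<close>

lemma linearization_props:
  "linearization X \<Phi> W T \<in> linear_maps (evaluation_span X \<Phi>) W \<and>
   (\<forall>x\<in>X. linearization X \<Phi> W T (evaluation \<Phi> x) = T x)"
proof -
  have W': "kspace W" using W by (simp add: separated_def)
  obtain L where L: "L \<in> linear_maps (evaluation_span X \<Phi>) W" "\<forall>x\<in>X. L (evaluation \<Phi> x) = T x"
    using linearization_exists by blast
  show ?thesis
    unfolding linearization_def
  proof (rule theI[of _ L])
    fix L' assume "L' \<in> linear_maps (evaluation_span X \<Phi>) W \<and> (\<forall>x\<in>X. L' (evaluation \<Phi> x) = T x)"
    then show "L' = L" using L by (intro linear_maps_evaluation_span_eqI[OF W']) auto
  qed (use L in blast)
qed

end


section \<open>Multilinear maps\<close>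

lemma tuples_iff: "x \<in> tuples Es \<longleftrightarrow> length x = length Es \<and> (\<forall>i<length Es. x ! i \<in> carrier (Es ! i))"
  unfolding tuples_def
proof (induction Es arbitrary: x)
  case (Cons E Es)
  then show ?case
    by (cases x) (auto simp: set_Cons_def nth_Cons less_Suc_eq_0_disj split: nat.splits)
qed simp

lemma tuples_update: "x \<in> tuples Es \<Longrightarrow> i < length Es \<Longrightarrow> v \<in> carrier (Es ! i) \<Longrightarrow> x[i := v] \<in> tuples Es"
  by (auto simp: tuples_iff nth_list_update)

lemma multilinear_space_simps [simp]:
  "carrier (multilinear_space Es W) = multilinear_maps Es W"
  "zero (multilinear_space Es W) = (\<lambda>x\<in>tuples Es. \<zero>\<^bsub>W\<^esub>)"
  "add (multilinear_space Es W) = (\<lambda>S T. \<lambda>x\<in>tuples Es. S x \<oplus>\<^bsub>W\<^esub> T x)"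
  "smult (multilinear_space Es W) = (\<lambda>a T. \<lambda>x\<in>tuples Es. a \<odot>\<^bsub>W\<^esub> T x)"
  by (simp_all add: multilinear_space_def)

abbreviation forms :: "('k::real_or_complex, 'a) normed_space list \<Rightarrow> ('k, 'a list \<Rightarrow> 'k) module" where
  "forms Es \<equiv> multilinear_space Es scalar_space"

lemma multilinear_mapsD1:
  assumes "T \<in> multilinear_maps Es W"
  shows "x \<in> tuples Es \<Longrightarrow> T x \<in> carrier W" "T \<in> extensional (tuples Es)"
  using assms by (auto simp: multilinear_maps_def PiE_def)

section \<open>Closure properties and separation of spaces of multilinear maps\<close>

context
  fixes Es :: "('k::real_or_complex, 'a) normed_space list"
  assumes Es: "\<forall>E\<in>set Es. kspace E"
begin

text \<open>The restricted functions of one slot in the definition are replaced by equations between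
  values of \<open>T\<close>; updated tuples are again tuples because each factor is closed under
  its operations.\<close>

lemma multilinear_maps_iff:
  "T \<in> multilinear_maps Es W \<longleftrightarrow>
     T \<in> extensional (tuples Es) \<and> (\<forall>x\<in>tuples Es. T x \<in> carrier W) \<and>
     (\<forall>x\<in>tuples Es. \<forall>i<length Es. \<forall>u\<in>carrier (Es ! i). \<forall>v\<in>carrier (Es ! i).
        T (x[i := u \<oplus>\<^bsub>Es ! i\<^esub> v]) = T (x[i := u]) \<oplus>\<^bsub>W\<^esub> T (x[i := v])) \<and>
     (\<forall>x\<in>tuples Es. \<forall>i<length Es. \<forall>a. \<forall>v\<in>carrier (Es ! i).
        T (x[i := a \<odot>\<^bsub>Es ! i\<^esub> v]) = a \<odot>\<^bsub>W\<^esub> T (x[i := v]))"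
  (is "_ \<longleftrightarrow> ?ext \<and> ?cl \<and> ?add \<and> ?scale")
proof -
  have slot: "(\<lambda>v\<in>carrier (Es ! i). T (x[i := v])) \<in> linear_maps (Es ! i) W \<longleftrightarrow>
      (\<forall>u\<in>carrier (Es ! i). \<forall>v\<in>carrier (Es ! i).
        T (x[i := u \<oplus>\<^bsub>Es ! i\<^esub> v]) = T (x[i := u]) \<oplus>\<^bsub>W\<^esub> T (x[i := v])) \<and>
      (\<forall>a. \<forall>v\<in>carrier (Es ! i). T (x[i := a \<odot>\<^bsub>Es ! i\<^esub> v]) = a \<odot>\<^bsub>W\<^esub> T (x[i := v]))"
    if cl: "\<forall>x\<in>tuples Es. T x \<in> carrier W" and x: "x \<in> tuples Es" and i: "i < length Es" for x i
  proof -
    interpret E: kspace "Es ! i" using Es i by simp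
    show ?thesis
      using cl tuples_update[OF x i] by (auto simp: linear_maps_def)
  qed
  show ?thesis
    unfolding multilinear_maps_def PiE_def Pi_def using slot by auto
qed

lemma multilinear_mapsD:
  assumes "T \<in> multilinear_maps Es W" "x \<in> tuples Es" "i < length Es"
  shows "u \<in> carrier (Es ! i) \<Longrightarrow> v \<in> carrier (Es ! i) \<Longrightarrow>
      T (x[i := u \<oplus>\<^bsub>Es ! i\<^esub> v]) = T (x[i := u]) \<oplus>\<^bsub>W\<^esub> T (x[i := v])"
    and "v \<in> carrier (Es ! i) \<Longrightarrow> T (x[i := a \<odot>\<^bsub>Es ! i\<^esub> v]) = a \<odot>\<^bsub>W\<^esub> T (x[i := v])"
  using assms unfolding multilinear_maps_iff by blast+

text \<open>The extra membership premises let \<open>simp\<close> evaluate a map that is restricted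
  to \<open>tuples Es\<close> at the updated tuples.\<close>

lemma multilinear_mapsI:
  assumes "T \<in> extensional (tuples Es)" "\<And>x. x \<in> tuples Es \<Longrightarrow> T x \<in> carrier W"
    and "\<And>x i u v. x \<in> tuples Es \<Longrightarrow> i < length Es \<Longrightarrow> u \<in> carrier (Es ! i) \<Longrightarrow> v \<in> carrier (Es ! i) \<Longrightarrow>
      x[i := u] \<in> tuples Es \<Longrightarrow> x[i := v] \<in> tuples Es \<Longrightarrow> x[i := u \<oplus>\<^bsub>Es ! i\<^esub> v] \<in> tuples Es \<Longrightarrow>
      T (x[i := u \<oplus>\<^bsub>Es ! i\<^esub> v]) = T (x[i := u]) \<oplus>\<^bsub>W\<^esub> T (x[i := v])"
    and "\<And>x i a v. x \<in> tuples Es \<Longrightarrow> i < length Es \<Longrightarrow> v \<in> carrier (Es ! i) \<Longrightarrow>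
      x[i := v] \<in> tuples Es \<Longrightarrow> x[i := a \<odot>\<^bsub>Es ! i\<^esub> v] \<in> tuples Es \<Longrightarrow>
      T (x[i := a \<odot>\<^bsub>Es ! i\<^esub> v]) = a \<odot>\<^bsub>W\<^esub> T (x[i := v])"
  shows "T \<in> multilinear_maps Es W"
  unfolding multilinear_maps_iff
proof (intro conjI ballI allI impI)
  fix x i assume x: "x \<in> tuples Es" and i: "i < length Es"
  interpret E: kspace "Es ! i" using Es i by simp
  note up = tuples_update[OF x i]
  show "T (x[i := u \<oplus>\<^bsub>Es ! i\<^esub> v]) = T (x[i := u]) \<oplus>\<^bsub>W\<^esub> T (x[i := v])"
    if "u \<in> carrier (Es ! i)" "v \<in> carrier (Es ! i)" for u v
    using assms(3)[OF x i that] up that by simp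
  show "T (x[i := a \<odot>\<^bsub>Es ! i\<^esub> v]) = a \<odot>\<^bsub>W\<^esub> T (x[i := v])" if "v \<in> carrier (Es ! i)" for a v
    using assms(4)[OF x i that] up that by simp
qed (use assms(1,2) in auto)

lemma multilinear_compose:
  assumes T: "T \<in> multilinear_maps Es W" and l: "l \<in> linear_maps W Z"
  shows "(\<lambda>x\<in>tuples Es. l (T x)) \<in> multilinear_maps Es Z"
proof (rule multilinear_mapsI)
  note TD = multilinear_mapsD1(1)[OF T]
  show "(\<lambda>x\<in>tuples Es. l (T x)) x \<in> carrier Z" if "x \<in> tuples Es" for x
    using that TD linear_mapsD(1)[OF l] by simp
qed (simp_all add: multilinear_mapsD[OF T] multilinear_mapsD1(1)[OF T] linear_mapsD(2,3)[OF l])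

lemma multilinear_add:
  assumes W: "kspace W" and S: "S \<in> multilinear_maps Es W" and T: "T \<in> multilinear_maps Es W"
  shows "(\<lambda>x\<in>tuples Es. S x \<oplus>\<^bsub>W\<^esub> T x) \<in> multilinear_maps Es W"
proof -
  interpret W: kspace W by fact
  show ?thesis
    by (rule multilinear_mapsI)
      (simp_all add: multilinear_mapsD[OF T] multilinear_mapsD[OF S] multilinear_mapsD1(1)[OF T]
        multilinear_mapsD1(1)[OF S] W.add_interchange W.scale_right_distrib)
qed

lemma multilinear_scale:
  assumes W: "kspace W" and T: "T \<in> multilinear_maps Es W"
  shows "(\<lambda>x\<in>tuples Es. a \<odot>\<^bsub>W\<^esub> T x) \<in> multilinear_maps Es W"
proof -
  interpret W: kspace W by fact
  show ?thesis
    by (rule multilinear_mapsI)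
      (simp_all add: multilinear_mapsD[OF T] multilinear_mapsD1(1)[OF T] W.scale_right_distrib
        mult.commute)
qed

lemma multilinear_zero:
  assumes "kspace W"
  shows "(\<lambda>x\<in>tuples Es. \<zero>\<^bsub>W\<^esub>) \<in> multilinear_maps Es W"
proof -
  interpret W: kspace W by fact
  show ?thesis by (rule multilinear_mapsI) simp_all
qed

lemma kspace_multilinear_space:
  assumes "kspace W"
  shows "kspace (multilinear_space Es W)"
proof -
  interpret W: kspace W by fact
  note cl = multilinear_mapsD1(1)[where W=W]
  show ?thesis
  proof (rule kspaceI, goal_cases)
    case (5 v)
    then have v: "v \<in> multilinear_maps Es W" by simp
    show ?case
      by (rule extensionalityI[OF _ multilinear_mapsD1(2)[OF v]]) (simp_all add: cl[OF v])
  next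
    case (11 v)
    then have v: "v \<in> multilinear_maps Es W" by simp
    show ?case
      by (rule extensionalityI[OF _ multilinear_mapsD1(2)[OF v]]) (simp_all add: cl[OF v])
  qed (auto simp: multilinear_add multilinear_scale multilinear_zero assms cl W.a_assoc W.scale_left_distrib
      W.scale_right_distrib W.scale_minus_one W.l_neg intro!: restrict_ext intro: W.a_comm)
qed

text \<open>With a functional \<open>l\<close> this yields functionals on a space of multilinear
  maps; with the identity it yields evaluation at \<open>x\<close> itself.\<close>

lemma multilinear_eval_linear:
  assumes "kspace W" "x \<in> tuples Es" "l \<in> linear_maps W Z"
  shows "(\<lambda>T\<in>multilinear_maps Es W. l (T x)) \<in> linear_maps (multilinear_space Es W) Z"
  using assms multilinear_mapsD1(1)[of _ Es W x]
  by (intro linear_mapsI)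
    (simp_all add: multilinear_add multilinear_scale linear_mapsD(1-3)[OF assms(3)])

text \<open>The functionals \<open>T \<mapsto> l (T x)\<close> separate: if all of them vanish at
  \<open>T\<close>, every value \<open>T x\<close> is zero.\<close>

lemma separated_multilinear_space:
  assumes W: "separated W"
  shows "separated (multilinear_space Es W)"
  unfolding separated_def
proof (intro conjI ballI impI)
  have W': "kspace W" using W by (simp add: separated_def)
  then interpret W: kspace W .
  show "kspace (multilinear_space Es W)" by (rule kspace_multilinear_space[OF W'])
  fix T assume "T \<in> carrier (multilinear_space Es W)"
    and 0: "\<forall>l\<in>linear_maps (multilinear_space Es W) scalar_space. l T = 0"
  then have T: "T \<in> multilinear_maps Es W" by simp
  have "T x = \<zero>\<^bsub>W\<^esub>" if x: "x \<in> tuples Es" for x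
  proof (rule separated_eqI[OF W multilinear_mapsD1(1)[OF T x] W.zero_closed])
    fix l assume l: "l \<in> linear_maps W scalar_space"
    show "l (T x) = l \<zero>\<^bsub>W\<^esub>"
      using bspec[OF 0 multilinear_eval_linear[OF W' x l]] T
        linear_map_zero[OF W' kspace_scalar_space l] by simp
  qed
  then show "T = \<zero>\<^bsub>multilinear_space Es W\<^esub>"
    using multilinear_mapsD1(2)[OF T] by (auto simp: extensional_def)
qed

lemma multilinear_zero_on_spanning:
  assumes W: "kspace W" and T: "T \<in> multilinear_maps Es W"
    and S: "\<And>i. i < length Es \<Longrightarrow> finite (S i) \<and> S i \<subseteq> carrier (Es ! i) \<and>
      (\<forall>v\<in>carrier (Es ! i). \<exists>c. v = (\<Oplus>\<^bsub>Es ! i\<^esub>b\<in>S i. c b \<odot>\<^bsub>Es ! i\<^esub> b))"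
    and 0: "\<And>x. length x = length Es \<Longrightarrow> (\<And>i. i < length Es \<Longrightarrow> x ! i \<in> S i) \<Longrightarrow> T x = \<zero>\<^bsub>W\<^esub>"
    and x: "x \<in> tuples Es"
  shows "T x = \<zero>\<^bsub>W\<^esub>"
proof -
  interpret W: kspace W by fact
  \<comment> \<open>Induction on the number \<open>k\<close> of leading slots with arbitrary
    entries, all later slots holding spanning vectors. One more slot is freed by expanding its entry
    and using linearity there.\<close>
  have "T x = \<zero>\<^bsub>W\<^esub>" if "k \<le> length Es" "x \<in> tuples Es" "\<And>i. k \<le> i \<Longrightarrow> i < length Es \<Longrightarrow> x ! i \<in> S i" for k x
    using that
  proof (induction k arbitrary: x)
    case 0
    then show ?case by (intro assms(4)) (auto simp: tuples_iff)
  next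
    case (Suc k)
    then have k: "k < length Es" by simp
    interpret E: kspace "Es ! k" using Es k by simp
    have xk: "x ! k \<in> carrier (Es ! k)" using Suc.prems k by (auto simp: tuples_iff)
    define f where "f = (\<lambda>v\<in>carrier (Es ! k). T (x[k := v]))"
    have f: "f \<in> linear_maps (Es ! k) W"
      using T k Suc.prems(2) unfolding multilinear_maps_def f_def by blast
    have fb: "f b = \<zero>\<^bsub>W\<^esub>" if "b \<in> S k" for b
    proof -
      have b: "b \<in> carrier (Es ! k)" using S[OF k] that by blast
      have "T (x[k := b]) = \<zero>\<^bsub>W\<^esub>"
      proof (rule Suc.IH)
        show "x[k := b] \<in> tuples Es" using tuples_update[OF Suc.prems(2) k b] .
        show "x[k := b] ! i \<in> S i" if "k \<le> i" "i < length Es" for i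
          using that Suc.prems(3)[of i] \<open>b \<in> S k\<close> k Suc.prems(2)
          by (cases "i = k") (auto simp: tuples_iff)
      qed (use k in simp)
      then show ?thesis using b by (simp add: f_def)
    qed
    obtain c where c: "x ! k = (\<Oplus>\<^bsub>Es ! k\<^esub>b\<in>S k. c b \<odot>\<^bsub>Es ! k\<^esub> b)" using S[OF k] xk by blast
    have "f (x ! k) = (\<Oplus>\<^bsub>W\<^esub>b\<in>S k. f (c b \<odot>\<^bsub>Es ! k\<^esub> b))"
      unfolding c using S[OF k] by (intro linear_map_finsum[OF E.kspace_axioms W f]) auto
    also have "\<dots> = (\<Oplus>\<^bsub>W\<^esub>b\<in>S k. \<zero>\<^bsub>W\<^esub>)"
      using S[OF k] linear_mapsD(3)[OF f] fb by (intro W.finsum_cong') auto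
    finally show ?case using xk by (simp add: f_def)
  qed
  from this[of "length Es" x] x show ?thesis by simp
qed

end

section \<open>Finite dimensionality\<close>

lemma linear_map_compose:
  assumes "kspace V" "f \<in> linear_maps V W" "g \<in> linear_maps W Z"
  shows "(\<lambda>v\<in>carrier V. g (f v)) \<in> linear_maps V Z"
proof -
  interpret V: kspace V by fact
  show ?thesis
    by (rule linear_mapsI) (simp_all add: linear_mapsD(1-3)[OF assms(2)] linear_mapsD(1-3)[OF assms(3)])
qed

lemma linear_map_id: "kspace V \<Longrightarrow> (\<lambda>v\<in>carrier V. v) \<in> linear_maps V V"
proof -
  assume "kspace V"
  then interpret V: kspace V .
  show ?thesis by (rule linear_mapsI) simp_all
qed

text \<open>Such a family of functionals passes to the domain of an injective linear map by mere
  composition, which a spanning set does not; this makes it the working form of finite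
  dimensionality.\<close>

definition finitely_separated :: "('k::real_or_complex, 'v, 'm) module_scheme \<Rightarrow> bool" where
  "finitely_separated V \<longleftrightarrow> (\<exists>\<Lambda>. finite \<Lambda> \<and> \<Lambda> \<subseteq> linear_maps V scalar_space \<and>
     (\<forall>v\<in>carrier V. (\<forall>l\<in>\<Lambda>. l v = 0) \<longrightarrow> v = \<zero>\<^bsub>V\<^esub>))"

lemma finitely_separated_spanned:
  assumes "kspace V" "finitely_separated V"
  shows "finitely_spanned V"
proof -
  obtain \<Lambda> where "finite \<Lambda>" "\<Lambda> \<subseteq> linear_maps V scalar_space"
    "\<And>v. v \<in> carrier V \<Longrightarrow> (\<And>l. l \<in> \<Lambda> \<Longrightarrow> l v = 0) \<Longrightarrow> v = \<zero>\<^bsub>V\<^esub>"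
    using assms(2) unfolding finitely_separated_def by metis
  then show ?thesis by (rule kspace.finite_separating_spanned[OF assms(1)])
qed

lemma finitely_separated_pullback:
  assumes V: "kspace V" and f: "f \<in> linear_maps V W"
    and inj: "\<And>v. v \<in> carrier V \<Longrightarrow> f v = \<zero>\<^bsub>W\<^esub> \<Longrightarrow> v = \<zero>\<^bsub>V\<^esub>" and W: "finitely_separated W"
  shows "finitely_separated V"
proof -
  obtain \<Lambda> where L: "finite \<Lambda>" "\<Lambda> \<subseteq> linear_maps W scalar_space"
    "\<And>w. w \<in> carrier W \<Longrightarrow> \<forall>l\<in>\<Lambda>. l w = 0 \<Longrightarrow> w = \<zero>\<^bsub>W\<^esub>"
    using W unfolding finitely_separated_def by metis
  show ?thesis
    unfolding finitely_separated_def
  proof (intro exI[of _ "(\<lambda>l. \<lambda>v\<in>carrier V. l (f v)) ` \<Lambda>"] conjI ballI impI)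
    show "(\<lambda>l. \<lambda>v\<in>carrier V. l (f v)) ` \<Lambda> \<subseteq> linear_maps V scalar_space"
      using linear_map_compose[OF V f] L(2) by blast
    fix v assume v: "v \<in> carrier V"
      and 0: "\<forall>l\<in>(\<lambda>l. \<lambda>v\<in>carrier V. l (f v)) ` \<Lambda>. l v = 0"
    then have "\<forall>l\<in>\<Lambda>. l (f v) = 0" by simp
    then show "v = \<zero>\<^bsub>V\<^esub>" using inj[OF v] L(3)[OF linear_mapsD(1)[OF f v]] by blast
  qed (use L in simp)
qed

text \<open>The coordinates of a frame, as elements of \<open>linear_maps\<close>. The
  reconstruction formula expresses the identity of \<open>F\<close> as a finite sum of rank-one
  maps.\<close>

lemma fin_dim_coordinates:
  assumes "fin_dim_normed_space F"
  obtains I and \<epsilon> :: "'v \<Rightarrow> 'v \<Rightarrow> 'k::real_or_complex"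
  where "finite I" "I \<subseteq> carrier F" "\<And>b. b \<in> I \<Longrightarrow> \<epsilon> b \<in> linear_maps F scalar_space"
    "\<And>y. y \<in> carrier F \<Longrightarrow> (\<Oplus>\<^bsub>F\<^esub>b\<in>I. \<epsilon> b y \<odot>\<^bsub>F\<^esub> b) = y"
proof -
  interpret F: normed_kspace F "vnorm F" using fin_dimD(2)[OF assms] .
  obtain I \<epsilon> where fr: "F.frame (carrier F) I \<epsilon>"
    using F.finitely_spanned_frame[OF fin_dimD(3)[OF assms]] by blast
  show thesis
  proof (rule that[of I "\<lambda>b. restrict (\<epsilon> b) (carrier F)"])
    show "finite I" "I \<subseteq> carrier F" using fr by (auto simp: F.frame_def)
    show "restrict (\<epsilon> b) (carrier F) \<in> linear_maps F scalar_space" if "b \<in> I" for b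
      using fr that by (intro linear_mapsI) (auto simp: F.frame_def)
    fix y assume y: "y \<in> carrier F"
    then have "y = (\<Oplus>\<^bsub>F\<^esub>b\<in>I. \<epsilon> b y \<odot>\<^bsub>F\<^esub> b)" using fr unfolding F.frame_def by blast
    then show "(\<Oplus>\<^bsub>F\<^esub>b\<in>I. restrict (\<epsilon> b) (carrier F) y \<odot>\<^bsub>F\<^esub> b) = y" using y by simp
  qed
qed

lemma fin_dim_scalar_space: "fin_dim_normed_space (scalar_space :: ('k::real_or_complex, 'k) normed_space)"
proof -
  let ?K = "scalar_space :: ('k, 'k) normed_space"
  have "finitely_separated ?K"
    unfolding finitely_separated_def
    using linear_map_id[OF kspace_scalar_space] by (intro exI[of _ "{\<lambda>v\<in>carrier ?K. v}"]) auto
  then show ?thesis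
    using normed_kspace_scalar_space
    by (simp add: fin_dim_normed_space_iff normed_kspace_def normed_kspace_axioms_def
        finitely_separated_spanned[OF kspace_scalar_space])
qed

lemma fin_dim_kspaces: "\<forall>E\<in>set Es. fin_dim_normed_space E \<Longrightarrow> \<forall>E\<in>set Es. kspace E"
  using fin_dimD(1) by blast

lemma kspace_tensor_space: "kspace (tensor_space Es)"
  unfolding tensor_space_def by (rule kspace_evaluation_span)

lemma separated_tensor_space: "separated (tensor_space Es)"
  unfolding tensor_space_def by (rule separated_evaluation_span)

lemma elementary_tensor_closed: "x \<in> tuples Es \<Longrightarrow> elementary_tensor Es x \<in> carrier (tensor_space Es)"
  unfolding tensor_space_def elementary_tensor_def by (rule evaluation_in_span)

lemma elementary_tensor_apply:
  "\<phi> \<in> multilinear_forms Es \<Longrightarrow> elementary_tensor Es x \<phi> = \<phi> x"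
  by (simp add: elementary_tensor_def evaluation_def)

lemma tensor_linear_maps_eqI:
  assumes "kspace W" "f \<in> linear_maps (tensor_space Es) W" "g \<in> linear_maps (tensor_space Es) W"
    and "\<And>x. x \<in> tuples Es \<Longrightarrow> f (elementary_tensor Es x) = g (elementary_tensor Es x)"
  shows "f = g"
  using assms unfolding tensor_space_def elementary_tensor_def
  by (rule linear_maps_evaluation_span_eqI)

lemma tensor_apply_linear:
  assumes "\<phi> \<in> multilinear_forms Es"
  shows "(\<lambda>u\<in>carrier (tensor_space Es). u \<phi>) \<in> linear_maps (tensor_space Es) scalar_space"
  unfolding tensor_space_def by (rule evaluation_span_apply[OF assms])

section \<open>Multilinear maps and tensors over finite dimensional factors\<close>

context
  fixes Es :: "('k::real_or_complex, 'a) normed_space list"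
  assumes Es: "\<forall>E\<in>set Es. fin_dim_normed_space E"
begin

text \<open>The functionals are \<open>T \<mapsto> \<epsilon> b (T x)\<close>, with coordinates
  \<open>\<epsilon> b\<close> of \<open>F\<close> and \<open>x\<close> in the finite grid
  \<open>X\<close> of tuples of spanning vectors. By multilinearity \<open>T\<close> vanishes once
  it vanishes on the grid.\<close>

lemma finitely_separated_multilinear_space:
  assumes F: "fin_dim_normed_space F"
  shows "finitely_separated (multilinear_space Es F)"
proof -
  have F': "kspace F" using fin_dimD(1)[OF F] .
  then interpret F: kspace F .
  obtain I \<epsilon> where I: "finite I" "I \<subseteq> carrier F" "\<And>b. b \<in> I \<Longrightarrow> \<epsilon> b \<in> linear_maps F scalar_space"
    "\<And>y. y \<in> carrier F \<Longrightarrow> (\<Oplus>\<^bsub>F\<^esub>b\<in>I. \<epsilon> b y \<odot>\<^bsub>F\<^esub> b) = y"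
    by (rule fin_dim_coordinates[OF F]) (rule that)
  define S where "S i = (SOME B. finite B \<and> B \<subseteq> carrier (Es ! i) \<and>
      (\<forall>v\<in>carrier (Es ! i). \<exists>c. v = (\<Oplus>\<^bsub>Es ! i\<^esub>b\<in>B. c b \<odot>\<^bsub>Es ! i\<^esub> b)))" for i
  have S: "finite (S i) \<and> S i \<subseteq> carrier (Es ! i) \<and>
      (\<forall>v\<in>carrier (Es ! i). \<exists>c. v = (\<Oplus>\<^bsub>Es ! i\<^esub>b\<in>S i. c b \<odot>\<^bsub>Es ! i\<^esub> b))" if "i < length Es" for i
    unfolding S_def
    by (rule someI_ex[OF fin_dimD(3)[OF bspec[OF Es nth_mem[OF that]], unfolded finitely_spanned_def]])
  define X where "X = {x. length x = length Es \<and> (\<forall>i<length Es. x ! i \<in> S i)}"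
  have "X \<subseteq> {x. set x \<subseteq> (\<Union>i<length Es. S i) \<and> length x = length Es}"
    by (force simp: X_def in_set_conv_nth)
  then have X: "finite X"
    using S by (elim finite_subset) (intro finite_lists_length_eq finite_UN_I, auto)
  have "S i \<subseteq> carrier (Es ! i)" if "i < length Es" for i using S[OF that] by blast
  then have X_tuples: "X \<subseteq> tuples Es" by (auto simp: X_def tuples_iff subset_eq)
  define L where "L b x = (\<lambda>T\<in>multilinear_maps Es F. \<epsilon> b (T x))" for b x
  define \<Lambda> where "\<Lambda> = (\<Union>b\<in>I. L b ` X)"
  have L: "L b x \<in> \<Lambda>" if "b \<in> I" "x \<in> X" for b x using that by (auto simp: \<Lambda>_def)
  show ?thesis
    unfolding finitely_separated_def
  proof (intro exI[of _ \<Lambda>] conjI ballI impI)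
    show "finite \<Lambda>" using I(1) X by (simp add: \<Lambda>_def)
    have "L b x \<in> linear_maps (multilinear_space Es F) scalar_space" if "b \<in> I" "x \<in> X" for b x
      unfolding L_def using that X_tuples I(3)
      by (intro multilinear_eval_linear[OF fin_dim_kspaces[OF Es] F']) auto
    then show "\<Lambda> \<subseteq> linear_maps (multilinear_space Es F) scalar_space"
      by (auto simp: \<Lambda>_def)
    fix T assume "T \<in> carrier (multilinear_space Es F)" and 0: "\<forall>l\<in>\<Lambda>. l T = 0"
    then have T: "T \<in> multilinear_maps Es F" by simp
    have "T x = \<zero>\<^bsub>F\<^esub>" if x: "x \<in> X" for x
    proof -
      have Tx: "T x \<in> carrier F" using multilinear_mapsD1(1)[OF T] X_tuples x by blast
      have "\<epsilon> b (T x) = 0" if b: "b \<in> I" for b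
      proof -
        have "L b x T = 0" using 0 L[OF b x] by blast
        then show ?thesis using T by (simp add: L_def)
      qed
      then have "(\<Oplus>\<^bsub>F\<^esub>b\<in>I. \<epsilon> b (T x) \<odot>\<^bsub>F\<^esub> b) = (\<Oplus>\<^bsub>F\<^esub>b\<in>I. \<zero>\<^bsub>F\<^esub>)"
        using I(2) by (intro F.finsum_cong') auto
      then show ?thesis using I(4)[OF Tx] by simp
    qed
    then have "T x = \<zero>\<^bsub>F\<^esub>" if "x \<in> tuples Es" for x
      by (intro multilinear_zero_on_spanning[OF fin_dim_kspaces[OF Es] F' T S _ that]) (auto simp: X_def)
    then show "T = \<zero>\<^bsub>multilinear_space Es F\<^esub>"
      using multilinear_mapsD1(2)[OF T] by (auto simp: extensional_def)
  qed
qed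

lemma lin_props:
  assumes W: "separated W" and T: "T \<in> multilinear_maps Es W"
  shows "lin Es W T \<in> linear_maps (tensor_space Es) W"
    and "x \<in> tuples Es \<Longrightarrow> lin Es W T (elementary_tensor Es x) = T x"
proof -
  have "lin Es W T \<in> linear_maps (tensor_space Es) W \<and>
      (\<forall>x\<in>tuples Es. lin Es W T (elementary_tensor Es x) = T x)"
    unfolding lin_def tensor_space_def elementary_tensor_def
    using multilinear_mapsD1(1)[OF T] multilinear_compose[OF fin_dim_kspaces[OF Es] T]
    by (intro linearization_props[OF W])
  then show "lin Es W T \<in> linear_maps (tensor_space Es) W"
    and "x \<in> tuples Es \<Longrightarrow> lin Es W T (elementary_tensor Es x) = T x" by auto
qed

lemma Sigma_map_elementary:
  assumes "separated W" "T \<in> multilinear_maps Es W" "x \<in> tuples Es"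
  shows "Sigma_map Es W T (elementary_tensor Es x) = T x"
  using lin_props(2)[OF assms] assms(3) by (simp add: Sigma_map_def Sigma_set_def)

lemma lin_eqI:
  assumes W: "separated W" and T: "T \<in> multilinear_maps Es W"
    and f: "f \<in> linear_maps (tensor_space Es) W"
    and "\<And>x. x \<in> tuples Es \<Longrightarrow> f (elementary_tensor Es x) = T x"
  shows "lin Es W T = f"
proof (rule tensor_linear_maps_eqI[OF _ lin_props(1)[OF W T] f])
  show "kspace W" using W by (simp add: separated_def)
qed (simp add: lin_props(2)[OF W T] assms(4))

text \<open>A tensor is a functional on forms, and \<open>u \<mapsto> u \<phi>\<close> is linear
  with value \<open>\<phi> x\<close> at the elementary tensor of \<open>x\<close>.\<close>

lemma lin_form:
  assumes \<phi>: "\<phi> \<in> multilinear_forms Es"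
  shows "lin Es scalar_space \<phi> = (\<lambda>u\<in>carrier (tensor_space Es). u \<phi>)"
  by (rule lin_eqI[OF fin_dim_separated[OF fin_dim_scalar_space] \<phi> tensor_apply_linear[OF \<phi>]])
    (simp add: elementary_tensor_closed elementary_tensor_apply \<phi>)

text \<open>A tensor is a combination of point evaluations, each of which is linear in the
  form.\<close>

lemma tensor_is_functional:
  assumes "u \<in> carrier (tensor_space Es)"
  shows "u \<in> linear_maps (forms Es) scalar_space"
proof -
  have cl: "(\<lambda>x\<in>tuples Es. \<phi> x + \<psi> x) \<in> multilinear_forms Es" "(\<lambda>x\<in>tuples Es. a * \<phi> x) \<in> multilinear_forms Es"
    if "\<phi> \<in> multilinear_forms Es" "\<psi> \<in> multilinear_forms Es" for \<phi> \<psi> a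
    using multilinear_add[OF fin_dim_kspaces[OF Es] kspace_scalar_space that]
      multilinear_scale[OF fin_dim_kspaces[OF Es] kspace_scalar_space that(1), of a] by simp_all
  obtain B c where u: "u = (\<lambda>\<phi>\<in>multilinear_forms Es. \<Sum>x\<in>B. c x * \<phi> x)" "finite B" "B \<subseteq> tuples Es"
    using assms unfolding tensor_space_def evaluation_span_carrier by blast
  show ?thesis
  proof (rule linear_mapsI)
    fix \<phi> \<psi> assume "\<phi> \<in> carrier (forms Es)" "\<psi> \<in> carrier (forms Es)"
    then have f: "\<phi> \<in> multilinear_forms Es" "\<psi> \<in> multilinear_forms Es" by simp_all
    have "(\<Sum>x\<in>B. c x * (\<lambda>x\<in>tuples Es. \<phi> x + \<psi> x) x) = (\<Sum>x\<in>B. c x * \<phi> x + c x * \<psi> x)"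
      using u(3) by (intro sum.cong) (auto simp: algebra_simps)
    then show "u (\<phi> \<oplus>\<^bsub>forms Es\<^esub> \<psi>) = u \<phi> \<oplus>\<^bsub>scalar_space\<^esub> u \<psi>"
      using f cl(1)[OF f] by (simp add: u(1) sum.distrib)
  next
    fix a \<phi> assume "\<phi> \<in> carrier (forms Es)"
    then have f: "\<phi> \<in> multilinear_forms Es" by simp
    have "(\<Sum>x\<in>B. c x * (\<lambda>x\<in>tuples Es. a * \<phi> x) x) = (\<Sum>x\<in>B. a * (c x * \<phi> x))"
      using u(3) by (intro sum.cong) (auto simp: algebra_simps)
    then show "u (a \<odot>\<^bsub>forms Es\<^esub> \<phi>) = a \<odot>\<^bsub>scalar_space\<^esub> u \<phi>"
      using f cl(2)[OF f f] by (simp add: u(1) sum_distrib_left)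
  qed (simp_all add: u(1))
qed

text \<open>Since linearized forms act by evaluation, the embedding into the bidual leaves a tensor
  unchanged in this encoding.\<close>

lemma canonical_image_eq:
  assumes "u \<in> carrier (tensor_space Es)"
  shows "canonical_image Es u = u"
proof -
  have "u \<in> extensional (multilinear_forms Es)"
    using assms unfolding tensor_space_def by (rule evaluation_span_extensional)
  then show ?thesis
    using assms by (intro extensionalityI[of _ "multilinear_forms Es"]) (simp_all add: canonical_image_def lin_form)
qed

text \<open>As a linear functional on the space of forms, a tensor is determined by its values on a
  finite spanning set \<open>P\<close> of forms. The evaluations at \<open>P\<close> are therefore
  finitely many separating functionals.\<close>

lemma finitely_spanned_tensor_space: "finitely_spanned (tensor_space Es)"
proof (rule finitely_separated_spanned[OF kspace_tensor_space])
  have M: "kspace (forms Es)" by (rule kspace_multilinear_space[OF fin_dim_kspaces[OF Es] kspace_scalar_space])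
  have "finitely_spanned (forms Es)"
    by (rule finitely_separated_spanned[OF M finitely_separated_multilinear_space[OF fin_dim_scalar_space]])
  then obtain P where P': "finite P \<and> P \<subseteq> carrier (forms Es) \<and>
      (\<forall>\<phi>\<in>carrier (forms Es). \<exists>c. \<phi> = (\<Oplus>\<^bsub>forms Es\<^esub>\<psi>\<in>P. c \<psi> \<odot>\<^bsub>forms Es\<^esub> \<psi>))"
    unfolding finitely_spanned_def by (rule exE)
  then have P: "finite P" "P \<subseteq> multilinear_forms Es" by simp_all
  have P_span: "\<exists>c. \<phi> = (\<Oplus>\<^bsub>forms Es\<^esub>\<psi>\<in>P. c \<psi> \<odot>\<^bsub>forms Es\<^esub> \<psi>)" if "\<phi> \<in> multilinear_forms Es" for \<phi>
    using bspec[OF conjunct2[OF conjunct2[OF P']], of \<phi>] that by simp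
  interpret M: kspace "forms Es" by (rule M)
  interpret K: kspace "scalar_space :: ('k, 'k) normed_space" by (rule kspace_scalar_space)
  show "finitely_separated (tensor_space Es)"
    unfolding finitely_separated_def
  proof (intro exI[of _ "(\<lambda>\<phi>. \<lambda>u\<in>carrier (tensor_space Es). u \<phi>) ` P"] conjI ballI impI)
    show "(\<lambda>\<phi>. \<lambda>u\<in>carrier (tensor_space Es). u \<phi>) ` P \<subseteq> linear_maps (tensor_space Es) scalar_space"
      using P(2) tensor_apply_linear by blast
    fix u assume u: "u \<in> carrier (tensor_space Es)"
      and 0: "\<forall>l\<in>(\<lambda>\<phi>. \<lambda>u\<in>carrier (tensor_space Es). u \<phi>) ` P. l u = 0"
    have uP: "u \<psi> = 0" if "\<psi> \<in> P" for \<psi> using 0 that u by auto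
    have "u \<phi> = 0" if \<phi>: "\<phi> \<in> multilinear_forms Es" for \<phi>
    proof -
      obtain c where c: "\<phi> = (\<Oplus>\<^bsub>forms Es\<^esub>\<psi>\<in>P. c \<psi> \<odot>\<^bsub>forms Es\<^esub> \<psi>)" using P_span[OF \<phi>] ..
      have "u \<phi> = (\<Oplus>\<^bsub>scalar_space\<^esub>\<psi>\<in>P. u (c \<psi> \<odot>\<^bsub>forms Es\<^esub> \<psi>))"
        unfolding c using P(2) M.scale_closed
        by (intro linear_map_finsum[OF M kspace_scalar_space tensor_is_functional[OF u] P(1)])
          (auto simp del: multilinear_space_simps(4))
      also have "\<dots> = (\<Oplus>\<^bsub>scalar_space\<^esub>\<psi>\<in>P. \<zero>\<^bsub>scalar_space\<^esub>)"
        using P(2) linear_mapsD(3)[OF tensor_is_functional[OF u]] uP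
        by (intro K.finsum_cong') (auto simp del: multilinear_space_simps(4))
      also have "\<dots> = \<zero>\<^bsub>scalar_space\<^esub>" by (rule K.finsum_zero)
      finally show ?thesis by simp
    qed
    then show "u = \<zero>\<^bsub>tensor_space Es\<^esub>"
      using evaluation_span_extensional[OF u[unfolded tensor_space_def]]
      by (auto simp: tensor_space_def fun_eq_iff restrict_def extensional_def)
  qed (use P in simp)
qed

end


section \<open>The identification of tensors with multilinear operators\<close>

lemma bilinear_formsD:
  assumes "B \<in> bilinear_forms V W" "kspace V" "kspace W"
  shows "v \<in> carrier V \<Longrightarrow> v' \<in> carrier V \<Longrightarrow> w \<in> carrier W \<Longrightarrow> B (v \<oplus>\<^bsub>V\<^esub> v', w) = B (v, w) + B (v', w)"
    and "v \<in> carrier V \<Longrightarrow> w \<in> carrier W \<Longrightarrow> B (a \<odot>\<^bsub>V\<^esub> v, w) = a * B (v, w)"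
    and "v \<in> carrier V \<Longrightarrow> w \<in> carrier W \<Longrightarrow> w' \<in> carrier W \<Longrightarrow> B (v, w \<oplus>\<^bsub>W\<^esub> w') = B (v, w) + B (v, w')"
    and "v \<in> carrier V \<Longrightarrow> w \<in> carrier W \<Longrightarrow> B (v, a \<odot>\<^bsub>W\<^esub> w) = a * B (v, w)"
proof -
  interpret V: kspace V by fact
  interpret W: kspace W by fact
  have 1: "(\<lambda>v\<in>carrier V. B (v, w)) \<in> linear_maps V scalar_space" if "w \<in> carrier W" for w
    using assms(1) that by (simp add: bilinear_forms_def)
  have 2: "(\<lambda>w\<in>carrier W. B (v, w)) \<in> linear_maps W scalar_space" if "v \<in> carrier V" for v
    using assms(1) that by (simp add: bilinear_forms_def)
  show "v \<in> carrier V \<Longrightarrow> v' \<in> carrier V \<Longrightarrow> w \<in> carrier W \<Longrightarrow> B (v \<oplus>\<^bsub>V\<^esub> v', w) = B (v, w) + B (v', w)"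
    using linear_map_scalarD(1)[OF 1, of w v v'] by simp
  show "v \<in> carrier V \<Longrightarrow> w \<in> carrier W \<Longrightarrow> B (a \<odot>\<^bsub>V\<^esub> v, w) = a * B (v, w)"
    using linear_map_scalarD(2)[OF 1, of w v a] by simp
  show "v \<in> carrier V \<Longrightarrow> w \<in> carrier W \<Longrightarrow> w' \<in> carrier W \<Longrightarrow> B (v, w \<oplus>\<^bsub>W\<^esub> w') = B (v, w) + B (v, w')"
    using linear_map_scalarD(1)[OF 2, of v w w'] by simp
  show "v \<in> carrier V \<Longrightarrow> w \<in> carrier W \<Longrightarrow> B (v, a \<odot>\<^bsub>W\<^esub> w) = a * B (v, w)"
    using linear_map_scalarD(2)[OF 2, of v w a] by simp
qed

text \<open>Curried and with values in an arbitrary space, matching the argument of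
  \<open>lin2\<close>; the set \<open>bilinear_forms\<close> is uncurried and scalar-valued.\<close>

definition bilinear_map ::
    "('k::real_or_complex, 'v, 'm) module_scheme \<Rightarrow> ('k, 'w, 'n) module_scheme \<Rightarrow>
     ('k, 'z, 'p) module_scheme \<Rightarrow> ('v \<Rightarrow> 'w \<Rightarrow> 'z) \<Rightarrow> bool" where
  "bilinear_map V W Z T \<longleftrightarrow>
     (\<forall>v\<in>carrier V. \<forall>w\<in>carrier W. T v w \<in> carrier Z) \<and>
     (\<forall>v\<in>carrier V. \<forall>v'\<in>carrier V. \<forall>w\<in>carrier W. T (v \<oplus>\<^bsub>V\<^esub> v') w = T v w \<oplus>\<^bsub>Z\<^esub> T v' w) \<and>
     (\<forall>a. \<forall>v\<in>carrier V. \<forall>w\<in>carrier W. T (a \<odot>\<^bsub>V\<^esub> v) w = a \<odot>\<^bsub>Z\<^esub> T v w) \<and>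
     (\<forall>v\<in>carrier V. \<forall>w\<in>carrier W. \<forall>w'\<in>carrier W. T v (w \<oplus>\<^bsub>W\<^esub> w') = T v w \<oplus>\<^bsub>Z\<^esub> T v w') \<and>
     (\<forall>a. \<forall>v\<in>carrier V. \<forall>w\<in>carrier W. T v (a \<odot>\<^bsub>W\<^esub> w) = a \<odot>\<^bsub>Z\<^esub> T v w)"

lemma kspace_tensor2: "kspace (tensor2 V W)"
  unfolding tensor2_def by (rule kspace_evaluation_span)

lemma separated_tensor2: "separated (tensor2 V W)"
  unfolding tensor2_def by (rule separated_evaluation_span)

lemma elementary2_closed:
  "v \<in> carrier V \<Longrightarrow> w \<in> carrier W \<Longrightarrow> elementary2 V W v w \<in> carrier (tensor2 V W)"
  unfolding tensor2_def elementary2_def by (rule evaluation_in_span) simp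

lemma bilinear_map_elementary2:
  assumes "kspace V" "kspace W"
  shows "bilinear_map V W (tensor2 V W) (elementary2 V W)"
  unfolding bilinear_map_def
  by (intro conjI ballI allI elementary2_closed)
    (auto simp: tensor2_def elementary2_def evaluation_def bilinear_formsD[OF _ assms] intro!: restrict_ext)

lemma tensor2_linear_maps_eqI:
  assumes "kspace Z" "f \<in> linear_maps (tensor2 V W) Z" "g \<in> linear_maps (tensor2 V W) Z"
    and "\<And>v w. v \<in> carrier V \<Longrightarrow> w \<in> carrier W \<Longrightarrow> f (elementary2 V W v w) = g (elementary2 V W v w)"
  shows "f = g"
proof (rule linear_maps_evaluation_span_eqI[OF assms(1) assms(2,3)[unfolded tensor2_def]])
  fix x assume "x \<in> carrier V \<times> carrier W"
  then show "f (evaluation (bilinear_forms V W) x) = g (evaluation (bilinear_forms V W) x)"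
    using assms(4) unfolding elementary2_def by (cases x) blast
qed

lemma lin2_props:
  assumes V: "kspace V" and W: "kspace W" and Z: "separated Z" and T: "bilinear_map V W Z T"
  shows "lin2 V W Z T \<in> linear_maps (tensor2 V W) Z"
    and "v \<in> carrier V \<Longrightarrow> w \<in> carrier W \<Longrightarrow> lin2 V W Z T (elementary2 V W v w) = T v w"
proof -
  interpret V: kspace V by fact
  interpret W: kspace W by fact
  have forms: "(\<lambda>x\<in>carrier V \<times> carrier W. l (case x of (v, w) \<Rightarrow> T v w)) \<in> bilinear_forms V W"
    if l: "l \<in> linear_maps Z scalar_space" for l
    using T unfolding bilinear_forms_def bilinear_map_def
    by (auto intro!: linear_mapsI simp: linear_map_scalarD[OF l])
  have "lin2 V W Z T \<in> linear_maps (tensor2 V W) Z \<and>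
      (\<forall>x\<in>carrier V \<times> carrier W. lin2 V W Z T (evaluation (bilinear_forms V W) x) = (case x of (v, w) \<Rightarrow> T v w))"
    unfolding lin2_def tensor2_def
  proof (rule linearization_props[OF Z])
    show "(case x of (v, w) \<Rightarrow> T v w) \<in> carrier Z" if "x \<in> carrier V \<times> carrier W" for x
      using T that by (auto simp: bilinear_map_def)
  qed (rule forms)
  then show "lin2 V W Z T \<in> linear_maps (tensor2 V W) Z"
    and "v \<in> carrier V \<Longrightarrow> w \<in> carrier W \<Longrightarrow> lin2 V W Z T (elementary2 V W v w) = T v w"
    by (auto simp: elementary2_def)
qed

section \<open>Bijectivity of \<phi> \<otimes> y \<mapsto> \<phi> \<cdot> y\<close>

context
  fixes Es :: "('k::real_or_complex, 'a) normed_space list" and F :: "('k, 'a) normed_space"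
  assumes Es: "\<forall>E\<in>set Es. fin_dim_normed_space E" and F: "fin_dim_normed_space F"
begin

interpretation F: kspace F by (rule fin_dimD(1)[OF F])
interpretation M: kspace "forms Es" by (rule kspace_multilinear_space[OF fin_dim_kspaces[OF Es] kspace_scalar_space])
interpretation MF: kspace "multilinear_space Es F"
  by (rule kspace_multilinear_space[OF fin_dim_kspaces[OF Es] F.kspace_axioms])
interpretation D: kspace "dual_tensor_space Es F"
  unfolding dual_tensor_space_def by (rule kspace_tensor2)

lemma form_times_vector_closed:
  assumes \<phi>: "\<phi> \<in> multilinear_forms Es" and y: "y \<in> carrier F"
  shows "form_times_vector Es F \<phi> y \<in> multilinear_maps Es F"
  unfolding form_times_vector_def
  by (rule multilinear_mapsI[OF fin_dim_kspaces[OF Es]])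
    (simp_all add: y multilinear_mapsD[OF fin_dim_kspaces[OF Es] \<phi>] F.scale_left_distrib)

lemma bilinear_form_times_vector:
  "bilinear_map (forms Es) F (multilinear_space Es F) (form_times_vector Es F)"
  unfolding bilinear_map_def
  by (auto simp: form_times_vector_closed)
    (auto simp: form_times_vector_def F.scale_left_distrib F.scale_right_distrib mult.commute
      intro!: restrict_ext)

lemma identification_linear:
  "identification Es F \<in> linear_maps (dual_tensor_space Es F) (multilinear_space Es F)"
  and identification_elementary:
  "\<phi> \<in> multilinear_forms Es \<Longrightarrow> y \<in> carrier F \<Longrightarrow>
    identification Es F (elementary2 (forms Es) F \<phi> y) = form_times_vector Es F \<phi> y"
  using lin2_props[OF M.kspace_axioms F.kspace_axioms
      separated_multilinear_space[OF fin_dim_kspaces[OF Es] fin_dim_separated[OF F]] bilinear_form_times_vector]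
  unfolding identification_def dual_tensor_space_def by simp_all

text \<open>The tensor is recovered from its operator, which gives injectivity. Both sides are
  linear in \<open>u\<close>. For \<open>u = \<phi> \<otimes> y\<close> the expansion of
  \<open>y\<close> turns \<open>B (\<phi>, y)\<close> into the sum of the
  \<open>B (\<epsilon> b y \<odot> \<phi>, b)\<close>, and
  \<open>\<epsilon> b y \<odot> \<phi>\<close> is the composition of \<open>\<epsilon> b\<close>
  with \<open>\<phi> \<cdot> y\<close>.\<close>

lemma tensor_determined_by_identification:
  assumes I: "finite I" "I \<subseteq> carrier F" "\<And>b. b \<in> I \<Longrightarrow> \<epsilon> b \<in> linear_maps F scalar_space"
    "\<And>y. y \<in> carrier F \<Longrightarrow> (\<Oplus>\<^bsub>F\<^esub>b\<in>I. \<epsilon> b y \<odot>\<^bsub>F\<^esub> b) = y"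
    and B: "B \<in> bilinear_forms (forms Es) F" and u: "u \<in> carrier (dual_tensor_space Es F)"
  shows "u B = (\<Sum>b\<in>I. B (\<lambda>x\<in>tuples Es. \<epsilon> b (identification Es F u x), b))"
proof -
  let ?D = "dual_tensor_space Es F"
  define h where "h b T = (\<lambda>x\<in>tuples Es. \<epsilon> b (T x))" for b T
  note BD = bilinear_formsD[OF B M.kspace_axioms F.kspace_axioms]
  note idD = linear_mapsD(1-3)[OF identification_linear]
  have h: "h b T \<in> multilinear_forms Es" if "b \<in> I" "T \<in> multilinear_maps Es F" for b T
    unfolding h_def by (rule multilinear_compose[OF fin_dim_kspaces[OF Es] that(2) I(3)[OF that(1)]])
  have h_add: "h b (S \<oplus>\<^bsub>multilinear_space Es F\<^esub> T) = h b S \<oplus>\<^bsub>forms Es\<^esub> h b T"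
    if "b \<in> I" "S \<in> multilinear_maps Es F" "T \<in> multilinear_maps Es F" for b S T
    using multilinear_mapsD1(1)[OF that(2)] multilinear_mapsD1(1)[OF that(3)]
    by (auto simp: h_def linear_map_scalarD[OF I(3)[OF that(1)]] intro!: restrict_ext)
  have h_scale: "h b (a \<odot>\<^bsub>multilinear_space Es F\<^esub> T) = a \<odot>\<^bsub>forms Es\<^esub> h b T"
    if "b \<in> I" "T \<in> multilinear_maps Es F" for b a T
    using multilinear_mapsD1(1)[OF that(2)]
    by (auto simp: h_def linear_map_scalarD[OF I(3)[OF that(1)]] intro!: restrict_ext)
  define f where "f = (\<lambda>u\<in>carrier ?D. \<Sum>b\<in>I. B (h b (identification Es F u), b))"
  have "f \<in> linear_maps ?D scalar_space"
  proof (rule linear_mapsI)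
    fix u v assume uv: "u \<in> carrier ?D" "v \<in> carrier ?D"
    have "B (h b (identification Es F (u \<oplus>\<^bsub>?D\<^esub> v)), b)
        = B (h b (identification Es F u), b) + B (h b (identification Es F v), b)" if b: "b \<in> I" for b
      unfolding idD(2)[OF uv]
      using idD(1)[OF uv(1)] idD(1)[OF uv(2)] b I(2) h[OF b]
      by (simp add: h_add BD(1) subset_eq del: multilinear_space_simps(3))
    then show "f (u \<oplus>\<^bsub>?D\<^esub> v) = f u \<oplus>\<^bsub>scalar_space\<^esub> f v"
      using uv by (simp add: f_def sum.distrib)
  next
    fix a u assume u: "u \<in> carrier ?D"
    have "B (h b (identification Es F (a \<odot>\<^bsub>?D\<^esub> u)), b) = a * B (h b (identification Es F u), b)"
      if b: "b \<in> I" for b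
      unfolding idD(3)[OF u]
      using idD(1)[OF u] b I(2) h[OF b]
      by (simp add: h_scale BD(2) subset_eq del: multilinear_space_simps(4))
    then show "f (a \<odot>\<^bsub>?D\<^esub> u) = a \<odot>\<^bsub>scalar_space\<^esub> f u"
      using u by (simp add: f_def sum_distrib_left)
  qed (simp_all add: f_def)
  moreover have "(\<lambda>u\<in>carrier ?D. u B) \<in> linear_maps ?D scalar_space"
    unfolding dual_tensor_space_def tensor2_def by (rule evaluation_span_apply[OF B])
  moreover have "(\<lambda>u\<in>carrier ?D. u B) (elementary2 (forms Es) F \<phi> y) = f (elementary2 (forms Es) F \<phi> y)"
    if \<phi>: "\<phi> \<in> carrier (forms Es)" and y: "y \<in> carrier F" for \<phi> y
  proof -
    have e: "elementary2 (forms Es) F \<phi> y \<in> carrier ?D"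
      unfolding dual_tensor_space_def by (rule elementary2_closed[OF \<phi> y])
    have "B (h b (form_times_vector Es F \<phi> y), b) = B (\<phi>, \<epsilon> b y \<odot>\<^bsub>F\<^esub> b)" if b: "b \<in> I" for b
    proof -
      have bc: "b \<in> carrier F" using b I(2) by blast
      have "h b (form_times_vector Es F \<phi> y) = \<epsilon> b y \<odot>\<^bsub>forms Es\<^esub> \<phi>"
        using y by (auto simp: h_def form_times_vector_def linear_map_scalarD[OF I(3)[OF b]] mult.commute
            intro!: restrict_ext)
      then show ?thesis using BD(2)[OF \<phi> bc] BD(4)[OF \<phi> bc] by simp
    qed
    then have "f (elementary2 (forms Es) F \<phi> y) = (\<Sum>b\<in>I. B (\<phi>, \<epsilon> b y \<odot>\<^bsub>F\<^esub> b))"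
      using e \<phi> y by (simp add: f_def identification_elementary)
    also have "\<dots> = B (\<phi>, (\<Oplus>\<^bsub>F\<^esub>b\<in>I. \<epsilon> b y \<odot>\<^bsub>F\<^esub> b))"
      using I(1,2)
    proof (induction I)
      case empty
      show ?case using BD(4)[OF \<phi> F.zero_closed, of 0] by simp
    next
      case (insert b I)
      have "(\<lambda>b. \<epsilon> b y \<odot>\<^bsub>F\<^esub> b) \<in> I \<rightarrow> carrier F" using insert.prems by auto
      then show ?case using insert \<phi> by (simp add: BD(3))
    qed
    also have "\<dots> = (\<lambda>u\<in>carrier ?D. u B) (elementary2 (forms Es) F \<phi> y)"
      using I(4)[OF y] e B by (simp add: elementary2_def evaluation_def)
    finally show ?thesis by simp
  qed
  ultimately have "(\<lambda>u\<in>carrier ?D. u B) = f"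
    unfolding dual_tensor_space_def by (intro tensor2_linear_maps_eqI[OF kspace_scalar_space])
  then have "(\<lambda>u\<in>carrier ?D. u B) u = f u" by simp
  then show ?thesis using u by (simp add: f_def h_def)
qed

lemma identification_kernel:
  assumes u: "u \<in> carrier (dual_tensor_space Es F)" and 0: "identification Es F u = \<zero>\<^bsub>multilinear_space Es F\<^esub>"
  shows "u = \<zero>\<^bsub>dual_tensor_space Es F\<^esub>"
proof -
  obtain I \<epsilon> where I: "finite I" "I \<subseteq> carrier F" "\<And>b. b \<in> I \<Longrightarrow> \<epsilon> b \<in> linear_maps F scalar_space"
    "\<And>y. y \<in> carrier F \<Longrightarrow> (\<Oplus>\<^bsub>F\<^esub>b\<in>I. \<epsilon> b y \<odot>\<^bsub>F\<^esub> b) = y"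
    by (rule fin_dim_coordinates[OF F]) (rule that)
  have "u B = 0" if B: "B \<in> bilinear_forms (forms Es) F" for B
  proof -
    have "B (\<lambda>x\<in>tuples Es. \<epsilon> b (identification Es F u x), b) = 0" if b: "b \<in> I" for b
    proof -
      \<comment> \<open>Written as a zero multiple so that homogeneity of \<open>B\<close> in its
        first argument gives the value 0.\<close>
      have "(\<lambda>x\<in>tuples Es. \<epsilon> b (identification Es F u x)) = 0 \<odot>\<^bsub>forms Es\<^esub> \<zero>\<^bsub>forms Es\<^esub>"
        using linear_map_zero[OF F.kspace_axioms kspace_scalar_space I(3)[OF b]]
        by (auto simp: 0 intro!: restrict_ext)
      then show ?thesis
        using bilinear_formsD(2)[OF B M.kspace_axioms F.kspace_axioms M.zero_closed, of b 0] b I(2)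
        by (simp add: subset_eq del: multilinear_space_simps)
    qed
    then show ?thesis using tensor_determined_by_identification[OF I B u] by simp
  qed
  then show ?thesis
    using evaluation_span_extensional[OF u[unfolded dual_tensor_space_def tensor2_def]]
    by (auto simp: dual_tensor_space_def tensor2_def fun_eq_iff restrict_def extensional_def)
qed

lemma identification_surj:
  assumes T: "T \<in> multilinear_maps Es F"
  shows "\<exists>u\<in>carrier (dual_tensor_space Es F). identification Es F u = T"
proof -
  let ?D = "dual_tensor_space Es F" and ?MF = "multilinear_space Es F"
  obtain I \<epsilon> where I: "finite I" "I \<subseteq> carrier F" "\<And>b. b \<in> I \<Longrightarrow> \<epsilon> b \<in> linear_maps F scalar_space"
    "\<And>y. y \<in> carrier F \<Longrightarrow> (\<Oplus>\<^bsub>F\<^esub>b\<in>I. \<epsilon> b y \<odot>\<^bsub>F\<^esub> b) = y"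
    by (rule fin_dim_coordinates[OF F]) (rule that)
  define h where "h b = (\<lambda>x\<in>tuples Es. \<epsilon> b (T x))" for b
  have h: "h b \<in> multilinear_forms Es" if "b \<in> I" for b
    unfolding h_def by (rule multilinear_compose[OF fin_dim_kspaces[OF Es] T I(3)[OF that]])
  have e: "elementary2 (forms Es) F (h b) b \<in> carrier ?D" if "b \<in> I" for b
    unfolding dual_tensor_space_def using h[OF that] I(2) that by (intro elementary2_closed) auto
  define u where "u = (\<Oplus>\<^bsub>?D\<^esub>b\<in>I. elementary2 (forms Es) F (h b) b)"
  have u: "u \<in> carrier ?D" unfolding u_def using e by (intro D.finsum_closed) auto
  have "identification Es F u = (\<Oplus>\<^bsub>?MF\<^esub>b\<in>I. identification Es F (elementary2 (forms Es) F (h b) b))"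
    unfolding u_def
    by (rule linear_map_finsum[OF D.kspace_axioms MF.kspace_axioms identification_linear I(1) e])
  also have "\<dots> = (\<Oplus>\<^bsub>?MF\<^esub>b\<in>I. form_times_vector Es F (h b) b)"
    using h I(2) by (intro MF.finsum_cong') (auto simp: identification_elementary form_times_vector_closed)
  finally have id_u: "identification Es F u = (\<Oplus>\<^bsub>?MF\<^esub>b\<in>I. form_times_vector Es F (h b) b)" .
  have "identification Es F u x = T x" if x: "x \<in> tuples Es" for x
  proof -
    note ev = multilinear_eval_linear[OF fin_dim_kspaces[OF Es] F.kspace_axioms x linear_map_id[OF F.kspace_axioms]]
    have fc: "form_times_vector Es F (h b) b \<in> multilinear_maps Es F" if "b \<in> I" for b
      using form_times_vector_closed[OF h[OF that]] I(2) that by blast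
    have cl: "(\<Oplus>\<^bsub>?MF\<^esub>b\<in>I. form_times_vector Es F (h b) b) \<in> multilinear_maps Es F"
      using linear_mapsD(1)[OF identification_linear u] unfolding id_u by simp
    \<comment> \<open>Evaluation at \<open>x\<close> is linear and carries the sum from the space of
      operators into \<open>F\<close>.\<close>
    have "(\<lambda>T\<in>multilinear_maps Es F. (\<lambda>v\<in>carrier F. v) (T x)) (\<Oplus>\<^bsub>?MF\<^esub>b\<in>I. form_times_vector Es F (h b) b)
        = (\<Oplus>\<^bsub>F\<^esub>b\<in>I. (\<lambda>T\<in>multilinear_maps Es F. (\<lambda>v\<in>carrier F. v) (T x)) (form_times_vector Es F (h b) b))"
      using fc x by (intro linear_map_finsum[OF MF.kspace_axioms F.kspace_axioms ev I(1)]) simp_all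
    then have "identification Es F u x = (\<Oplus>\<^bsub>F\<^esub>b\<in>I. (\<lambda>T\<in>multilinear_maps Es F. (\<lambda>v\<in>carrier F. v) (T x))
        (form_times_vector Es F (h b) b))"
      using cl multilinear_mapsD1(1)[OF cl x] by (simp add: id_u)
    also have "\<dots> = (\<Oplus>\<^bsub>F\<^esub>b\<in>I. \<epsilon> b (T x) \<odot>\<^bsub>F\<^esub> b)"
      using fc I(2) x multilinear_mapsD1(1)[OF fc x]
      by (intro F.finsum_cong') (auto simp: form_times_vector_def h_def)
    also have "\<dots> = T x" by (rule I(4)[OF multilinear_mapsD1(1)[OF T x]])
    finally show ?thesis .
  qed
  moreover have "identification Es F u \<in> multilinear_maps Es F"
    using linear_mapsD(1)[OF identification_linear u] by simp
  ultimately have "identification Es F u = T"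
    using multilinear_mapsD1(2)[OF T] multilinear_mapsD1(2) by (intro extensionalityI)
  then show ?thesis using u by blast
qed

lemma identification_bij:
  "bij_betw (identification Es F) (carrier (dual_tensor_space Es F)) (multilinear_maps Es F)"
proof (rule bij_betw_imageI)
  show "inj_on (identification Es F) (carrier (dual_tensor_space Es F))"
  proof (rule inj_onI)
    fix u v assume uv: "u \<in> carrier (dual_tensor_space Es F)" "v \<in> carrier (dual_tensor_space Es F)"
      and eq: "identification Es F u = identification Es F v"
    have iu: "identification Es F v \<in> carrier (multilinear_space Es F)"
      by (rule linear_mapsD(1)[OF identification_linear uv(2)])
    have "identification Es F (u \<ominus>\<^bsub>dual_tensor_space Es F\<^esub> v) = \<zero>\<^bsub>multilinear_space Es F\<^esub>"
      unfolding linear_map_minus[OF D.kspace_axioms MF.kspace_axioms identification_linear uv] eq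
      unfolding MF.minus_eq_scale[OF iu iu] by (rule MF.add_cancel[OF iu])
    then have "u \<ominus>\<^bsub>dual_tensor_space Es F\<^esub> v = \<zero>\<^bsub>dual_tensor_space Es F\<^esub>"
      by (rule identification_kernel[OF D.minus_closed[OF uv]])
    then show "u = v" by (rule D.eqI_minus[OF uv])
  qed
  show "identification Es F ` carrier (dual_tensor_space Es F) = multilinear_maps Es F"
    using identification_surj linear_mapsD(1)[OF identification_linear] by auto
qed

text \<open>Finitely many functionals separate the operators, and the injective identification pulls
  them back.\<close>

lemma finitely_spanned_dual_tensor_space: "finitely_spanned (dual_tensor_space Es F)"
  using finitely_separated_pullback[OF D.kspace_axioms identification_linear identification_kernel
      finitely_separated_multilinear_space[OF Es F]]
  by (rule finitely_separated_spanned[OF D.kspace_axioms])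

end

section \<open>The dual of a tensor product\<close>

lemma forms_space_simps [simp]:
  "carrier (forms_space Es \<beta>) = multilinear_forms Es"
  "zero (forms_space Es \<beta>) = zero (forms Es)"
  "add (forms_space Es \<beta>) = add (forms Es)"
  "smult (forms_space Es \<beta>) = smult (forms Es)"
  "vnorm (forms_space Es \<beta>) \<phi> = op_norm (normed_tensor Es \<beta>) scalar_space (lin Es scalar_space \<phi>)"
  by (simp_all add: forms_space_def)

lemma linear_maps_forms_space [simp]:
  "linear_maps (forms_space Es \<beta>) W = linear_maps (forms Es) W"
  "linear_maps V (forms_space Es \<beta>) = linear_maps V (forms Es)"
  by (simp_all add: forms_space_def)

section \<open>Dual norms of forms, and Lipschitz constants on \<Sigma>\<close>

context
  fixes Es :: "('k::real_or_complex, 'a) normed_space list" and \<beta> :: "('k, 'a) tensor \<Rightarrow> real"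
  assumes Es: "\<forall>E\<in>set Es. fin_dim_normed_space E" and \<beta>: "is_norm (tensor_space Es) \<beta>"
begin

lemma fin_dim_normed_tensor: "fin_dim_normed_space (normed_tensor Es \<beta>)"
  by (simp add: fin_dim_with_norm kspace_tensor_space finitely_spanned_tensor_space[OF Es] \<beta>)

interpretation U: normed_kspace "tensor_space Es" \<beta>
  by (simp add: normed_kspace_def normed_kspace_axioms_def kspace_tensor_space \<beta>)

interpretation M: kspace "forms Es"
  by (rule kspace_multilinear_space[OF fin_dim_kspaces[OF Es] kspace_scalar_space])

lemma lin_form_linear_bounded:
  assumes \<phi>: "\<phi> \<in> multilinear_forms Es"
  shows "lin Es scalar_space \<phi> \<in> linear_maps (normed_tensor Es \<beta>) scalar_space"
    and "bounded_map (normed_tensor Es \<beta>) scalar_space (lin Es scalar_space \<phi>)"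
proof -
  show l: "lin Es scalar_space \<phi> \<in> linear_maps (normed_tensor Es \<beta>) scalar_space"
    using lin_props(1)[OF Es fin_dim_separated[OF fin_dim_scalar_space] \<phi>] by simp
  show "bounded_map (normed_tensor Es \<beta>) scalar_space (lin Es scalar_space \<phi>)"
    by (rule fin_dim_linear_bounded[OF fin_dim_normed_tensor fin_dimD(2)[OF fin_dim_scalar_space] l])
qed

lemma form_norm_bound:
  assumes \<phi>: "\<phi> \<in> multilinear_forms Es" and u: "u \<in> carrier (tensor_space Es)"
  shows "norm (u \<phi>) \<le> vnorm (forms_space Es \<beta>) \<phi> * \<beta> u"
  using op_norm_bound[OF fin_dimD(2)[OF fin_dim_normed_tensor] fin_dimD(2)[OF fin_dim_scalar_space]
      lin_form_linear_bounded[OF \<phi>], of u] u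
  by (simp add: lin_form[OF Es \<phi>])

lemma form_norm_nonneg:
  assumes \<phi>: "\<phi> \<in> multilinear_forms Es"
  shows "0 \<le> vnorm (forms_space Es \<beta>) \<phi>"
  using op_norm_nonneg[OF fin_dimD(2)[OF fin_dim_normed_tensor] fin_dimD(2)[OF fin_dim_scalar_space]
      lin_form_linear_bounded[OF \<phi>]]
  by simp

lemma form_norm_le:
  assumes \<phi>: "\<phi> \<in> multilinear_forms Es" and "0 \<le> C"
    and "\<And>u. u \<in> carrier (tensor_space Es) \<Longrightarrow> norm (u \<phi>) \<le> C * \<beta> u"
  shows "vnorm (forms_space Es \<beta>) \<phi> \<le> C"
  unfolding forms_space_simps
  by (rule op_norm_le[OF fin_dimD(2)[OF fin_dim_normed_tensor] fin_dimD(2)[OF fin_dim_scalar_space]])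
    (simp_all add: assms lin_form[OF Es \<phi>])

text \<open>The norm of a form is the smallest nonnegative \<open>C\<close> with
  \<open>norm (u \<phi>) \<le> C * \<beta> u\<close> for all tensors \<open>u\<close>. The norm
  axioms follow because every tensor is additive and homogeneous in the form.\<close>

lemma fin_dim_forms_space: "fin_dim_normed_space (forms_space Es \<beta>)"
proof -
  let ?n = "vnorm (forms_space Es \<beta>)"
  have func: "u (\<phi> \<oplus>\<^bsub>forms Es\<^esub> \<psi>) = u \<phi> + u \<psi>" "u (a \<odot>\<^bsub>forms Es\<^esub> \<phi>) = a * u \<phi>"
    if "u \<in> carrier (tensor_space Es)" "\<phi> \<in> multilinear_forms Es" "\<psi> \<in> multilinear_forms Es" for u \<phi> \<psi> a
    using linear_map_scalarD[OF tensor_is_functional[OF Es that(1)]] that(2,3) by simp_all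
  have cl: "\<phi> \<oplus>\<^bsub>forms Es\<^esub> \<psi> \<in> multilinear_forms Es" "a \<odot>\<^bsub>forms Es\<^esub> \<phi> \<in> multilinear_forms Es"
    if "\<phi> \<in> multilinear_forms Es" "\<psi> \<in> multilinear_forms Es" for \<phi> \<psi> a
    using M.a_closed[of \<phi> \<psi>] M.scale_closed[of \<phi> a] that unfolding multilinear_space_simps(1) by blast+
  have scale_le: "?n (a \<odot>\<^bsub>forms Es\<^esub> \<phi>) \<le> norm a * ?n \<phi>" if \<phi>: "\<phi> \<in> multilinear_forms Es" for a \<phi>
  proof (rule form_norm_le[OF cl(2)[OF \<phi> \<phi>]])
    fix u assume u: "u \<in> carrier (tensor_space Es)"
    have "norm a * norm (u \<phi>) \<le> norm a * (?n \<phi> * \<beta> u)"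
      by (rule mult_left_mono[OF form_norm_bound[OF \<phi> u]]) simp
    then show "norm (u (a \<odot>\<^bsub>forms Es\<^esub> \<phi>)) \<le> norm a * ?n \<phi> * \<beta> u"
      unfolding func(2)[OF u \<phi> \<phi>] norm_mult by (simp only: mult.assoc)
  qed (use form_norm_nonneg[OF \<phi>] in \<open>simp del: forms_space_simps\<close>)
  have "is_norm (forms Es) ?n"
    unfolding is_norm_def
  proof (intro conjI ballI allI)
    fix \<phi> assume "\<phi> \<in> carrier (forms Es)"
    then have \<phi>: "\<phi> \<in> multilinear_forms Es" by simp
    show "0 \<le> ?n \<phi>" by (rule form_norm_nonneg[OF \<phi>])
    show "?n \<phi> = 0 \<longleftrightarrow> \<phi> = \<zero>\<^bsub>forms Es\<^esub>"
    proof
      assume 0: "?n \<phi> = 0"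
      \<comment> \<open>A form of norm 0 vanishes at every elementary tensor, that is, on every
        tuple.\<close>
      have "\<phi> x = 0" if x: "x \<in> tuples Es" for x
        using form_norm_bound[OF \<phi> elementary_tensor_closed[OF x]]
        unfolding 0 elementary_tensor_apply[OF \<phi>] by simp
      then show "\<phi> = \<zero>\<^bsub>forms Es\<^esub>"
        using multilinear_mapsD1(2)[OF \<phi>] by (auto simp: extensional_def)
    next
      assume "\<phi> = \<zero>\<^bsub>forms Es\<^esub>"
      then have "\<phi> = 0 \<odot>\<^bsub>forms Es\<^esub> \<phi>" by (simp only: M.scale_zero_right)
      then have "?n \<phi> \<le> norm (0 :: 'k) * ?n \<phi>" using scale_le[OF \<phi>, of 0] by metis
      then show "?n \<phi> = 0" using form_norm_nonneg[OF \<phi>] unfolding norm_zero by linarith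
    qed
    show "?n (a \<odot>\<^bsub>forms Es\<^esub> \<phi>) = norm a * ?n \<phi>" for a
    proof (cases "a = 0")
      case True
      then show ?thesis
        using scale_le[OF \<phi>, of 0] form_norm_nonneg[OF cl(2)[OF \<phi> \<phi>, of 0]]
        unfolding True norm_zero by linarith
    next
      case False
      \<comment> \<open>The reverse of the inequality \<open>scale_le\<close> for \<open>a\<close>
        is obtained from the same inequality for the inverse of \<open>a\<close>.\<close>
      have "\<phi> = inverse a \<odot>\<^bsub>forms Es\<^esub> (a \<odot>\<^bsub>forms Es\<^esub> \<phi>)"
        using \<open>\<phi> \<in> carrier (forms Es)\<close> False M.scale_scale[of \<phi> "inverse a" a] M.scale_one[of \<phi>]
        by (simp del: multilinear_space_simps)
      then have "?n \<phi> \<le> norm (inverse a) * ?n (a \<odot>\<^bsub>forms Es\<^esub> \<phi>)"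
        using scale_le[OF cl(2)[OF \<phi> \<phi>, of a], of "inverse a"] by metis
      then have "norm a * ?n \<phi> \<le> norm a * (norm (inverse a) * ?n (a \<odot>\<^bsub>forms Es\<^esub> \<phi>))"
        by (rule mult_left_mono) simp
      also have "\<dots> = ?n (a \<odot>\<^bsub>forms Es\<^esub> \<phi>)"
        using False by (simp add: norm_inverse del: forms_space_simps multilinear_space_simps)
      finally show ?thesis using scale_le[OF \<phi>, of a] by linarith
    qed
  next
    fix \<phi> \<psi> assume "\<phi> \<in> carrier (forms Es)" "\<psi> \<in> carrier (forms Es)"
    then have f: "\<phi> \<in> multilinear_forms Es" "\<psi> \<in> multilinear_forms Es" by simp_all
    show "?n (\<phi> \<oplus>\<^bsub>forms Es\<^esub> \<psi>) \<le> ?n \<phi> + ?n \<psi>"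
    proof (rule form_norm_le[OF cl(1)[OF f]])
      show "0 \<le> ?n \<phi> + ?n \<psi>" using form_norm_nonneg[OF f(1)] form_norm_nonneg[OF f(2)] by linarith
      fix u assume u: "u \<in> carrier (tensor_space Es)"
      have "norm (u (\<phi> \<oplus>\<^bsub>forms Es\<^esub> \<psi>)) \<le> norm (u \<phi>) + norm (u \<psi>)"
        unfolding func(1)[OF u f] by (rule norm_triangle_ineq)
      also have "\<dots> \<le> (?n \<phi> + ?n \<psi>) * \<beta> u"
        using form_norm_bound[OF f(1) u] form_norm_bound[OF f(2) u] unfolding distrib_right by linarith
      finally show "norm (u (\<phi> \<oplus>\<^bsub>forms Es\<^esub> \<psi>)) \<le> (?n \<phi> + ?n \<psi>) * \<beta> u" .
    qed
  qed
  moreover have "finitely_spanned (forms Es)"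
    by (rule finitely_separated_spanned[OF M.kspace_axioms
          finitely_separated_multilinear_space[OF Es fin_dim_scalar_space]])
  ultimately show ?thesis
    unfolding forms_space_def fin_dim_with_norm by (simp add: M.kspace_axioms forms_space_def)
qed

lemma elementary_tensor_multilinear:
  "(\<lambda>x\<in>tuples Es. elementary_tensor Es x) \<in> multilinear_maps Es (tensor_space Es)"
proof (rule multilinear_mapsI[OF fin_dim_kspaces[OF Es]])
  show "(\<lambda>x\<in>tuples Es. elementary_tensor Es x) x \<in> carrier (tensor_space Es)" if "x \<in> tuples Es" for x
    using that elementary_tensor_closed by simp
qed (auto simp: elementary_tensor_def evaluation_def tensor_space_def
    multilinear_mapsD[OF fin_dim_kspaces[OF Es]] intro!: restrict_ext)

text \<open>Forms norm the tensors: the Hahn--Banach theorem gives a functional \<open>l\<close>,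
  bounded by \<open>\<beta>\<close>, with \<open>norm (l u) = \<beta> u\<close>. It is the
  linearization of the form obtained by composing it with the elementary tensors, and this form has
  norm at most 1.\<close>

lemma tensor_norm_le:
  assumes u: "u \<in> carrier (tensor_space Es)" and C: "0 \<le> C"
    and bound: "\<And>\<phi>. \<phi> \<in> multilinear_forms Es \<Longrightarrow> norm (u \<phi>) \<le> C * vnorm (forms_space Es \<beta>) \<phi>"
  shows "\<beta> u \<le> C"
proof -
  obtain l where l: "l \<in> linear_maps (tensor_space Es) scalar_space"
    and l_le: "\<And>v. v \<in> carrier (tensor_space Es) \<Longrightarrow> norm (l v) \<le> \<beta> v" and lu: "norm (l u) = \<beta> u"
    using fin_dim_norming_functional[OF fin_dim_normed_tensor, of u] u by auto
  define \<phi> where "\<phi> = (\<lambda>x\<in>tuples Es. l (elementary_tensor Es x))"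
  have "(\<lambda>x\<in>tuples Es. l ((\<lambda>x\<in>tuples Es. elementary_tensor Es x) x)) \<in> multilinear_forms Es"
    by (rule multilinear_compose[OF fin_dim_kspaces[OF Es] elementary_tensor_multilinear l])
  then have \<phi>: "\<phi> \<in> multilinear_forms Es" by (simp add: \<phi>_def cong: restrict_cong)
  have "lin Es scalar_space \<phi> = l"
    by (rule lin_eqI[OF Es fin_dim_separated[OF fin_dim_scalar_space] \<phi> l]) (simp add: \<phi>_def)
  then have l_eq: "l v = v \<phi>" if "v \<in> carrier (tensor_space Es)" for v
    using that lin_form[OF Es \<phi>] by auto
  have "vnorm (forms_space Es \<beta>) \<phi> \<le> 1"
    by (rule form_norm_le[OF \<phi>]) (use l_le l_eq in auto)
  then have "C * vnorm (forms_space Es \<beta>) \<phi> \<le> C * 1"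
    using C by (rule mult_left_mono)
  then show ?thesis using bound[OF \<phi>] lu l_eq[OF u] by simp
qed

lemma Lip_le:
  assumes F: "fin_dim_normed_space F" and T: "T \<in> multilinear_maps Es F" and C: "0 \<le> C"
    and le: "\<And>x z. x \<in> tuples Es \<Longrightarrow> z \<in> tuples Es \<Longrightarrow>
      vnorm F (T x \<ominus>\<^bsub>F\<^esub> T z) \<le> C * \<beta> (elementary_tensor Es x \<ominus>\<^bsub>tensor_space Es\<^esub> elementary_tensor Es z)"
  shows "Lip Es \<beta> F (Sigma_map Es F T) \<le> C"
  unfolding Lip_def
proof (rule cInf_lower)
  show "C \<in> {C. 0 \<le> C \<and> (\<forall>p\<in>Sigma_set Es. \<forall>q\<in>Sigma_set Es.
      vnorm F (Sigma_map Es F T p \<ominus>\<^bsub>F\<^esub> Sigma_map Es F T q) \<le> C * \<beta> (p \<ominus>\<^bsub>tensor_space Es\<^esub> q))}"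
    using C le by (auto simp: Sigma_set_def Sigma_map_elementary[OF Es fin_dim_separated[OF F] T])
qed (auto intro: bdd_belowI[of _ 0])

text \<open>The infimum in \<open>Lip\<close> is itself an admissible constant. This needs the set
  of constants to be nonempty; the operator norm of the linearization belongs to it, since the
  difference of the values at two points is the linearization at their difference.\<close>

lemma Lip_bound:
  assumes F: "fin_dim_normed_space F" and T: "T \<in> multilinear_maps Es F"
    and x: "x \<in> tuples Es" and z: "z \<in> tuples Es"
  shows "vnorm F (T x \<ominus>\<^bsub>F\<^esub> T z)
    \<le> Lip Es \<beta> F (Sigma_map Es F T) * \<beta> (elementary_tensor Es x \<ominus>\<^bsub>tensor_space Es\<^esub> elementary_tensor Es z)"
proof -
  interpret F: normed_kspace F "vnorm F" by (rule fin_dimD(2)[OF F])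
  let ?e = "elementary_tensor Es"
  let ?f = "Sigma_map Es F T"
  let ?L = "lin Es F T"
  let ?b = "\<beta> (?e x \<ominus>\<^bsub>tensor_space Es\<^esub> ?e z)"
  define S where "S = {C. 0 \<le> C \<and> (\<forall>p\<in>Sigma_set Es. \<forall>q\<in>Sigma_set Es.
      vnorm F (?f p \<ominus>\<^bsub>F\<^esub> ?f q) \<le> C * \<beta> (p \<ominus>\<^bsub>tensor_space Es\<^esub> q))}"
  note e = elementary_tensor_closed
  note L = lin_props[OF Es fin_dim_separated[OF F] T]
  note feq = Sigma_map_elementary[OF Es fin_dim_separated[OF F] T]
  have L': "?L \<in> linear_maps (normed_tensor Es \<beta>) F" using L(1) by simp
  note bdd = fin_dim_linear_bounded[OF fin_dim_normed_tensor F.normed_kspace_axioms L']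
  have "op_norm (normed_tensor Es \<beta>) F ?L \<in> S"
  proof -
    have "vnorm F (?f (?e x) \<ominus>\<^bsub>F\<^esub> ?f (?e z))
        \<le> op_norm (normed_tensor Es \<beta>) F ?L * \<beta> (?e x \<ominus>\<^bsub>tensor_space Es\<^esub> ?e z)"
      if "x \<in> tuples Es" "z \<in> tuples Es" for x z
    proof -
      have "?f (?e x) \<ominus>\<^bsub>F\<^esub> ?f (?e z) = ?L (?e x \<ominus>\<^bsub>tensor_space Es\<^esub> ?e z)"
        unfolding linear_map_minus[OF kspace_tensor_space F.kspace_axioms L(1) e[OF that(1)] e[OF that(2)]]
        using that by (simp add: feq L(2))
      then show ?thesis
        using op_norm_bound[OF fin_dimD(2)[OF fin_dim_normed_tensor] F.normed_kspace_axioms L' bdd,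
            of "?e x \<ominus>\<^bsub>tensor_space Es\<^esub> ?e z"] U.minus_closed[OF e[OF that(1)] e[OF that(2)]]
        by simp
    qed
    then show ?thesis
      using op_norm_nonneg[OF fin_dimD(2)[OF fin_dim_normed_tensor] F.normed_kspace_axioms L' bdd]
      unfolding S_def Sigma_set_def by blast
  qed
  then have ne: "S \<noteq> {}" by blast
  have S: "vnorm F (T x \<ominus>\<^bsub>F\<^esub> T z) \<le> C * ?b" if "C \<in> S" for C
  proof -
    have "vnorm F (?f (?e x) \<ominus>\<^bsub>F\<^esub> ?f (?e z)) \<le> C * ?b"
      using that x z unfolding S_def Sigma_set_def by blast
    then show ?thesis using x z by (simp add: feq)
  qed
  have b: "0 \<le> ?b" by (rule U.N_nonneg[OF U.minus_closed[OF e[OF x] e[OF z]]])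
  \<comment> \<open>Dividing by the distance turns the claim into a lower bound for all constants.
    At distance 0 any single admissible constant already gives the claim.\<close>
  have "vnorm F (T x \<ominus>\<^bsub>F\<^esub> T z) \<le> Inf S * ?b"
  proof (cases "?b = 0")
    case True
    then show ?thesis using S ne by force
  next
    case False
    then have pos: "0 < ?b" using b by linarith
    have "vnorm F (T x \<ominus>\<^bsub>F\<^esub> T z) / ?b \<le> Inf S"
      using S pos by (intro cInf_greatest[OF ne]) (simp add: divide_le_eq)
    then show ?thesis using pos by (simp add: divide_le_eq)
  qed
  then show ?thesis by (simp add: Lip_def S_def)
qed

end


section \<open>$\Sigma$-operators and operators preserving $\Sigma$\<close>

text \<open>
  A multilinear map \<open>R\<close> into the tensor product and a linear map \<open>f\<close> between the spaces of forms
  are dual to each other if \<open>R m \<phi> = f \<phi> m\<close>: both are the curried forms of one pairing.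
\<close>

context
  fixes Es Ms :: "('k::real_or_complex, 'a) normed_space list"
    and \<beta> \<theta> :: "('k, 'a) tensor \<Rightarrow> real" and R f
  assumes Es: "\<forall>E\<in>set Es. fin_dim_normed_space E" and \<beta>: "is_norm (tensor_space Es) \<beta>"
    and Ms: "\<forall>E\<in>set Ms. fin_dim_normed_space E" and \<theta>: "is_norm (tensor_space Ms) \<theta>"
    and R: "R \<in> multilinear_maps Ms (tensor_space Es)"
    and f: "f \<in> linear_maps (forms Es) (forms Ms)"
    and dual: "\<forall>m\<in>tuples Ms. \<forall>\<phi>\<in>multilinear_forms Es. R m \<phi> = f \<phi> m"
begin

text \<open>The duality relation extends linearly from elementary tensors: the linearization of
  \<open>R\<close> and the operator \<open>f\<close> are adjoint to each other.\<close>

lemma dual_lin_apply: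
  assumes u: "u \<in> carrier (tensor_space Ms)" and \<phi>: "\<phi> \<in> multilinear_forms Es"
  shows "lin Ms (tensor_space Es) R u \<phi> = u (f \<phi>)"
proof -
  have f\<phi>: "f \<phi> \<in> multilinear_forms Ms" using linear_mapsD(1)[OF f] \<phi> by simp
  note L = lin_props[OF Ms separated_tensor_space R]
  have "(\<lambda>u\<in>carrier (tensor_space Ms).
      (\<lambda>u\<in>carrier (tensor_space Es). u \<phi>) (lin Ms (tensor_space Es) R u))
      = (\<lambda>u\<in>carrier (tensor_space Ms). u (f \<phi>))"
  proof (rule tensor_linear_maps_eqI[OF kspace_scalar_space
        linear_map_compose[OF kspace_tensor_space L(1) tensor_apply_linear[OF \<phi>]]
        tensor_apply_linear[OF f\<phi>]])
    fix m assume m: "m \<in> tuples Ms"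
    show "(\<lambda>u\<in>carrier (tensor_space Ms).
        (\<lambda>u\<in>carrier (tensor_space Es). u \<phi>) (lin Ms (tensor_space Es) R u)) (elementary_tensor Ms m)
        = (\<lambda>u\<in>carrier (tensor_space Ms). u (f \<phi>)) (elementary_tensor Ms m)"
      using elementary_tensor_closed[OF m] L(2)[OF m] multilinear_mapsD1(1)[OF R m] dual[rule_format, OF m \<phi>]
        elementary_tensor_apply[OF f\<phi>]
      by simp
  qed
  from fun_cong[OF this, of u] show ?thesis using u linear_mapsD(1)[OF L(1) u] by simp
qed

lemma op_norm_dual:
  "op_norm (normed_tensor Ms \<theta>) (normed_tensor Es \<beta>) (lin Ms (tensor_space Es) R)
    = op_norm (forms_space Es \<beta>) (forms_space Ms \<theta>) f"
proof -
  let ?L = "lin Ms (tensor_space Es) R"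
  let ?nE = "vnorm (forms_space Es \<beta>)" and ?nM = "vnorm (forms_space Ms \<theta>)"
  let ?R = "op_norm (normed_tensor Ms \<theta>) (normed_tensor Es \<beta>) ?L"
  let ?f = "op_norm (forms_space Es \<beta>) (forms_space Ms \<theta>) f"
  note TM = fin_dim_normed_tensor[OF Ms \<theta>] and TE = fin_dim_normed_tensor[OF Es \<beta>]
  note FM = fin_dim_forms_space[OF Ms \<theta>] and FE = fin_dim_forms_space[OF Es \<beta>]
  have L: "?L \<in> linear_maps (normed_tensor Ms \<theta>) (normed_tensor Es \<beta>)"
    using lin_props(1)[OF Ms separated_tensor_space R] by simp
  have Lc: "?L u \<in> carrier (tensor_space Es)" if "u \<in> carrier (tensor_space Ms)" for u
    using linear_mapsD(1)[OF L, of u] that by simp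
  have f': "f \<in> linear_maps (forms_space Es \<beta>) (forms_space Ms \<theta>)" using f by simp
  have fc: "f \<phi> \<in> multilinear_forms Ms" if "\<phi> \<in> multilinear_forms Es" for \<phi>
    using linear_mapsD(1)[OF f, of \<phi>] that by simp
  note L_bdd = fin_dim_linear_bounded[OF TM fin_dimD(2)[OF TE] L]
  note f_bdd = fin_dim_linear_bounded[OF FE fin_dimD(2)[OF FM] f']
  have R0: "0 \<le> ?R" by (rule op_norm_nonneg[OF fin_dimD(2)[OF TM] fin_dimD(2)[OF TE] L L_bdd])
  have f0: "0 \<le> ?f" by (rule op_norm_nonneg[OF fin_dimD(2)[OF FE] fin_dimD(2)[OF FM] f' f_bdd])
  have Rb: "\<beta> (?L u) \<le> ?R * \<theta> u" if "u \<in> carrier (tensor_space Ms)" for u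
    using op_norm_bound[OF fin_dimD(2)[OF TM] fin_dimD(2)[OF TE] L L_bdd, of u] that by simp
  have fb: "?nM (f \<phi>) \<le> ?f * ?nE \<phi>" if "\<phi> \<in> multilinear_forms Es" for \<phi>
    using op_norm_bound[OF fin_dimD(2)[OF FE] fin_dimD(2)[OF FM] f' f_bdd, of \<phi>] that by simp
  have \<theta>0: "0 \<le> \<theta> u" if "u \<in> carrier (tensor_space Ms)" for u
    using \<theta> that by (simp add: is_norm_def)
  \<comment> \<open>This direction uses the Hahn--Banach theorem, through
    \<open>tensor_norm_le\<close>: the norm of \<open>?L u\<close> is tested on forms.\<close>
  have "?R \<le> ?f"
  proof (rule op_norm_le[OF fin_dimD(2)[OF TM] fin_dimD(2)[OF TE] f0])
    fix u assume "u \<in> carrier (normed_tensor Ms \<theta>)"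
    then have u: "u \<in> carrier (tensor_space Ms)" by simp
    have "\<beta> (?L u) \<le> ?f * \<theta> u"
    proof (rule tensor_norm_le[OF Es \<beta> Lc[OF u] mult_nonneg_nonneg[OF f0 \<theta>0[OF u]]])
      fix \<phi> assume \<phi>: "\<phi> \<in> multilinear_forms Es"
      have "norm (?L u \<phi>) \<le> ?nM (f \<phi>) * \<theta> u"
        unfolding dual_lin_apply[OF u \<phi>] by (rule form_norm_bound[OF Ms \<theta> fc[OF \<phi>] u])
      also have "\<dots> \<le> (?f * ?nE \<phi>) * \<theta> u" by (rule mult_right_mono[OF fb[OF \<phi>] \<theta>0[OF u]])
      finally show "norm (?L u \<phi>) \<le> ?f * \<theta> u * ?nE \<phi>"
        by (simp only: mult.assoc mult.commute[of "\<theta> u"])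
    qed
    then show "vnorm (normed_tensor Es \<beta>) (?L u) \<le> ?f * vnorm (normed_tensor Ms \<theta>) u" by simp
  qed
  \<comment> \<open>The norm of \<open>f \<phi>\<close> is by definition tested on tensors, so the
    adjoint relation suffices.\<close>
  moreover have "?f \<le> ?R"
  proof (rule op_norm_le[OF fin_dimD(2)[OF FE] fin_dimD(2)[OF FM] R0])
    fix \<phi> assume "\<phi> \<in> carrier (forms_space Es \<beta>)"
    then have \<phi>: "\<phi> \<in> multilinear_forms Es" by simp
    show "?nM (f \<phi>) \<le> ?R * ?nE \<phi>"
    proof (rule form_norm_le[OF Ms \<theta> fc[OF \<phi>] mult_nonneg_nonneg[OF R0 form_norm_nonneg[OF Es \<beta> \<phi>]]])
      fix u assume u: "u \<in> carrier (tensor_space Ms)"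
      have "norm (u (f \<phi>)) \<le> ?nE \<phi> * \<beta> (?L u)"
        unfolding dual_lin_apply[OF u \<phi>, symmetric] by (rule form_norm_bound[OF Es \<beta> \<phi> Lc[OF u]])
      also have "\<dots> \<le> ?nE \<phi> * (?R * \<theta> u)"
        by (rule mult_left_mono[OF Rb[OF u] form_norm_nonneg[OF Es \<beta> \<phi>]])
      finally show "norm (u (f \<phi>)) \<le> ?R * ?nE \<phi> * \<theta> u"
        by (simp only: mult.assoc mult.left_commute)
    qed
  qed
  ultimately show ?thesis by (rule antisym)
qed

text \<open>Under the identification \<open>f \<otimes> g\<close> becomes
  \<open>T \<mapsto> g \<circ> f\<^sub>T \<circ> R\<close>; this is the bridge between (D3) and
  (I3). Both sides are linear in \<open>u\<close>, and for \<open>u = \<phi> \<otimes> y\<close>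
  both are \<open>f \<phi> \<cdot> g y\<close>, since \<open>f \<phi> m = R m \<phi>\<close> is the
  value of \<open>\<phi>\<close> at a tuple that represents \<open>R m\<close>.\<close>

lemma identification_tensor_map:
  assumes F: "fin_dim_normed_space F" and N: "fin_dim_normed_space N"
    and R_Sigma: "\<forall>m\<in>tuples Ms. R m \<in> Sigma_set Es"
    and g: "g \<in> linear_maps F N" and u: "u \<in> carrier (dual_tensor_space Es F)"
  defines "fg \<equiv> lin2 (forms Es) F (dual_tensor_space Ms N)
    (\<lambda>\<phi> y. elementary2 (forms Ms) N (f \<phi>) (g y))"
  shows "fg \<in> linear_maps (dual_tensor_space Es F) (dual_tensor_space Ms N)"
    and "identification Ms N (fg u) = (\<lambda>m\<in>tuples Ms. g (Sigma_map Es F (identification Es F u) (R m)))"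
    and "(\<lambda>m\<in>tuples Ms. g (Sigma_map Es F (identification Es F u) (R m))) \<in> multilinear_maps Ms N"
proof -
  let ?DE = "dual_tensor_space Es F" and ?DM = "dual_tensor_space Ms N"
  have kME: "kspace (forms Es)" by (rule kspace_multilinear_space[OF fin_dim_kspaces[OF Es] kspace_scalar_space])
  have kMM: "kspace (forms Ms)" by (rule kspace_multilinear_space[OF fin_dim_kspaces[OF Ms] kspace_scalar_space])
  have kMN: "kspace (multilinear_space Ms N)"
    by (rule kspace_multilinear_space[OF fin_dim_kspaces[OF Ms] fin_dimD(1)[OF N]])
  interpret D: kspace ?DE unfolding dual_tensor_space_def by (rule kspace_tensor2)
  have sep: "separated ?DM" unfolding dual_tensor_space_def by (rule separated_tensor2)
  have bil: "bilinear_map (forms Es) F ?DM (\<lambda>\<phi> y. elementary2 (forms Ms) N (f \<phi>) (g y))"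
    using bilinear_map_elementary2[OF kMM fin_dimD(1)[OF N]] linear_mapsD(1-3)[OF f] linear_mapsD(1-3)[OF g]
    unfolding bilinear_map_def dual_tensor_space_def by (simp del: multilinear_space_simps)
  note fg = lin2_props[OF kME fin_dimD(1)[OF F] sep bil, folded fg_def]
  show fg_lin: "fg \<in> linear_maps ?DE ?DM" using fg(1) unfolding dual_tensor_space_def .
  note idE = identification_linear[OF Es F]
  \<comment> \<open>\<open>R m\<close> is an elementary tensor, and \<open>\<xi> m\<close> picks a
    tuple for it. The choice is arbitrary, so \<open>\<xi>\<close> need not be linear in any
    slot.\<close>
  define \<xi> where "\<xi> m = (SOME x. x \<in> tuples Es \<and> R m = elementary_tensor Es x)" for m
  have \<xi>: "\<xi> m \<in> tuples Es" "R m = elementary_tensor Es (\<xi> m)" if "m \<in> tuples Ms" for m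
  proof -
    have "\<exists>x. x \<in> tuples Es \<and> R m = elementary_tensor Es x"
      using R_Sigma[rule_format, OF that] by (auto simp: Sigma_set_def)
    from someI_ex[OF this] show "\<xi> m \<in> tuples Es" "R m = elementary_tensor Es (\<xi> m)"
      by (simp_all add: \<xi>_def)
  qed
  have T_R: "Sigma_map Es F T (R m) = T (\<xi> m)" if "T \<in> multilinear_maps Es F" "m \<in> tuples Ms" for T m
    using Sigma_map_elementary[OF Es fin_dim_separated[OF F] that(1) \<xi>(1)[OF that(2)]] \<xi>(2)[OF that(2)]
    by simp
  \<comment> \<open>Multilinearity comes from rewriting the map as the linear map
    \<open>g \<circ> lin Es F T\<close> applied after the multilinear \<open>R\<close>.\<close>
  have comp: "(\<lambda>m\<in>tuples Ms. g (T (\<xi> m))) \<in> multilinear_maps Ms N" if T: "T \<in> multilinear_maps Es F" for T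
  proof -
    note L = lin_props[OF Es fin_dim_separated[OF F] T]
    have "(\<lambda>m\<in>tuples Ms. (\<lambda>v\<in>carrier (tensor_space Es). g (lin Es F T v)) (R m)) \<in> multilinear_maps Ms N"
      by (rule multilinear_compose[OF fin_dim_kspaces[OF Ms] R
            linear_map_compose[OF kspace_tensor_space L(1) g]])
    also have "(\<lambda>m\<in>tuples Ms. (\<lambda>v\<in>carrier (tensor_space Es). g (lin Es F T v)) (R m))
        = (\<lambda>m\<in>tuples Ms. g (T (\<xi> m)))"
      by (intro restrict_ext) (simp add: \<xi> L(2) elementary_tensor_closed)
    finally show ?thesis .
  qed
  have id_mem: "identification Es F v \<in> multilinear_maps Es F" if "v \<in> carrier ?DE" for v
    using linear_mapsD(1)[OF idE that] by simp
  show "(\<lambda>m\<in>tuples Ms. g (Sigma_map Es F (identification Es F u) (R m))) \<in> multilinear_maps Ms N"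
    using comp[OF id_mem[OF u]] by (simp add: T_R[OF id_mem[OF u]] cong: restrict_cong)
  define h where "h = (\<lambda>v\<in>carrier ?DE. \<lambda>m\<in>tuples Ms. g (identification Es F v (\<xi> m)))"
  have "h \<in> linear_maps ?DE (multilinear_space Ms N)"
  proof (rule linear_mapsI)
    show "h v \<in> carrier (multilinear_space Ms N)" if "v \<in> carrier ?DE" for v
      using comp[OF id_mem[OF that]] that by (simp add: h_def)
    fix v w a assume v: "v \<in> carrier ?DE"
    have cl: "identification Es F v (\<xi> m) \<in> carrier F" if "v \<in> carrier ?DE" "m \<in> tuples Ms" for m v
      by (rule multilinear_mapsD1(1)[OF id_mem[OF that(1)] \<xi>(1)[OF that(2)]])
    show "h (v \<oplus>\<^bsub>?DE\<^esub> w) = h v \<oplus>\<^bsub>multilinear_space Ms N\<^esub> h w" if w: "w \<in> carrier ?DE"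
      using v w \<xi>(1) cl linear_mapsD(2)[OF idE v w] linear_mapsD(2)[OF g]
      by (auto simp: h_def intro!: restrict_ext)
    show "h (a \<odot>\<^bsub>?DE\<^esub> v) = a \<odot>\<^bsub>multilinear_space Ms N\<^esub> h v"
      using v \<xi>(1) cl linear_mapsD(3)[OF idE v] linear_mapsD(3)[OF g]
      by (auto simp: h_def intro!: restrict_ext)
  qed (simp add: h_def)
  moreover have "(\<lambda>v\<in>carrier ?DE. identification Ms N (fg v)) \<in> linear_maps ?DE (multilinear_space Ms N)"
    by (rule linear_map_compose[OF D.kspace_axioms fg_lin identification_linear[OF Ms N]])
  moreover have "(\<lambda>v\<in>carrier ?DE. identification Ms N (fg v)) (elementary2 (forms Es) F \<phi> y) = h (elementary2 (forms Es) F \<phi> y)"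
    if \<phi>: "\<phi> \<in> carrier (forms Es)" and y: "y \<in> carrier F" for \<phi> y
  proof -
    have e: "elementary2 (forms Es) F \<phi> y \<in> carrier ?DE"
      unfolding dual_tensor_space_def by (rule elementary2_closed[OF \<phi> y])
    have \<phi>': "\<phi> \<in> multilinear_forms Es" using \<phi> by simp
    have f\<phi>: "f \<phi> \<in> multilinear_forms Ms" using linear_mapsD(1)[OF f \<phi>] by simp
    have "identification Ms N (fg (elementary2 (forms Es) F \<phi> y)) = form_times_vector Ms N (f \<phi>) (g y)"
      unfolding fg(2)[OF \<phi> y] by (rule identification_elementary[OF Ms N f\<phi> linear_mapsD(1)[OF g y]])
    also have "\<dots> = (\<lambda>m\<in>tuples Ms. g (form_times_vector Es F \<phi> y (\<xi> m)))"
    proof -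
      have "f \<phi> m = \<phi> (\<xi> m)" if m: "m \<in> tuples Ms" for m
        using dual[rule_format, OF m \<phi>'] \<xi>(2)[OF m] elementary_tensor_apply[OF \<phi>'] by simp
      then show ?thesis
        using \<xi>(1) linear_mapsD(3)[OF g y]
        by (auto simp: form_times_vector_def intro!: restrict_ext)
    qed
    finally show ?thesis
      using e identification_elementary[OF Es F \<phi>' y] by (simp add: h_def)
  qed
  ultimately have "(\<lambda>v\<in>carrier ?DE. identification Ms N (fg v)) = h"
    unfolding dual_tensor_space_def by (intro tensor2_linear_maps_eqI[OF kMN])
  from fun_cong[OF this, of u] have "identification Ms N (fg u) = h u" using u by simp
  also have "\<dots> = (\<lambda>m\<in>tuples Ms. g (Sigma_map Es F (identification Es F u) (R m)))"
    using u by (simp add: h_def T_R[OF id_mem[OF u]] cong: restrict_cong)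
  finally show "identification Ms N (fg u) = (\<lambda>m\<in>tuples Ms. g (Sigma_map Es F (identification Es F u) (R m)))" .
qed

end

section \<open>From \<Sigma>-operators to operators on forms and back\<close>

context
  fixes Es Ms :: "('k::real_or_complex, 'a) normed_space list" and \<beta> \<theta> :: "('k, 'a) tensor \<Rightarrow> real"
  assumes Es: "\<forall>E\<in>set Es. fin_dim_normed_space E" and Ms: "\<forall>E\<in>set Ms. fin_dim_normed_space E"
begin

lemma form_of_tensor_map:
  assumes R: "R \<in> multilinear_maps Ms (tensor_space Es)" and R_Sigma: "\<forall>m\<in>tuples Ms. R m \<in> Sigma_set Es"
  shows "\<exists>f. preserves_Sigma Es \<beta> Ms \<theta> f \<and>
    (\<forall>m\<in>tuples Ms. \<forall>\<phi>\<in>multilinear_forms Es. R m \<phi> = f \<phi> m)"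
proof -
  have kME: "kspace (forms Es)" by (rule kspace_multilinear_space[OF fin_dim_kspaces[OF Es] kspace_scalar_space])
  note Rc = multilinear_mapsD1(1)[OF R]
  define f where "f = (\<lambda>\<phi>\<in>multilinear_forms Es. \<lambda>m\<in>tuples Ms. R m \<phi>)"
  have f_mem: "f \<phi> \<in> multilinear_forms Ms" if \<phi>: "\<phi> \<in> multilinear_forms Es" for \<phi>
  proof -
    have "(\<lambda>m\<in>tuples Ms. (\<lambda>u\<in>carrier (tensor_space Es). u \<phi>) (R m)) \<in> multilinear_forms Ms"
      by (rule multilinear_compose[OF fin_dim_kspaces[OF Ms] R tensor_apply_linear[OF \<phi>]])
    also have "(\<lambda>m\<in>tuples Ms. (\<lambda>u\<in>carrier (tensor_space Es). u \<phi>) (R m)) = f \<phi>"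
      using \<phi> by (simp add: f_def Rc cong: restrict_cong)
    finally show ?thesis .
  qed
  have f: "f \<in> linear_maps (forms Es) (forms Ms)"
  proof (rule linear_mapsI)
    show "f \<phi> \<in> carrier (forms Ms)" if "\<phi> \<in> carrier (forms Es)" for \<phi> using f_mem that by simp
    show "f (\<phi> \<oplus>\<^bsub>forms Es\<^esub> \<psi>) = f \<phi> \<oplus>\<^bsub>forms Ms\<^esub> f \<psi>" if "\<phi> \<in> carrier (forms Es)" "\<psi> \<in> carrier (forms Es)" for \<phi> \<psi>
    proof -
      have "\<phi> \<oplus>\<^bsub>forms Es\<^esub> \<psi> \<in> multilinear_forms Es"
        using multilinear_add[OF fin_dim_kspaces[OF Es] kspace_scalar_space, of \<phi> \<psi>] that by simp
      then show ?thesis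
        using linear_map_scalarD(1)[OF tensor_is_functional[OF Es Rc] that] that
        by (simp add: f_def cong: restrict_cong del: multilinear_space_simps(3)) (simp cong: restrict_cong)
    qed
    show "f (a \<odot>\<^bsub>forms Es\<^esub> \<phi>) = a \<odot>\<^bsub>forms Ms\<^esub> f \<phi>" if "\<phi> \<in> carrier (forms Es)" for a \<phi>
    proof -
      have "a \<odot>\<^bsub>forms Es\<^esub> \<phi> \<in> multilinear_forms Es"
        using multilinear_scale[OF fin_dim_kspaces[OF Es] kspace_scalar_space, of \<phi> a] that by simp
      then show ?thesis
        using linear_map_scalarD(2)[OF tensor_is_functional[OF Es Rc] that] that
        by (simp add: f_def cong: restrict_cong del: multilinear_space_simps(4)) (simp cong: restrict_cong)
    qed
  qed (simp add: f_def)
  \<comment> \<open>The adjoint sends the elementary tensor of \<open>m\<close> to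
    \<open>R m\<close>, which lies in \<Sigma> by assumption.\<close>
  have adj: "adjoint (forms_space Es \<beta>) f (canonical_image Ms (elementary_tensor Ms m)) = R m"
    if m: "m \<in> tuples Ms" for m
  proof (rule extensionalityI[of _ "multilinear_forms Es"])
    show "R m \<in> extensional (multilinear_forms Es)"
      using linear_mapsD(4)[OF tensor_is_functional[OF Es Rc[OF m]]] by simp
    fix \<phi> assume \<phi>: "\<phi> \<in> multilinear_forms Es"
    show "adjoint (forms_space Es \<beta>) f (canonical_image Ms (elementary_tensor Ms m)) \<phi> = R m \<phi>"
      using \<phi> m elementary_tensor_apply[OF f_mem[OF \<phi>], of m]
      by (simp add: adjoint_def canonical_image_eq[OF Ms elementary_tensor_closed[OF m]]) (simp add: f_def)
  qed (simp add: adjoint_def)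
  have "adjoint (forms_space Es \<beta>) f (canonical_image Ms (elementary_tensor Ms m))
      \<in> canonical_image Es ` Sigma_set Es" if m: "m \<in> tuples Ms" for m
    unfolding adj[OF m] using canonical_image_eq[OF Es Rc[OF m], symmetric] R_Sigma[rule_format, OF m] by (rule image_eqI)
  then have "adjoint (forms_space Es \<beta>) f ` canonical_image Ms ` Sigma_set Ms
      \<subseteq> canonical_image Es ` Sigma_set Es"
    unfolding Sigma_set_def[of Ms] by blast
  then have "preserves_Sigma Es \<beta> Ms \<theta> f" using f by (simp add: preserves_Sigma_def)
  moreover have "\<forall>m\<in>tuples Ms. \<forall>\<phi>\<in>multilinear_forms Es. R m \<phi> = f \<phi> m" by (simp add: f_def)
  ultimately show ?thesis by blast
qed

text \<open>Here \<open>R m\<close> is the adjoint of \<open>f\<close> at the elementary tensor of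
  \<open>m\<close>. It lies in \<Sigma> because \<open>f\<close> preserves \<Sigma>, and it is
  multilinear in \<open>m\<close> because each \<open>f \<phi>\<close> is.\<close>

lemma tensor_map_of_form:
  assumes "preserves_Sigma Es \<beta> Ms \<theta> f"
  shows "\<exists>R\<in>multilinear_maps Ms (tensor_space Es). (\<forall>m\<in>tuples Ms. R m \<in> Sigma_set Es) \<and>
    (\<forall>m\<in>tuples Ms. \<forall>\<phi>\<in>multilinear_forms Es. R m \<phi> = f \<phi> m)"
proof -
  have f: "f \<in> linear_maps (forms Es) (forms Ms)"
    and adj: "adjoint (forms_space Es \<beta>) f ` canonical_image Ms ` Sigma_set Ms
      \<subseteq> canonical_image Es ` Sigma_set Es"
    using assms by (simp_all add: preserves_Sigma_def)
  have f_mem: "f \<phi> \<in> multilinear_forms Ms" if "\<phi> \<in> multilinear_forms Es" for \<phi>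
    using linear_mapsD(1)[OF f, of \<phi>] that by simp
  define R where "R = (\<lambda>m\<in>tuples Ms. \<lambda>\<phi>\<in>multilinear_forms Es. f \<phi> m)"
  have R_Sigma: "R m \<in> Sigma_set Es" if m: "m \<in> tuples Ms" for m
  proof -
    have "adjoint (forms_space Es \<beta>) f (canonical_image Ms (elementary_tensor Ms m)) = R m"
      using m elementary_tensor_apply[OF f_mem]
      by (simp add: adjoint_def R_def canonical_image_eq[OF Ms elementary_tensor_closed[OF m]]
          cong: restrict_cong)
    moreover have "adjoint (forms_space Es \<beta>) f (canonical_image Ms (elementary_tensor Ms m))
        \<in> canonical_image Es ` Sigma_set Es"
      using m by (intro subsetD[OF adj] imageI) (simp add: Sigma_set_def)
    ultimately have "R m \<in> canonical_image Es ` Sigma_set Es" by simp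
    then obtain x where x: "x \<in> tuples Es" "R m = canonical_image Es (elementary_tensor Es x)"
      by (auto simp: Sigma_set_def)
    then show ?thesis
      by (simp add: canonical_image_eq[OF Es elementary_tensor_closed] Sigma_set_def)
  qed
  have "R \<in> multilinear_maps Ms (tensor_space Es)"
  proof (rule multilinear_mapsI[OF fin_dim_kspaces[OF Ms]])
    show "R m \<in> carrier (tensor_space Es)" if "m \<in> tuples Ms" for m
      using R_Sigma[OF that] elementary_tensor_closed by (auto simp: Sigma_set_def)
  qed (auto simp: R_def tensor_space_def multilinear_mapsD[OF fin_dim_kspaces[OF Ms] f_mem]
      intro!: restrict_ext)
  moreover have "\<forall>m\<in>tuples Ms. \<forall>\<phi>\<in>multilinear_forms Es. R m \<phi> = f \<phi> m" by (simp add: R_def)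
  ultimately show ?thesis using R_Sigma by blast
qed

end


section \<open>Transport along the identification\<close>

lemma electionD:
  assumes "election Es F \<beta>"
  shows "\<forall>E\<in>set Es. fin_dim_normed_space E" "fin_dim_normed_space F" "is_norm (tensor_space Es) \<beta>"
  using assms by (auto simp: election_def spaces_with_crossnorm_def reasonable_crossnorm_def)

lemma election_identification_bij:
  assumes "election Es F \<beta>"
  shows "bij_betw (identification Es F) (carrier (dual_tensor_space Es F)) (multilinear_maps Es F)"
  by (rule identification_bij[OF electionD(1,2)[OF assms]])

lemma is_norm_transport:
  assumes V: "kspace V" and W: "kspace W" and f: "f \<in> linear_maps V W"
    and bij: "bij_betw f (carrier V) (carrier W)"
    and eq: "\<And>v. v \<in> carrier V \<Longrightarrow> N v = M (f v)"
  shows "is_norm V N \<longleftrightarrow> is_norm W M"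
proof -
  interpret V: kspace V by fact
  interpret W: kspace W by fact
  note fD = linear_mapsD(1-3)[OF f]
  have im: "carrier W = f ` carrier V" using bij by (simp add: bij_betw_def)
  have f0: "f v = \<zero>\<^bsub>W\<^esub> \<longleftrightarrow> v = \<zero>\<^bsub>V\<^esub>" if "v \<in> carrier V" for v
    using linear_map_zero[OF V W f] bij_betw_imp_inj_on[OF bij] that V.zero_closed by (metis inj_onD)
  have "N (a \<odot>\<^bsub>V\<^esub> v) = M (a \<odot>\<^bsub>W\<^esub> f v)" if "v \<in> carrier V" for a v
    using that by (simp add: eq fD(3))
  moreover have "N (u \<oplus>\<^bsub>V\<^esub> v) = M (f u \<oplus>\<^bsub>W\<^esub> f v)" if "u \<in> carrier V" "v \<in> carrier V" for u v
    using that by (simp add: eq fD(2))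
  ultimately show ?thesis
    unfolding is_norm_def im ball_simps by (auto simp: eq f0)
qed

lemma component_multilinear:
  assumes "\<A> Es F \<beta> = multilinear_maps Es F"
  shows "component \<A> A Es F \<beta> = with_norm (multilinear_space Es F) (A Es F \<beta>)"
  by (simp add: component_def assms multilinear_space_def)

section \<open>Transport of the axioms for abstract \<nu> and A matched by the identification,
  shared by both directions\<close>

context
  fixes \<nu> :: "('k::real_or_complex, 'a) dual_norm_assignment"
    and \<A> :: "('k, 'a) space_assignment" and A :: "('k, 'a) norm_assignment"
  assumes all: "\<forall>Es F \<beta>. election Es F \<beta> \<longrightarrow> \<A> Es F \<beta> = multilinear_maps Es F"
    and \<nu>_A: "\<forall>Es F \<beta>. election Es F \<beta> \<longrightarrow> (\<forall>u\<in>carrier (dual_tensor_space Es F).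
      \<nu> Es F \<beta> u = A Es F \<beta> (identification Es F u))"
begin

context
  fixes Es :: "('k, 'a) normed_space list" and F :: "('k, 'a) normed_space"
    and \<beta> :: "('k, 'a) tensor \<Rightarrow> real"
  assumes e: "election Es F \<beta>"
begin

private abbreviation "D \<equiv> dual_tensor_space Es F"

private lemma kspaces: "kspace (forms Es)" "kspace (multilinear_space Es F)" "kspace D"
  using kspace_multilinear_space[OF fin_dim_kspaces[OF electionD(1)[OF e]]] kspace_scalar_space
    fin_dimD(1)[OF electionD(2)[OF e]] kspace_tensor2
  by (simp_all add: dual_tensor_space_def)

private lemma id_linear: "identification Es F \<in> linear_maps D (multilinear_space Es F)"
  by (rule identification_linear[OF electionD(1,2)[OF e]])

private lemma id_bij: "bij_betw (identification Es F) (carrier D) (multilinear_maps Es F)"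
  by (rule identification_bij[OF electionD(1,2)[OF e]])

lemma transport_isometric_iso:
  "isometric_iso (normed_dual_tensor \<nu> Es F \<beta>) (component \<A> A Es F \<beta>) (identification Es F)"
  using id_linear id_bij \<nu>_A[rule_format, OF e]
  by (simp add: isometric_iso_def component_multilinear[of \<A>, OF all[rule_format, OF e]])

lemma transport_is_norm: "is_norm D (\<nu> Es F \<beta>) \<longleftrightarrow> is_norm (multilinear_space Es F) (A Es F \<beta>)"
  by (rule is_norm_transport[OF kspaces(3,2) id_linear])
    (simp_all add: id_bij \<nu>_A[rule_format, OF e])

text \<open>The component is the full space of multilinear maps, which is finite dimensional and
  hence complete for every norm.\<close>

lemma transport_space:
  assumes "is_norm D (\<nu> Es F \<beta>)"
  shows "submodule (\<A> Es F \<beta>) scalar_ring (multilinear_space Es F)"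
    and "is_norm (component \<A> A Es F \<beta>) (A Es F \<beta>)"
    and "is_complete (component \<A> A Es F \<beta>)"
proof -
  have N: "is_norm (multilinear_space Es F) (A Es F \<beta>)" using assms transport_is_norm by simp
  note comp = component_multilinear[of \<A>, OF all[rule_format, OF e]]
  show "submodule (\<A> Es F \<beta>) scalar_ring (multilinear_space Es F)"
    using module.carrier_is_submodule[of scalar_ring "multilinear_space Es F"] kspaces(2)
    by (simp add: all[rule_format, OF e] kspace_iff)
  show "is_norm (component \<A> A Es F \<beta>) (A Es F \<beta>)" using N by (simp add: comp)
  have "finitely_spanned (multilinear_space Es F)"
    by (rule finitely_separated_spanned[OF kspaces(2) finitely_separated_multilinear_space[OF electionD(1,2)[OF e]]])
  then have "fin_dim_normed_space (with_norm (multilinear_space Es F) (A Es F \<beta>))"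
    using N kspaces(2) by (simp add: fin_dim_with_norm)
  then show "is_complete (component \<A> A Es F \<beta>)" unfolding comp by (rule fin_dim_complete)
qed

lemma transport_elementary:
  assumes "\<phi> \<in> multilinear_forms Es" "y \<in> carrier F"
  shows "form_times_vector Es F \<phi> y \<in> \<A> Es F \<beta>"
    and "\<nu> Es F \<beta> (elementary2 (forms Es) F \<phi> y) = A Es F \<beta> (form_times_vector Es F \<phi> y)"
proof -
  have "elementary2 (forms Es) F \<phi> y \<in> carrier D"
    unfolding dual_tensor_space_def using assms by (intro elementary2_closed) simp_all
  then show "\<nu> Es F \<beta> (elementary2 (forms Es) F \<phi> y) = A Es F \<beta> (form_times_vector Es F \<phi> y)"
    using \<nu>_A[rule_format, OF e] identification_elementary[OF electionD(1,2)[OF e] assms] by simp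
  show "form_times_vector Es F \<phi> y \<in> \<A> Es F \<beta>"
    unfolding all[rule_format, OF e] by (rule form_times_vector_closed[OF electionD(1,2)[OF e] assms])
qed

text \<open>The functional of (D2), with the points \<open>p\<close> and \<open>q\<close> of
  \<Sigma> given by tuples \<open>x\<close> and \<open>z\<close>.\<close>

private definition difference_functional :: "'a list \<Rightarrow> 'a list \<Rightarrow> ('a \<Rightarrow> 'k) \<Rightarrow> ('k, 'a) dual_tensor \<Rightarrow> 'k" where
  "difference_functional x z y' = lin2 (forms Es) F scalar_space
     (\<lambda>\<phi> y. (Sigma_map Es scalar_space \<phi> (elementary_tensor Es x)
       - Sigma_map Es scalar_space \<phi> (elementary_tensor Es z)) * y' y)"

private lemma difference_functional:
  assumes x: "x \<in> tuples Es" and z: "z \<in> tuples Es" and y': "y' \<in> linear_maps F scalar_space"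
  shows "difference_functional x z y' \<in> linear_maps D scalar_space"
    and "u \<in> carrier D \<Longrightarrow> difference_functional x z y' u
      = y' (identification Es F u x \<ominus>\<^bsub>F\<^esub> identification Es F u z)"
proof -
  note EF = electionD(1,2)[OF e]
  let ?T = "\<lambda>\<phi> y. (Sigma_map Es scalar_space \<phi> (elementary_tensor Es x)
    - Sigma_map Es scalar_space \<phi> (elementary_tensor Es z)) * y' y"
  have T: "?T \<phi> y = (\<phi> x - \<phi> z) * y' y" if "\<phi> \<in> multilinear_forms Es" for \<phi> y
    using Sigma_map_elementary[OF EF(1) fin_dim_separated[OF fin_dim_scalar_space] that] x z by simp
  interpret M: kspace "forms Es" by (rule kspaces(1))
  have M_closed: "\<phi> \<oplus>\<^bsub>forms Es\<^esub> \<psi> \<in> multilinear_forms Es" "a \<odot>\<^bsub>forms Es\<^esub> \<phi> \<in> multilinear_forms Es"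
    if "\<phi> \<in> multilinear_forms Es" "\<psi> \<in> multilinear_forms Es" for \<phi> \<psi> a
    using M.a_closed[of \<phi> \<psi>] M.scale_closed[of \<phi> a] that unfolding multilinear_space_simps(1) by blast+
  have "bilinear_map (forms Es) F scalar_space ?T"
    unfolding bilinear_map_def
  proof (intro conjI ballI allI)
    fix \<phi> \<psi> y y2 a assume "\<phi> \<in> carrier (forms Es)" and y: "y \<in> carrier F"
    then have \<phi>: "\<phi> \<in> multilinear_forms Es" by simp
    show "?T \<phi> y \<in> carrier scalar_space" by simp
    show "?T (a \<odot>\<^bsub>forms Es\<^esub> \<phi>) y = a \<odot>\<^bsub>scalar_space\<^esub> ?T \<phi> y"
      unfolding T[OF \<phi>] T[OF M_closed(2)[OF \<phi> \<phi>]] using x z by (simp add: algebra_simps)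
    show "?T \<phi> (a \<odot>\<^bsub>F\<^esub> y) = a \<odot>\<^bsub>scalar_space\<^esub> ?T \<phi> y"
      unfolding T[OF \<phi>] using linear_map_scalarD(2)[OF y' y] by simp
    show "?T \<phi> (y \<oplus>\<^bsub>F\<^esub> y2) = ?T \<phi> y \<oplus>\<^bsub>scalar_space\<^esub> ?T \<phi> y2" if "y2 \<in> carrier F"
      unfolding T[OF \<phi>] using linear_map_scalarD(1)[OF y' y that] by (simp add: algebra_simps)
    show "?T (\<phi> \<oplus>\<^bsub>forms Es\<^esub> \<psi>) y = ?T \<phi> y \<oplus>\<^bsub>scalar_space\<^esub> ?T \<psi> y" if "\<psi> \<in> carrier (forms Es)"
    proof -
      have \<psi>: "\<psi> \<in> multilinear_forms Es" using that by simp
      show ?thesis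
        unfolding T[OF \<phi>] T[OF \<psi>] T[OF M_closed(1)[OF \<phi> \<psi>]] using x z by (simp add: algebra_simps)
    qed
  qed
  note L = lin2_props[OF kspaces(1) fin_dimD(1)[OF EF(2)] fin_dim_separated[OF fin_dim_scalar_space] this]
  show diff: "difference_functional x z y' \<in> linear_maps D scalar_space"
    using L(1) unfolding difference_functional_def dual_tensor_space_def .
  interpret F: kspace F by (rule fin_dimD(1)[OF EF(2)])
  \<comment> \<open>The claimed value as a function of \<open>u\<close>. It is linear because the
    identification is, so a comparison on elementary tensors suffices.\<close>
  define h where "h = (\<lambda>u\<in>carrier D. y' (identification Es F u x) - y' (identification Es F u z))"
  have id_mem: "identification Es F u \<in> multilinear_maps Es F" if "u \<in> carrier D" for u
    using linear_mapsD(1)[OF id_linear that] by simp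
  have cl: "identification Es F u w \<in> carrier F" if "u \<in> carrier D" "w \<in> tuples Es" for u w
    by (rule multilinear_mapsD1(1)[OF id_mem[OF that(1)] that(2)])
  interpret D: kspace D by (rule kspaces(3))
  have "h \<in> linear_maps D scalar_space"
  proof (rule linear_mapsI)
    fix u v assume uv: "u \<in> carrier D" "v \<in> carrier D"
    then show "h (u \<oplus>\<^bsub>D\<^esub> v) = h u \<oplus>\<^bsub>scalar_space\<^esub> h v"
      using linear_mapsD(2)[OF id_linear uv] x z cl by (simp add: h_def linear_map_scalarD[OF y'])
  next
    fix a u assume u: "u \<in> carrier D"
    then show "h (a \<odot>\<^bsub>D\<^esub> u) = a \<odot>\<^bsub>scalar_space\<^esub> h u"
      using linear_mapsD(3)[OF id_linear u] x z cl
      by (simp add: h_def linear_map_scalarD[OF y'] right_diff_distrib)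
  qed (simp_all add: h_def)
  moreover have "difference_functional x z y' (elementary2 (forms Es) F \<phi> y) = h (elementary2 (forms Es) F \<phi> y)"
    if \<phi>: "\<phi> \<in> carrier (forms Es)" and y: "y \<in> carrier F" for \<phi> y
  proof -
    have el: "elementary2 (forms Es) F \<phi> y \<in> carrier D"
      unfolding dual_tensor_space_def by (rule elementary2_closed[OF \<phi> y])
    have \<phi>': "\<phi> \<in> multilinear_forms Es" using \<phi> by simp
    have "difference_functional x z y' (elementary2 (forms Es) F \<phi> y) = (\<phi> x - \<phi> z) * y' y"
      unfolding difference_functional_def L(2)[OF \<phi> y] by (rule T[OF \<phi>'])
    then show ?thesis
      using el x z y by (simp add: h_def identification_elementary[OF EF \<phi>' y] form_times_vector_def
          linear_map_scalarD[OF y'] left_diff_distrib)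
  qed
  ultimately have "difference_functional x z y' = h"
    using diff unfolding dual_tensor_space_def by (intro tensor2_linear_maps_eqI[OF kspace_scalar_space])
  then show "u \<in> carrier D \<Longrightarrow> difference_functional x z y' u
      = y' (identification Es F u x \<ominus>\<^bsub>F\<^esub> identification Es F u z)"
    using x z cl linear_map_minus[OF F.kspace_axioms kspace_scalar_space y']
    by (simp add: h_def kspace.minus_eq_scale[OF kspace_scalar_space])
qed

lemma fin_dim_normed_dual_tensor:
  assumes "is_norm D (\<nu> Es F \<beta>)"
  shows "fin_dim_normed_space (normed_dual_tensor \<nu> Es F \<beta>)"
  using assms kspaces(3) finitely_spanned_dual_tensor_space[OF electionD(1,2)[OF e]]
  by (simp add: fin_dim_with_norm)

lemma transport_Lipschitz:
  assumes N: "is_norm D (\<nu> Es F \<beta>)"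
  shows "(\<forall>p\<in>Sigma_set Es. \<forall>q\<in>Sigma_set Es. \<forall>y'\<in>linear_maps F scalar_space.
      op_norm (normed_dual_tensor \<nu> Es F \<beta>) scalar_space
        (lin2 (forms Es) F scalar_space (\<lambda>\<phi> y. (Sigma_map Es scalar_space \<phi> p - Sigma_map Es scalar_space \<phi> q) * y' y))
      \<le> \<beta> (p \<ominus>\<^bsub>tensor_space Es\<^esub> q) * op_norm F scalar_space y') \<longleftrightarrow>
    (\<forall>T\<in>\<A> Es F \<beta>. Lip Es \<beta> F (Sigma_map Es F T) \<le> A Es F \<beta> T)"
    (is "?dual \<longleftrightarrow> ?ideal")
proof -
  note EF = electionD(1,2)[OF e] and \<beta> = electionD(3)[OF e]
  let ?e = "elementary_tensor Es"
  let ?dist = "\<lambda>x z. \<beta> (?e x \<ominus>\<^bsub>tensor_space Es\<^esub> ?e z)"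
  let ?K = "scalar_space :: ('k, 'k) normed_space"
  have dual_iff: "?dual \<longleftrightarrow> (\<forall>x\<in>tuples Es. \<forall>z\<in>tuples Es. \<forall>y'\<in>linear_maps F scalar_space.
      op_norm (normed_dual_tensor \<nu> Es F \<beta>) scalar_space (difference_functional x z y')
      \<le> ?dist x z * op_norm F scalar_space y')"
    by (simp add: Sigma_set_def difference_functional_def)
  note nD = fin_dim_normed_dual_tensor[OF N] and nK = fin_dimD(2)[OF fin_dim_scalar_space]
  interpret U: normed_kspace "tensor_space Es" \<beta>
    by (simp add: normed_kspace_def normed_kspace_axioms_def kspace_tensor_space \<beta>)
  interpret F: normed_kspace F "vnorm F" by (rule fin_dimD(2)[OF EF(2)])
  have dist0: "0 \<le> ?dist x z" if "x \<in> tuples Es" "z \<in> tuples Es" for x z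
    using that elementary_tensor_closed by (intro U.N_nonneg U.minus_closed)
  have \<nu>0: "0 \<le> \<nu> Es F \<beta> u" if "u \<in> carrier D" for u using N that by (simp add: is_norm_def)
  have id_mem: "identification Es F u \<in> multilinear_maps Es F" if "u \<in> carrier D" for u
    using linear_mapsD(1)[OF id_linear that] by simp
  note Tc = multilinear_mapsD1(1)[where W=F]
  show ?thesis
    unfolding dual_iff
  proof (intro iffI ballI)
    fix T assume dual: "\<forall>x\<in>tuples Es. \<forall>z\<in>tuples Es. \<forall>y'\<in>linear_maps F scalar_space.
      op_norm (normed_dual_tensor \<nu> Es F \<beta>) scalar_space (difference_functional x z y')
      \<le> ?dist x z * op_norm F scalar_space y'"
    assume "T \<in> \<A> Es F \<beta>"
    then have T: "T \<in> multilinear_maps Es F" by (simp add: all[rule_format, OF e])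
    then obtain u where u: "u \<in> carrier D" "T = identification Es F u"
      using bij_betw_imp_surj_on[OF id_bij] by blast
    have AT: "A Es F \<beta> T = \<nu> Es F \<beta> u" using \<nu>_A[rule_format, OF e u(1)] u(2) by simp
    show "Lip Es \<beta> F (Sigma_map Es F T) \<le> A Es F \<beta> T"
      unfolding AT
    proof (rule Lip_le[OF EF(1) \<beta> EF(2) T \<nu>0[OF u(1)]])
      fix x z assume xz: "x \<in> tuples Es" "z \<in> tuples Es"
      have w: "T x \<ominus>\<^bsub>F\<^esub> T z \<in> carrier F" using Tc[OF T] xz by simp
      \<comment> \<open>A norming functional for the difference turns the scalar estimate of (D2)
        into an estimate in \<open>F\<close>.\<close>
      obtain y' where y': "y' \<in> linear_maps F scalar_space"
        "\<And>v. v \<in> carrier F \<Longrightarrow> norm (y' v) \<le> vnorm F v" "norm (y' (T x \<ominus>\<^bsub>F\<^esub> T z)) = vnorm F (T x \<ominus>\<^bsub>F\<^esub> T z)"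
        using fin_dim_norming_functional[OF EF(2) w] by blast
      have "op_norm F ?K y' \<le> 1"
        by (rule op_norm_le[OF fin_dimD(2)[OF EF(2)] nK]) (simp_all add: y'(2))
      then have "?dist x z * op_norm F ?K y' \<le> ?dist x z * 1"
        by (rule mult_left_mono[OF _ dist0[OF xz]])
      moreover have "op_norm (normed_dual_tensor \<nu> Es F \<beta>) scalar_space (difference_functional x z y')
          \<le> ?dist x z * op_norm F ?K y'"
        using dual xz y'(1) by blast
      ultimately have op: "op_norm (normed_dual_tensor \<nu> Es F \<beta>) scalar_space (difference_functional x z y') \<le> ?dist x z"
        by linarith
      have lin: "difference_functional x z y' \<in> linear_maps (normed_dual_tensor \<nu> Es F \<beta>) ?K"
        using difference_functional(1)[OF xz y'(1)] by simp
      have "norm (difference_functional x z y' u)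
          \<le> op_norm (normed_dual_tensor \<nu> Es F \<beta>) scalar_space (difference_functional x z y') * \<nu> Es F \<beta> u"
        using op_norm_bound[OF fin_dimD(2)[OF nD] nK lin fin_dim_linear_bounded[OF nD nK lin], of u] u(1)
        by simp
      also have "\<dots> \<le> ?dist x z * \<nu> Es F \<beta> u" by (rule mult_right_mono[OF op \<nu>0[OF u(1)]])
      finally show "vnorm F (T x \<ominus>\<^bsub>F\<^esub> T z) \<le> \<nu> Es F \<beta> u * ?dist x z"
        using difference_functional(2)[OF xz y'(1) u(1)] y'(3) u(2) by (simp add: mult.commute)
    qed
  next
    fix x z y' assume ideal: ?ideal and xz: "x \<in> tuples Es" "z \<in> tuples Es"
      and y': "y' \<in> linear_maps F scalar_space"
    note y'_bdd = fin_dim_linear_bounded[OF EF(2) nK y']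
    have y0: "0 \<le> op_norm F ?K y'" by (rule op_norm_nonneg[OF fin_dimD(2)[OF EF(2)] nK y' y'_bdd])
    show "op_norm (normed_dual_tensor \<nu> Es F \<beta>) scalar_space (difference_functional x z y')
      \<le> ?dist x z * op_norm F scalar_space y'"
    proof (rule op_norm_le[OF fin_dimD(2)[OF nD] nK])
      show "0 \<le> ?dist x z * op_norm F scalar_space y'" using dist0[OF xz] y0 by simp
      fix u assume "u \<in> carrier (normed_dual_tensor \<nu> Es F \<beta>)"
      then have u: "u \<in> carrier D" by simp
      let ?T = "identification Es F u"
      have T: "?T \<in> multilinear_maps Es F" by (rule id_mem[OF u])
      have w: "?T x \<ominus>\<^bsub>F\<^esub> ?T z \<in> carrier F" using Tc[OF T] xz by simp
      have "vnorm F (?T x \<ominus>\<^bsub>F\<^esub> ?T z) \<le> Lip Es \<beta> F (Sigma_map Es F ?T) * ?dist x z"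
        by (rule Lip_bound[OF EF(1) \<beta> EF(2) T xz])
      also have "\<dots> \<le> \<nu> Es F \<beta> u * ?dist x z"
        using ideal T by (intro mult_right_mono[OF _ dist0[OF xz]]) (simp add: \<nu>_A[rule_format, OF e u] all[rule_format, OF e])
      finally have le: "vnorm F (?T x \<ominus>\<^bsub>F\<^esub> ?T z) \<le> \<nu> Es F \<beta> u * ?dist x z" .
      \<comment> \<open>Conversely, the Lipschitz bound in \<open>F\<close> is passed through
        \<open>y'\<close> at the cost of its operator norm.\<close>
      have "norm (difference_functional x z y' u) \<le> op_norm F ?K y' * vnorm F (?T x \<ominus>\<^bsub>F\<^esub> ?T z)"
        using op_norm_bound[OF fin_dimD(2)[OF EF(2)] nK y' y'_bdd w] difference_functional(2)[OF xz y' u]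
        by simp
      also have "\<dots> \<le> op_norm F ?K y' * (\<nu> Es F \<beta> u * ?dist x z)" by (rule mult_left_mono[OF le y0])
      finally show "vnorm scalar_space (difference_functional x z y' u)
          \<le> ?dist x z * op_norm F scalar_space y' * vnorm (normed_dual_tensor \<nu> Es F \<beta>) u"
        by (simp add: mult_ac)
    qed
  qed
qed

end

section \<open>The ideal property (I3) and the mapping property (D3)\<close>

context
  fixes Es Ms :: "('k, 'a) normed_space list" and F N :: "('k, 'a) normed_space"
    and \<beta> \<theta> :: "('k, 'a) tensor \<Rightarrow> real"
  assumes eE: "election Es F \<beta>" and eM: "election Ms N \<theta>"
    and nE: "is_norm (dual_tensor_space Es F) (\<nu> Es F \<beta>)"
    and nM: "is_norm (dual_tensor_space Ms N) (\<nu> Ms N \<theta>)"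
begin

private abbreviation (input) "tensor_map f g \<equiv> lin2 (forms Es) F (dual_tensor_space Ms N)
  (\<lambda>\<phi> y. elementary2 (forms Ms) N (f \<phi>) (g y))"

text \<open>(D3) is applied to \<open>S\<close> and to the operator on forms dual to
  \<open>R\<close>, and the resulting bound is read at the tensor \<open>u\<close> of
  \<open>T\<close>; \<open>op_norm_dual\<close> replaces the norm of \<open>f\<close> by that of the
  linearization of \<open>R\<close>.\<close>

lemma transport_dual_to_ideal:
  assumes dual: "\<And>f g. preserves_Sigma Es \<beta> Ms \<theta> f \<Longrightarrow> g \<in> linear_maps F N \<Longrightarrow>
      op_norm (normed_dual_tensor \<nu> Es F \<beta>) (normed_dual_tensor \<nu> Ms N \<theta>) (tensor_map f g)
        \<le> op_norm (forms_space Es \<beta>) (forms_space Ms \<theta>) f * op_norm F N g"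
    and R: "Sigma_operator Ms \<theta> Es \<beta> R" and T: "T \<in> \<A> Es F \<beta>" and S: "S \<in> linear_maps F N"
  shows "(\<lambda>x\<in>tuples Ms. S (Sigma_map Es F T (R x))) \<in> \<A> Ms N \<theta>"
    and "A Ms N \<theta> (\<lambda>x\<in>tuples Ms. S (Sigma_map Es F T (R x)))
      \<le> op_norm (normed_tensor Ms \<theta>) (normed_tensor Es \<beta>) (lin Ms (tensor_space Es) R)
        * A Es F \<beta> T * op_norm F N S"
proof -
  note EF = electionD[OF eE] and MN = electionD[OF eM]
  have R': "R \<in> multilinear_maps Ms (tensor_space Es)" "\<forall>m\<in>tuples Ms. R m \<in> Sigma_set Es"
    using R by (auto simp: Sigma_operator_def)
  obtain f where f: "preserves_Sigma Es \<beta> Ms \<theta> f"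
    "\<forall>m\<in>tuples Ms. \<forall>\<phi>\<in>multilinear_forms Es. R m \<phi> = f \<phi> m"
    using form_of_tensor_map[OF EF(1) MN(1) R'] by blast
  have f_lin: "f \<in> linear_maps (forms Es) (forms Ms)"
    using f(1) by (simp add: preserves_Sigma_def)
  have "T \<in> multilinear_maps Es F" using T by (simp add: all[rule_format, OF eE])
  then obtain u where u: "u \<in> carrier (dual_tensor_space Es F)" "T = identification Es F u"
    using bij_betw_imp_surj_on[OF identification_bij[OF EF(1,2)]] by blast
  note tm = identification_tensor_map[OF EF(1,3) MN(1,3) R'(1) f_lin f(2) EF(2) MN(2) R'(2) S u(1)]
  show "(\<lambda>x\<in>tuples Ms. S (Sigma_map Es F T (R x))) \<in> \<A> Ms N \<theta>"
    unfolding all[rule_format, OF eM] u(2) by (rule tm(3))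
  note nDE = fin_dim_normed_dual_tensor[OF eE nE] and nDM = fin_dim_normed_dual_tensor[OF eM nM]
  have tl: "tensor_map f S \<in> linear_maps (normed_dual_tensor \<nu> Es F \<beta>) (normed_dual_tensor \<nu> Ms N \<theta>)"
    using tm(1) by simp
  have tu: "tensor_map f S u \<in> carrier (dual_tensor_space Ms N)" by (rule linear_mapsD(1)[OF tm(1) u(1)])
  have "A Ms N \<theta> (\<lambda>x\<in>tuples Ms. S (Sigma_map Es F T (R x))) = \<nu> Ms N \<theta> (tensor_map f S u)"
    unfolding \<nu>_A[rule_format, OF eM tu] tm(2) u(2) ..
  also have "\<dots> \<le> op_norm (normed_dual_tensor \<nu> Es F \<beta>) (normed_dual_tensor \<nu> Ms N \<theta>) (tensor_map f S)
      * \<nu> Es F \<beta> u"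
    using op_norm_bound[OF fin_dimD(2)[OF nDE] fin_dimD(2)[OF nDM] tl
        fin_dim_linear_bounded[OF nDE fin_dimD(2)[OF nDM] tl], of u] u(1)
    by simp
  also have "\<dots> \<le> (op_norm (forms_space Es \<beta>) (forms_space Ms \<theta>) f * op_norm F N S) * \<nu> Es F \<beta> u"
    using nE u(1) by (intro mult_right_mono[OF dual[OF f(1) S]]) (simp add: is_norm_def)
  also have "\<dots> = op_norm (normed_tensor Ms \<theta>) (normed_tensor Es \<beta>) (lin Ms (tensor_space Es) R)
        * A Es F \<beta> T * op_norm F N S"
    unfolding op_norm_dual[OF EF(1,3) MN(1,3) R'(1) f_lin f(2)] \<nu>_A[rule_format, OF eE u(1)] u(2)
    by (simp only: mult_ac)
  finally show "A Ms N \<theta> (\<lambda>x\<in>tuples Ms. S (Sigma_map Es F T (R x)))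
      \<le> op_norm (normed_tensor Ms \<theta>) (normed_tensor Es \<beta>) (lin Ms (tensor_space Es) R)
        * A Es F \<beta> T * op_norm F N S" .
qed

text \<open>The map \<open>R\<close> dual to \<open>f\<close> is a \<Sigma>-operator, its
  linearization being bounded by finite dimension. Then (I3) bounds \<open>f \<otimes> g\<close> at
  every \<open>u\<close>, and so bounds its operator norm.\<close>

lemma transport_ideal_to_dual:
  assumes ideal: "\<And>R T S. Sigma_operator Ms \<theta> Es \<beta> R \<Longrightarrow> T \<in> \<A> Es F \<beta> \<Longrightarrow> S \<in> linear_maps F N \<Longrightarrow>
      A Ms N \<theta> (\<lambda>x\<in>tuples Ms. S (Sigma_map Es F T (R x)))
      \<le> op_norm (normed_tensor Ms \<theta>) (normed_tensor Es \<beta>) (lin Ms (tensor_space Es) R)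
        * A Es F \<beta> T * op_norm F N S"
    and f: "preserves_Sigma Es \<beta> Ms \<theta> f" and g: "g \<in> linear_maps F N"
  shows "op_norm (normed_dual_tensor \<nu> Es F \<beta>) (normed_dual_tensor \<nu> Ms N \<theta>) (tensor_map f g)
        \<le> op_norm (forms_space Es \<beta>) (forms_space Ms \<theta>) f * op_norm F N g"
proof -
  note EF = electionD[OF eE] and MN = electionD[OF eM]
  obtain R where R: "R \<in> multilinear_maps Ms (tensor_space Es)" "\<forall>m\<in>tuples Ms. R m \<in> Sigma_set Es"
    "\<forall>m\<in>tuples Ms. \<forall>\<phi>\<in>multilinear_forms Es. R m \<phi> = f \<phi> m"
    using tensor_map_of_form[OF EF(1) MN(1) f] by blast
  have f_lin: "f \<in> linear_maps (forms Es) (forms Ms)"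
    using f by (simp add: preserves_Sigma_def)
  have f_lin': "f \<in> linear_maps (forms_space Es \<beta>) (forms_space Ms \<theta>)" using f_lin by simp
  have "lin Ms (tensor_space Es) R \<in> linear_maps (normed_tensor Ms \<theta>) (normed_tensor Es \<beta>)"
    using lin_props(1)[OF MN(1) separated_tensor_space R(1)] by simp
  then have "Sigma_operator Ms \<theta> Es \<beta> R"
    using R fin_dim_linear_bounded[OF fin_dim_normed_tensor[OF MN(1,3)]
        fin_dimD(2)[OF fin_dim_normed_tensor[OF EF(1,3)]]]
    by (simp add: Sigma_operator_def)
  note ideal = ideal[OF this _ g]
  note nDE = fin_dim_normed_dual_tensor[OF eE nE] and nDM = fin_dim_normed_dual_tensor[OF eM nM]
  note FM = fin_dim_forms_space[OF MN(1,3)] and FE = fin_dim_forms_space[OF EF(1,3)]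
  have nonneg: "0 \<le> op_norm (forms_space Es \<beta>) (forms_space Ms \<theta>) f" "0 \<le> op_norm F N g"
    by (rule op_norm_nonneg[OF fin_dimD(2)[OF FE] fin_dimD(2)[OF FM] f_lin'
          fin_dim_linear_bounded[OF FE fin_dimD(2)[OF FM] f_lin']])
      (rule op_norm_nonneg[OF fin_dimD(2)[OF EF(2)] fin_dimD(2)[OF MN(2)] g
          fin_dim_linear_bounded[OF EF(2) fin_dimD(2)[OF MN(2)] g]])
  show ?thesis
  proof (rule op_norm_le[OF fin_dimD(2)[OF nDE] fin_dimD(2)[OF nDM] mult_nonneg_nonneg[OF nonneg]])
    fix u assume "u \<in> carrier (normed_dual_tensor \<nu> Es F \<beta>)"
    then have u: "u \<in> carrier (dual_tensor_space Es F)" by simp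
    note tm = identification_tensor_map[OF EF(1,3) MN(1,3) R(1) f_lin R(3) EF(2) MN(2) R(2) g u]
    have T: "identification Es F u \<in> \<A> Es F \<beta>"
      using linear_mapsD(1)[OF identification_linear[OF EF(1,2)] u] by (simp add: all[rule_format, OF eE])
    have tu: "tensor_map f g u \<in> carrier (dual_tensor_space Ms N)" by (rule linear_mapsD(1)[OF tm(1) u])
    have "\<nu> Ms N \<theta> (tensor_map f g u)
        \<le> op_norm (forms_space Es \<beta>) (forms_space Ms \<theta>) f * \<nu> Es F \<beta> u * op_norm F N g"
      using ideal[OF T]
      unfolding \<nu>_A[rule_format, OF eM tu] tm(2) \<nu>_A[rule_format, OF eE u] op_norm_dual[OF EF(1,3) MN(1,3) R(1) f_lin R(3)] .
    then show "vnorm (normed_dual_tensor \<nu> Ms N \<theta>) (tensor_map f g u)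
        \<le> op_norm (forms_space Es \<beta>) (forms_space Ms \<theta>) f * op_norm F N g * vnorm (normed_dual_tensor \<nu> Es F \<beta>) u"
      by (simp add: mult_ac)
  qed
qed

end

section \<open>Assembling the axioms\<close>

lemma Sigma_ideal_of_dual_norm:
  assumes "Sigma_tensor_norm_on_duals \<nu>"
  shows "Sigma_ideal \<A> A"
proof -
  note dual = assms[unfolded Sigma_tensor_norm_on_duals_def]
  note D0 = dual[THEN conjunct1, rule_format]
    and D1 = dual[THEN conjunct2, THEN conjunct1, rule_format]
    and D2 = dual[THEN conjunct2, THEN conjunct2, THEN conjunct1, rule_format]
    and D3 = dual[THEN conjunct2, THEN conjunct2, THEN conjunct2, rule_format]
  show ?thesis
    unfolding Sigma_ideal_def
  proof (intro conjI allI impI ballI)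
    fix Es and F :: "('k, 'a) normed_space" and \<beta> assume e: "election Es F \<beta>"
    show "submodule (\<A> Es F \<beta>) scalar_ring (multilinear_space Es F)"
      "is_norm (component \<A> A Es F \<beta>) (A Es F \<beta>)" "is_complete (component \<A> A Es F \<beta>)"
      by (rule transport_space[OF e D0[OF e]])+
    show "Lip Es \<beta> F (Sigma_map Es F T) \<le> A Es F \<beta> T" if "T \<in> \<A> Es F \<beta>" for T
      using transport_Lipschitz[OF e D0[OF e]] D2[OF e] that by blast
    fix \<phi> y assume "\<phi> \<in> carrier (forms_space Es \<beta>)" and y: "y \<in> carrier F"
    then have \<phi>: "\<phi> \<in> multilinear_forms Es" by simp
    show "form_times_vector Es F \<phi> y \<in> \<A> Es F \<beta>" by (rule transport_elementary(1)[OF e \<phi> y])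
    show "A Es F \<beta> (form_times_vector Es F \<phi> y) \<le> vnorm (forms_space Es \<beta>) \<phi> * vnorm F y"
      using D1[OF e \<open>\<phi> \<in> carrier (forms_space Es \<beta>)\<close> y] unfolding transport_elementary(2)[OF e \<phi> y] .
  next
    fix Es Ms and F N :: "('k, 'a) normed_space" and \<beta> \<theta> R T S
    assume e: "election Es F \<beta>" "election Ms N \<theta>"
      and R: "Sigma_operator Ms \<theta> Es \<beta> R" "T \<in> \<A> Es F \<beta>" "S \<in> linear_maps F N"
    show "(\<lambda>x\<in>tuples Ms. S (Sigma_map Es F T (R x))) \<in> \<A> Ms N \<theta>"
      "A Ms N \<theta> (\<lambda>x\<in>tuples Ms. S (Sigma_map Es F T (R x)))
          \<le> op_norm (normed_tensor Ms \<theta>) (normed_tensor Es \<beta>) (lin Ms (tensor_space Es) R)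
             * A Es F \<beta> T * op_norm F N S"
      by (rule transport_dual_to_ideal[OF e D0[OF e(1)] D0[OF e(2)] D3[OF e] R]; assumption)+
  qed
qed

lemma dual_norm_of_Sigma_ideal:
  assumes "Sigma_ideal \<A> A"
  shows "Sigma_tensor_norm_on_duals \<nu>"
proof -
  note ideal = assms[unfolded Sigma_ideal_def]
  note I1 = ideal[THEN conjunct2, THEN conjunct1, rule_format, THEN conjunct2]
    and I2 = ideal[THEN conjunct2, THEN conjunct2, THEN conjunct1, rule_format]
    and I3 = ideal[THEN conjunct2, THEN conjunct2, THEN conjunct2, rule_format, THEN conjunct2]
  have I0: "is_norm (dual_tensor_space Es F) (\<nu> Es F \<beta>)" if e: "election Es F \<beta>" for Es F \<beta>
    using ideal[THEN conjunct1, rule_format, OF e] transport_is_norm[OF e]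
    by (simp add: component_multilinear[of \<A>, OF all[rule_format, OF e]])
  show ?thesis
    unfolding Sigma_tensor_norm_on_duals_def
  proof (intro conjI allI impI ballI)
    fix Es and F :: "('k, 'a) normed_space" and \<beta> assume e: "election Es F \<beta>"
    show "is_norm (dual_tensor_space Es F) (\<nu> Es F \<beta>)" by (rule I0[OF e])
    show "op_norm (normed_dual_tensor \<nu> Es F \<beta>) scalar_space
      (lin2 (forms Es) F scalar_space
         (\<lambda>\<phi> y. (Sigma_map Es scalar_space \<phi> p - Sigma_map Es scalar_space \<phi> q) * y' y))
      \<le> \<beta> (p \<ominus>\<^bsub>tensor_space Es\<^esub> q) * op_norm F scalar_space y'"
      if "p \<in> Sigma_set Es" "q \<in> Sigma_set Es" "y' \<in> linear_maps F scalar_space" for p q y'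
      using transport_Lipschitz[OF e I0[OF e]] I2[OF e] that by blast
    fix \<phi> y assume \<phi>: "\<phi> \<in> carrier (forms_space Es \<beta>)" and y: "y \<in> carrier F"
    have \<phi>': "\<phi> \<in> multilinear_forms Es" using \<phi> by simp
    show "\<nu> Es F \<beta> (elementary2 (forms Es) F \<phi> y)
        \<le> vnorm (forms_space Es \<beta>) \<phi> * vnorm F y"
      unfolding transport_elementary(2)[OF e \<phi>' y] by (rule I1[OF e \<phi> y])
  next
    fix Es Ms and F N :: "('k, 'a) normed_space" and \<beta> \<theta> f g
    assume e: "election Es F \<beta>" "election Ms N \<theta>"
      and f: "preserves_Sigma Es \<beta> Ms \<theta> f" "g \<in> linear_maps F N"
    show "op_norm (normed_dual_tensor \<nu> Es F \<beta>) (normed_dual_tensor \<nu> Ms N \<theta>)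
      (lin2 (forms Es) F (dual_tensor_space Ms N)
         (\<lambda>\<phi> y. elementary2 (forms Ms) N (f \<phi>) (g y)))
      \<le> op_norm (forms_space Es \<beta>) (forms_space Ms \<theta>) f * op_norm F N g"
      by (rule transport_ideal_to_dual[OF e I0[OF e(1)] I0[OF e(2)] I3[OF e] f]; assumption)
  qed
qed

end

text \<open>This supplies the hypothesis on \<open>\<A>\<close> that the transport lemmas require.
  The induction along the span of elementary tensors uses (I1) for a single tensor and the submodule
  laws for sums and multiples.\<close>

lemma Sigma_ideal_all_multilinear:
  fixes \<A> :: "('k::real_or_complex, 'a) space_assignment"
  assumes "Sigma_ideal \<A> A" and e: "election Es F \<beta>"
  shows "\<A> Es F \<beta> = multilinear_maps Es F"
proof
  note EF = electionD(1,2)[OF e]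
  let ?MF = "multilinear_space Es F"
  have sub: "submodule (\<A> Es F \<beta>) scalar_ring ?MF"
    and mem: "\<And>\<phi> y. \<phi> \<in> multilinear_forms Es \<Longrightarrow> y \<in> carrier F \<Longrightarrow> form_times_vector Es F \<phi> y \<in> \<A> Es F \<beta>"
    using assms(1)[unfolded Sigma_ideal_def, THEN conjunct1, rule_format, OF e]
      assms(1)[unfolded Sigma_ideal_def, THEN conjunct2, THEN conjunct1, rule_format, OF e]
    by simp_all
  interpret MF: kspace ?MF by (rule kspace_multilinear_space[OF fin_dim_kspaces[OF EF(1)] fin_dimD(1)[OF EF(2)]])
  note subD = MF.submoduleE[OF sub]
  show "\<A> Es F \<beta> \<subseteq> multilinear_maps Es F" using subD(1) by simp
  show "multilinear_maps Es F \<subseteq> \<A> Es F \<beta>"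
  proof
    fix T assume "T \<in> multilinear_maps Es F"
    then obtain u where u: "u \<in> carrier (dual_tensor_space Es F)" "T = identification Es F u"
      using bij_betw_imp_surj_on[OF identification_bij[OF EF]] by blast
      note idl = identification_linear[OF EF]
    have "identification Es F u \<in> \<A> Es F \<beta>"
      using u(1) unfolding dual_tensor_space_def tensor2_def
    proof (induction rule: evaluation_span_induct)
      case zero
      have "identification Es F \<zero>\<^bsub>dual_tensor_space Es F\<^esub> = \<zero>\<^bsub>?MF\<^esub>"
        by (rule linear_map_zero[OF _ MF.kspace_axioms idl]) (simp add: dual_tensor_space_def kspace_tensor2)
      moreover have "\<zero>\<^bsub>?MF\<^esub> \<in> \<A> Es F \<beta>"
        using subgroup.one_closed[OF submodule.axioms(1)[OF sub]] by simp
      ultimately show ?case by (simp only: dual_tensor_space_def tensor2_def evaluation_span_simps)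
    next
      case (step u a x)
      then obtain \<phi> y where x: "x = (\<phi>, y)" "\<phi> \<in> multilinear_forms Es" "y \<in> carrier F" by auto
      let ?D = "dual_tensor_space Es F"
      have D: "?D = evaluation_span (carrier (forms Es) \<times> carrier F) (bilinear_forms (forms Es) F)"
        by (simp only: dual_tensor_space_def tensor2_def)
      interpret D: kspace ?D unfolding dual_tensor_space_def by (rule kspace_tensor2)
      have el: "elementary2 (forms Es) F \<phi> y \<in> carrier ?D"
        unfolding dual_tensor_space_def using x by (intro elementary2_closed) simp_all
      have u: "u \<in> carrier ?D" using step.hyps(1) unfolding D .
      have "identification Es F (u \<oplus>\<^bsub>?D\<^esub> a \<odot>\<^bsub>?D\<^esub> elementary2 (forms Es) F \<phi> y)
          = identification Es F u \<oplus>\<^bsub>?MF\<^esub> a \<odot>\<^bsub>?MF\<^esub> form_times_vector Es F \<phi> y"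
        unfolding linear_mapsD(2)[OF idl u D.scale_closed[OF el]] linear_mapsD(3)[OF idl el]
          identification_elementary[OF EF x(2,3)] ..
      also have "\<dots> \<in> \<A> Es F \<beta>"
        by (intro subD(5) step.IH subD(4) mem x(2,3)) simp
      finally show ?case unfolding D x(1) elementary2_def .
    qed
    then show "T \<in> \<A> Es F \<beta>" using u(2) by simp
  qed
qed

theorem theorem4p12:
  fixes \<nu> :: "('k::real_or_complex, 'a) dual_norm_assignment"
    and \<A> :: "('k, 'a) space_assignment"
    and A :: "('k, 'a) norm_assignment"
  shows "(Sigma_tensor_norm_on_duals \<nu> \<longrightarrow>
           Sigma_ideal ideal_of_spaces (ideal_of_norm \<nu>) \<and>
           (\<forall>Es F \<beta>. election Es F \<beta> \<longrightarrow>
              isometric_iso (normed_dual_tensor \<nu> Es F \<beta>)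
                (component ideal_of_spaces (ideal_of_norm \<nu>) Es F \<beta>) (identification Es F))) \<and>
         (Sigma_ideal \<A> A \<longrightarrow>
           Sigma_tensor_norm_on_duals (dual_norm_of A) \<and>
           (\<forall>Es F \<beta>. election Es F \<beta> \<longrightarrow>
              isometric_iso (normed_dual_tensor (dual_norm_of A) Es F \<beta>)
                (component \<A> A Es F \<beta>) (identification Es F)))"
proof (intro conjI impI allI)
  have all: "\<forall>Es F (\<beta> :: ('k, 'a) tensor \<Rightarrow> real). election Es F \<beta> \<longrightarrow>
      ideal_of_spaces Es F \<beta> = multilinear_maps Es F"
    unfolding ideal_of_spaces_def using bij_betw_imp_surj_on[OF election_identification_bij] by blast
  \<comment> \<open>\<open>ideal_of_norm\<close> is defined by an inverse of the identification,
    which cancels by injectivity.\<close>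
  have eq: "\<forall>Es F \<beta>. election Es F \<beta> \<longrightarrow> (\<forall>u\<in>carrier (dual_tensor_space Es F).
      \<nu> Es F \<beta> u = ideal_of_norm \<nu> Es F \<beta> (identification Es F u))"
    unfolding ideal_of_norm_def
    using inv_into_f_f[OF bij_betw_imp_inj_on[OF election_identification_bij]] by metis
  show "Sigma_ideal ideal_of_spaces (ideal_of_norm \<nu>)" if "Sigma_tensor_norm_on_duals \<nu>"
    using that by (rule Sigma_ideal_of_dual_norm[OF all eq])
  show "isometric_iso (normed_dual_tensor \<nu> Es F \<beta>)
      (component ideal_of_spaces (ideal_of_norm \<nu>) Es F \<beta>) (identification Es F)"
    if "election Es F \<beta>" for Es F \<beta>
    using that by (rule transport_isometric_iso[OF all eq])
next
  assume ideal: "Sigma_ideal \<A> A"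
  then have all: "\<forall>Es F \<beta>. election Es F \<beta> \<longrightarrow> \<A> Es F \<beta> = multilinear_maps Es F"
    using Sigma_ideal_all_multilinear by blast
  have eq: "\<forall>Es F \<beta>. election Es F \<beta> \<longrightarrow> (\<forall>u\<in>carrier (dual_tensor_space Es F).
      dual_norm_of A Es F \<beta> u = A Es F \<beta> (identification Es F u))"
    by (simp add: dual_norm_of_def)
  show "Sigma_tensor_norm_on_duals (dual_norm_of A)"
    using ideal by (rule dual_norm_of_Sigma_ideal[OF all eq])
  show "isometric_iso (normed_dual_tensor (dual_norm_of A) Es F \<beta>)
      (component \<A> A Es F \<beta>) (identification Es F)"
    if "election Es F \<beta>" for Es F \<beta>
    using that by (rule transport_isometric_iso[OF all eq])
qed

end
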